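(* Let $\Sigma$ be a finite simplicial complex, let $n$ be a positive integer, and let $p^k$ be a prime power. If \[ \tilde{H}^i\big({\tt Ram}(\partial \Delta_{p^k}, \Sigma);\mathbb{Z}_p\big)=0 \quad\text{for all } i \leq (n-1)(p^k-1)-1, \] then the vertices of $\Sigma$ cannot be colored with $n$ colors in such a way that, for each color, the set of vertices receiving that color is a face of $\Sigma$.
   Context: For a finite set $V$, $\Delta_V$ denotes the simplex with vertex set $V$; $\Delta_m$ is the $(m-1)$-dimensional simplex on $\{1,\dots,m\}$, and $\partial\Delta_m$ is its boundary, i.e. the simplicial complex on vertex set $\{1,\dots,m\}$ whose faces are all proper subsets of $\{1,\dots,m\}$. For a simplicial complex $\Sigma$, $\Sigma^0$ denotes its vertex set. For finite sets $I,V$, the vertices of the polyhedral complex $\prod_{i\in I}\Delta_V$ are the functions $\eta: I\to V$, and its cells are the functions $\nu: I\to 2^V\setminus\{\emptyset\}$ (the cell $\prod_i \Delta_{\nu(i)}$). For a set $E$ of vertices, a cell $\nu$ belongs to the induced subcomplex on $E$ if every $\eta$ with $\eta(i)\in\nu(i)$ for all $i\in I$ lies in $E$. For finite simplicial complexes $\Sigma_1,\Sigma_2$, the Ramsey complex ${\tt Ram}(\Sigma_1,\Sigma_2)$ is the induced subcomplex of $\prod_{v\in\Sigma_1^0}\Delta_{\Sigma_2^0}$ on the vertex set $\{\eta:\Sigma_1^0\to\Sigma_2^0 \mid \eta^{-1}(\sigma)\in\Sigma_1 \text{ for all faces } \sigma\in\Sigma_2\}$. $\tilde H^i(\,\cdot\,;\mathbb{Z}_p)$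 denotes reduced cohomology with $\mathbb{Z}_p$ coefficients. *)

theory Defs
  imports
    "HOL-Algebra.FiniteProduct"
    "HOL-Algebra.Elementary_Groups"
    "HOL-Algebra.Product_Groups"
    "HOL-Computational_Algebra.Primes"
begin

section \<open>Finite simplicial complexes\<close>

text \<open>
  A complex is the set of its faces; the empty set is a face.
\<close>

definition finite_simplicial_complex :: "'a set set \<Rightarrow> bool" where
  "finite_simplicial_complex K \<longleftrightarrow>
     finite K \<and> (\<forall>\<sigma>\<in>K. finite \<sigma>) \<and> {} \<in> K \<and> (\<forall>\<sigma>\<in>K. \<forall>\<tau>. \<tau> \<subseteq> \<sigma> \<longrightarrow> \<tau> \<in> K)"

definition vertices :: "'a set set \<Rightarrow> 'a set" where
  "vertices K = \<Union>K"

definition boundary_simplex :: "nat \<Rightarrow> nat set set" where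
  "boundary_simplex m = {\<sigma>. \<sigma> \<subset> {1..m}}"

section \<open>Subcomplexes of products of simplices\<close>

text \<open>
  Vertices and cells of the product, over \<open>i \<in> I\<close>, of copies of the simplex on \<open>V\<close> are functions
  on \<open>I\<close>, normalised to be \<open>undefined\<close> outside \<open>I\<close>. The function \<open>\<nu>\<close> stands for the cell
  that is the product of the simplices on the sets \<open>\<nu> i\<close>; its vertices are the elements of
  \<open>Pi\<^sub>E I \<nu>\<close>.
\<close>

definition product_cells :: "'i set \<Rightarrow> 'v set \<Rightarrow> ('i \<Rightarrow> 'v set) set" where
  "product_cells I V = I \<rightarrow>\<^sub>E (Pow V - {{}})"

definition induced_subcomplex ::
    "'i set \<Rightarrow> 'v set \<Rightarrow> ('i \<Rightarrow> 'v) set \<Rightarrow> ('i \<Rightarrow> 'v set) set" where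
  "induced_subcomplex I V E = {\<nu> \<in> product_cells I V. Pi\<^sub>E I \<nu> \<subseteq> E}"

definition ramsey_vertices :: "'a set set \<Rightarrow> 'b set set \<Rightarrow> ('a \<Rightarrow> 'b) set" where
  "ramsey_vertices K L =
     {\<eta> \<in> vertices K \<rightarrow>\<^sub>E vertices L. \<forall>\<sigma>\<in>L. {v \<in> vertices K. \<eta> v \<in> \<sigma>} \<in> K}"

definition Ram :: "'a set set \<Rightarrow> 'b set set \<Rightarrow> ('a \<Rightarrow> 'b set) set" where
  "Ram K L = induced_subcomplex (vertices K) (vertices L) (ramsey_vertices K L)"

section \<open>Reduced cellular cohomology\<close>

text \<open>
  Simplices and products are oriented by an arbitrary but fixed total order on the type of
  vertices and on the type of indices. Another choice changes the orientations of the cells, and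
  so leads to an isomorphic cochain complex.
\<close>

definition fixed_less :: "'a \<Rightarrow> 'a \<Rightarrow> bool" where
  "fixed_less x y \<longleftrightarrow> x \<noteq> y \<and> (x, y) \<in> (SOME r. linear_order r)"

definition cell_dim :: "'i set \<Rightarrow> ('i \<Rightarrow> 'v set) \<Rightarrow> int" where
  "cell_dim I \<nu> = (\<Sum>i\<in>I. (int (card (\<nu> i)) - 1))"

text \<open>
  The facets of the cell \<open>\<nu>\<close> are obtained by deleting a vertex \<open>v\<close> from a set \<open>\<nu> i\<close> with at
  least two elements; they are indexed by the pairs \<open>(i, v)\<close>.
\<close>

definition facet_indices :: "'i set \<Rightarrow> ('i \<Rightarrow> 'v set) \<Rightarrow> ('i \<times> 'v) set" where
  "facet_indices I \<nu> = {(i, v). i \<in> I \<and> v \<in> \<nu> i \<and> \<nu> i \<noteq> {v}}"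

definition facet :: "('i \<Rightarrow> 'v set) \<Rightarrow> 'i \<times> 'v \<Rightarrow> ('i \<Rightarrow> 'v set)" where
  "facet \<nu> = (\<lambda>(i, v). \<nu>(i := \<nu> i - {v}))"

text \<open>
  The incidence number of a cell and a facet comes from the alternating sum formula for the
  boundary of a simplex and from the rule
  \<open>\<partial>(a \<times> b) = \<partial>a \<times> b + (-1)\<^bsup>dim a\<^esup> a \<times> \<partial>b\<close> for products.
\<close>

definition facet_exponent :: "'i set \<Rightarrow> ('i \<Rightarrow> 'v set) \<Rightarrow> 'i \<times> 'v \<Rightarrow> nat" where
  "facet_exponent I \<nu> = (\<lambda>(i, v).
     (\<Sum>j | j \<in> I \<and> fixed_less j i. card (\<nu> j) - 1) + card {w \<in> \<nu> i. fixed_less w v})"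

definition incidence :: "'i set \<Rightarrow> ('i \<Rightarrow> 'v set) \<Rightarrow> 'i \<times> 'v \<Rightarrow> int" where
  "incidence I \<nu> a = (- 1) ^ facet_exponent I \<nu> a"

text \<open>
  \<open>None\<close> is the empty face, which has dimension \<open>-1\<close> and augments the cochain complex.
\<close>

definition augmented_cells ::
    "'i set \<Rightarrow> ('i \<Rightarrow> 'v set) set \<Rightarrow> int \<Rightarrow> ('i \<Rightarrow> 'v set) option set" where
  "augmented_cells I X n =
     (if n = - 1 then {None} else Some ` {\<nu> \<in> X. cell_dim I \<nu> = n})"

definition cochain_group ::
    "'i set \<Rightarrow> ('i \<Rightarrow> 'v set) set \<Rightarrow> ('g, 'm) monoid_scheme \<Rightarrow> int
      \<Rightarrow> (('i \<Rightarrow> 'v set) option \<Rightarrow> 'g) monoid" where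
  "cochain_group I X G n = product_group (augmented_cells I X n) (\<lambda>_. G)"

text \<open>The coefficient group \<open>G\<close> is written multiplicatively, as in the library.\<close>

definition coboundary ::
    "'i set \<Rightarrow> ('i \<Rightarrow> 'v set) set \<Rightarrow> ('g, 'm) monoid_scheme \<Rightarrow> int
      \<Rightarrow> (('i \<Rightarrow> 'v set) option \<Rightarrow> 'g) \<Rightarrow> (('i \<Rightarrow> 'v set) option \<Rightarrow> 'g)" where
  "coboundary I X G n c = (\<lambda>x\<in>augmented_cells I X (n + 1).
     case x of
       None \<Rightarrow> \<one>\<^bsub>G\<^esub>
     | Some \<nu> \<Rightarrow>
         if n = - 1 then c None
         else \<Otimes>\<^bsub>G\<^esub>a\<in>facet_indices I \<nu>. c (Some (facet \<nu> a)) [^]\<^bsub>G\<^esub> incidence I \<nu> a)"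

definition cocycle_group ::
    "'i set \<Rightarrow> ('i \<Rightarrow> 'v set) set \<Rightarrow> ('g, 'm) monoid_scheme \<Rightarrow> int
      \<Rightarrow> (('i \<Rightarrow> 'v set) option \<Rightarrow> 'g) monoid" where
  "cocycle_group I X G n = subgroup_generated (cochain_group I X G n)
     (kernel (cochain_group I X G n) (cochain_group I X G (n + 1)) (coboundary I X G n))"

definition coboundary_set ::
    "'i set \<Rightarrow> ('i \<Rightarrow> 'v set) set \<Rightarrow> ('g, 'm) monoid_scheme \<Rightarrow> int
      \<Rightarrow> (('i \<Rightarrow> 'v set) option \<Rightarrow> 'g) set" where
  "coboundary_set I X G n = coboundary I X G (n - 1) ` carrier (cochain_group I X G (n - 1))"

definition reduced_cohomology_group ::
    "'i set \<Rightarrow> ('i \<Rightarrow> 'v set) set \<Rightarrow> ('g, 'm) monoid_scheme \<Rightarrow> int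
      \<Rightarrow> (('i \<Rightarrow> 'v set) option \<Rightarrow> 'g) set monoid" where
  "reduced_cohomology_group I X G n = cocycle_group I X G n Mod coboundary_set I X G n"

subsection \<open>Well-definedness\<close>

lemma linear_order_fixed: "linear_order (SOME r :: 'a rel. linear_order r)"
proof -
  obtain r :: "'a rel" where "well_order_on UNIV r"
    using well_order_on by blast
  then have "linear_order r"
    by (simp add: well_order_on_def)
  then show ?thesis
    by (rule someI)
qed

lemma fixed_less_irrefl [simp]: "\<not> fixed_less x x"
  by (simp add: fixed_less_def)

lemma fixed_less_linear: "x \<noteq> y \<Longrightarrow> fixed_less x y \<longleftrightarrow> \<not> fixed_less y x"
  using linear_order_fixed[where 'a = 'a]
  unfolding fixed_less_def linear_order_on_def partial_order_on_def total_on_def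
  by (auto dest: antisymD)

locale simplex_product_subcomplex =
  fixes I :: "'i set" and V :: "'v set" and X :: "('i \<Rightarrow> 'v set) set"
  assumes finite_I: "finite I" and finite_V: "finite V"
    and cells: "X \<subseteq> product_cells I V"
    and face_closed: "\<And>\<nu> \<mu>. \<nu> \<in> X \<Longrightarrow> \<mu> \<in> product_cells I V \<Longrightarrow> (\<forall>i\<in>I. \<mu> i \<subseteq> \<nu> i) \<Longrightarrow> \<mu> \<in> X"
begin

lemma cellD:
  assumes "\<nu> \<in> X" "i \<in> I"
  shows "\<nu> i \<subseteq> V" "\<nu> i \<noteq> {}" "finite (\<nu> i)" "card (\<nu> i) \<ge> 1"
proof -
  have *: "\<nu> i \<in> Pow V - {{}}"
    using assms cells by (auto simp: product_cells_def PiE_iff)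
  then show "\<nu> i \<subseteq> V" "\<nu> i \<noteq> {}" by auto
  then show "finite (\<nu> i)" using finite_V finite_subset by blast
  with \<open>\<nu> i \<noteq> {}\<close> show "card (\<nu> i) \<ge> 1"
    by (simp add: Suc_le_eq card_gt_0_iff)
qed

lemma facet_cell:
  assumes "\<nu> \<in> X" "a \<in> facet_indices I \<nu>"
  shows "facet \<nu> a \<in> X"
proof -
  obtain i v where a: "a = (i, v)" "i \<in> I" "v \<in> \<nu> i" "\<nu> i \<noteq> {v}"
    using assms by (auto simp: facet_indices_def)
  have "\<nu> \<in> product_cells I V" using assms cells by auto
  then have "facet \<nu> a \<in> product_cells I V"
    using a by (auto simp: product_cells_def PiE_iff facet_def extensional_def)
  then show ?thesis
    by (rule face_closed[OF assms(1)]) (use a in \<open>auto simp: facet_def\<close>)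
qed

lemma facet_dim:
  assumes "\<nu> \<in> X" "a \<in> facet_indices I \<nu>"
  shows "cell_dim I (facet \<nu> a) = cell_dim I \<nu> - 1"
proof -
  obtain i v where a: "a = (i, v)" "i \<in> I" "v \<in> \<nu> i"
    using assms by (auto simp: facet_indices_def)
  have c: "int (card (\<nu> i - {v})) = int (card (\<nu> i)) - 1"
    using a cellD[OF assms(1) a(2)] by (simp add: card_Diff_singleton of_nat_diff)
  have "(\<Sum>j\<in>I - {i}. int (card (facet \<nu> a j)) - 1) = (\<Sum>j\<in>I - {i}. int (card (\<nu> j)) - 1)"
    by (rule sum.cong) (auto simp: facet_def a)
  then show ?thesis
    unfolding cell_dim_def using a c finite_I
    by (simp add: sum.remove[of I i] facet_def)
qed

lemma cell_dim_nonneg: "\<nu> \<in> X \<Longrightarrow> cell_dim I \<nu> \<ge> 0"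
  unfolding cell_dim_def by (rule sum_nonneg) (use cellD in force)

lemma finite_facet_indices: "\<nu> \<in> X \<Longrightarrow> finite (facet_indices I \<nu>)"
proof -
  assume "\<nu> \<in> X"
  then have "facet_indices I \<nu> \<subseteq> Sigma I \<nu>" "finite (Sigma I \<nu>)"
    using cellD finite_I by (auto simp: facet_indices_def)
  then show ?thesis by (rule finite_subset)
qed

definition lex :: "'i \<times> 'v \<Rightarrow> 'i \<times> 'v \<Rightarrow> bool" where
  "lex a b \<longleftrightarrow> fixed_less (fst a) (fst b) \<or> fst a = fst b \<and> fixed_less (snd a) (snd b)"

lemma lex_linear: "a \<noteq> b \<Longrightarrow> lex a b \<longleftrightarrow> \<not> lex b a"
  unfolding lex_def
  by (cases a; cases b) (metis fixed_less_irrefl fixed_less_linear fst_conv snd_conv)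

lemma lex_irrefl [simp]: "\<not> lex a a"
  by (simp add: lex_def)

lemma facet_exponent_facet:
  assumes "\<nu> \<in> X" "a \<in> facet_indices I \<nu>" "b \<in> facet_indices I (facet \<nu> a)"
  shows "facet_exponent I \<nu> b = facet_exponent I (facet \<nu> a) b + (if lex a b then 1 else 0)"
proof -
  obtain i v where a: "a = (i, v)" "i \<in> I" "v \<in> \<nu> i" "\<nu> i \<noteq> {v}"
    using assms by (auto simp: facet_indices_def)
  obtain j w where b: "b = (j, w)" "j \<in> I" "w \<in> facet \<nu> a j"
    using assms by (auto simp: facet_indices_def)
  have fin: "finite (\<nu> i)" using cellD[OF assms(1) a(2)] by auto
  have card_i: "card (\<nu> i - {v}) = card (\<nu> i) - 1" "card (\<nu> i) \<ge> 2"
  proof -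
    show "card (\<nu> i - {v}) = card (\<nu> i) - 1" using a by simp
    have "card (\<nu> i) \<noteq> 1" using a by (auto simp: card_1_singleton_iff)
    then show "card (\<nu> i) \<ge> 2" using cellD(4)[OF assms(1) a(2)] by linarith
  qed
  let ?J = "{l \<in> I. fixed_less l j}"
  have finJ: "finite ?J" using finite_I by auto
  have S: "(\<Sum>l\<in>?J. card (\<nu> l) - 1) =
           (\<Sum>l\<in>?J. card (facet \<nu> a l) - 1) + (if fixed_less i j then 1 else 0)"
  proof (cases "fixed_less i j")
    case True
    then have i: "i \<in> ?J" using a by auto
    have "(\<Sum>l\<in>?J - {i}. card (facet \<nu> a l) - 1) = (\<Sum>l\<in>?J - {i}. card (\<nu> l) - 1)"
      by (rule sum.cong) (auto simp: facet_def a)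
    then show ?thesis
      using True card_i unfolding sum.remove[OF finJ i]
      by (simp add: facet_def a)
  next
    case False
    have "(\<Sum>l\<in>?J. card (facet \<nu> a l) - 1) = (\<Sum>l\<in>?J. card (\<nu> l) - 1)"
      by (rule sum.cong) (use False in \<open>auto simp: facet_def a\<close>)
    then show ?thesis using False by simp
  qed
  have T: "card {u \<in> \<nu> j. fixed_less u w} =
           card {u \<in> facet \<nu> a j. fixed_less u w} + (if i = j \<and> fixed_less v w then 1 else 0)"
  proof (cases "i = j \<and> fixed_less v w")
    case True
    have "{u \<in> \<nu> j. fixed_less u w} = insert v {u \<in> facet \<nu> a j. fixed_less u w}"
      using True a by (auto simp: facet_def)
    moreover have "v \<notin> {u \<in> facet \<nu> a j. fixed_less u w}" "finite {u \<in> facet \<nu> a j. fixed_less u w}"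
      using True a fin by (auto simp: facet_def)
    ultimately show ?thesis using True by simp
  next
    case False
    then have "{u \<in> \<nu> j. fixed_less u w} = {u \<in> facet \<nu> a j. fixed_less u w}"
      using a by (auto simp: facet_def)
    then show ?thesis using False by simp
  qed
  show ?thesis
    unfolding facet_exponent_def using S T
    by (auto simp: a b lex_def)
qed

lemma facet_swap:
  assumes "\<nu> \<in> X" "a \<in> facet_indices I \<nu>" "b \<in> facet_indices I (facet \<nu> a)"
  shows "b \<in> facet_indices I \<nu>" "a \<in> facet_indices I (facet \<nu> b)"
    "facet (facet \<nu> a) b = facet (facet \<nu> b) a" "a \<noteq> b"
proof -
  obtain i v where a: "a = (i, v)" "i \<in> I" "v \<in> \<nu> i" "\<nu> i \<noteq> {v}"
    using assms by (auto simp: facet_indices_def)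
  obtain j w where b: "b = (j, w)" "j \<in> I" "w \<in> facet \<nu> a j" "facet \<nu> a j \<noteq> {w}"
    using assms by (auto simp: facet_indices_def)
  show "b \<in> facet_indices I \<nu>" "a \<in> facet_indices I (facet \<nu> b)" "a \<noteq> b"
    using a b by (cases "i = j"; fastforce simp: facet_indices_def facet_def)+
  show "facet (facet \<nu> a) b = facet (facet \<nu> b) a"
    by (rule ext) (auto simp: a b facet_def)
qed

lemma incidence_swap:
  assumes "\<nu> \<in> X" "a \<in> facet_indices I \<nu>" "b \<in> facet_indices I (facet \<nu> a)"
  shows "incidence I \<nu> a * incidence I (facet \<nu> a) b = - (incidence I \<nu> b * incidence I (facet \<nu> b) a)"
proof -
  note s = facet_swap[OF assms]
  have 1: "facet_exponent I \<nu> b = facet_exponent I (facet \<nu> a) b + (if lex a b then 1 else 0)"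
    by (rule facet_exponent_facet[OF assms])
  have 2: "facet_exponent I \<nu> a = facet_exponent I (facet \<nu> b) a + (if lex b a then 1 else 0)"
    by (rule facet_exponent_facet[OF assms(1) s(1,2)])
  show ?thesis
    unfolding incidence_def 1 2 using lex_linear[OF s(4)] by auto
qed

end

lemma (in comm_group) finprod_Sigma:
  assumes "finite A" "\<And>a. a \<in> A \<Longrightarrow> finite (B a)"
    "\<And>a b. a \<in> A \<Longrightarrow> b \<in> B a \<Longrightarrow> f (a, b) \<in> carrier G"
  shows "(\<Otimes>a\<in>A. \<Otimes>b\<in>B a. f (a, b)) = (\<Otimes>x\<in>Sigma A B. f x)"
proof -
  have "(\<Otimes>x\<in>Sigma A B. f x) = (\<Otimes>x\<in>(\<Union>a\<in>A. Pair a ` B a). f x)"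
    by (rule arg_cong[where f = "finprod G f"]) auto
  also have "\<dots> = (\<Otimes>a\<in>A. finprod G f (Pair a ` B a))"
    by (rule finprod_UN_disjoint) (use assms in \<open>auto simp: pairwise_def disjnt_def\<close>)
  also have "\<dots> = (\<Otimes>a\<in>A. \<Otimes>b\<in>B a. f (a, b))"
  proof (rule finprod_cong')
    show "(\<lambda>a. \<Otimes>b\<in>B a. f (a, b)) \<in> A \<rightarrow> carrier G"
      using assms(3) by (auto intro!: finprod_closed)
    show "finprod G f (Pair a ` B a) = (\<Otimes>b\<in>B a. f (a, b))" if "a \<in> A" for a
      by (rule finprod_reindex) (use assms(3)[OF that] in \<open>auto simp: inj_on_def\<close>)
  qed simp
  finally show ?thesis by simp
qed

lemma (in comm_group) finprod_cancel:
  assumes "finite P" "f \<in> P \<rightarrow> carrier G" "\<And>x. x \<in> P \<Longrightarrow> s x \<in> P \<and> s (s x) = x \<and> (h (s x) \<longleftrightarrow> \<not> h x)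
             \<and> f (s x) = inv (f x)"
  shows "(\<Otimes>x\<in>P. f x) = \<one>"
proof -
  let ?A = "{x \<in> P. h x}" and ?B = "{x \<in> P. \<not> h x}"
  have s: "s x \<in> P" "s (s x) = x" "h (s x) \<longleftrightarrow> \<not> h x" "f (s x) = inv (f x)" if "x \<in> P" for x
    using assms(3)[OF that] by auto
  have f: "f x \<in> carrier G" if "x \<in> P" for x
    using assms(2) that by auto
  have B: "?B = s ` ?A"
  proof
    show "?B \<subseteq> s ` ?A"
    proof
      fix x assume "x \<in> ?B"
      then have "s x \<in> ?A" "x = s (s x)" using s[of x] by auto
      then show "x \<in> s ` ?A" by (rule rev_image_eqI)
    qed
    show "s ` ?A \<subseteq> ?B" using s(1,3) by blast
  qed
  have inj: "inj_on s ?A"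
    by (rule inj_on_inverseI[where g = s]) (use s(2) in blast)
  have fA: "f \<in> ?A \<rightarrow> carrier G" "f \<in> ?B \<rightarrow> carrier G" "(\<lambda>x. f (s x)) \<in> ?A \<rightarrow> carrier G"
    using f s(1) by blast+
  have "(\<Otimes>x\<in>P. f x) = (\<Otimes>x\<in>?A \<union> ?B. f x)"
    by (rule arg_cong[where f = "finprod G f"]) blast
  also have "\<dots> = (\<Otimes>x\<in>?A. f x) \<otimes> (\<Otimes>x\<in>?B. f x)"
    by (rule finprod_Un_disjoint) (use assms(1) fA in auto)
  also have "(\<Otimes>x\<in>?B. f x) = (\<Otimes>x\<in>?A. f (s x))"
    unfolding B by (rule finprod_reindex) (use fA(2) inj B in auto)
  also have "(\<Otimes>x\<in>?A. f x) \<otimes> \<dots> = (\<Otimes>x\<in>?A. f x \<otimes> f (s x))"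
    by (rule finprod_multf[symmetric]) (use fA in auto)
  also have "\<dots> = \<one>"
  proof (rule finprod_one_eqI)
    fix x assume "x \<in> ?A"
    then show "f x \<otimes> f (s x) = \<one>" using f[of x] s(4)[of x] by simp
  qed
  finally show ?thesis .
qed

lemma (in comm_group) int_pow_finprod:
  "f \<in> A \<rightarrow> carrier G \<Longrightarrow> (\<Otimes>x\<in>A. f x) [^] (k::int) = (\<Otimes>x\<in>A. f x [^] k)"
proof (induction A rule: infinite_finite_induct)
  case (insert x A)
  then have "f \<in> A \<rightarrow> carrier G" "f x \<in> carrier G" by auto
  with insert show ?case by (simp add: Pi_def int_pow_distrib)
qed auto

locale simplex_product_cochains = simplex_product_subcomplex I V X + comm_group G
  for I :: "'i set" and V :: "'v set" and X and G (structure)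
begin

abbreviation "C \<equiv> cochain_group I X G"
abbreviation "d \<equiv> coboundary I X G"

lemma comm_group_cochain: "comm_group (C n)"
  unfolding cochain_group_def
  by (rule group.group_comm_groupI)
    (auto simp: group_axioms PiE_iff m_comm cong: restrict_cong)

lemma cochain_closed:
  assumes "c \<in> carrier (C n)" "x \<in> augmented_cells I X n"
  shows "c x \<in> carrier G"
  using assms by (auto simp: cochain_group_def PiE_iff)

lemma facet_augmented:
  assumes "Some \<nu> \<in> augmented_cells I X (n + 1)" "n \<noteq> - 1" "a \<in> facet_indices I \<nu>"
  shows "Some (facet \<nu> a) \<in> augmented_cells I X n"
proof -
  have "\<nu> \<in> X" "cell_dim I \<nu> = n + 1"
    using assms(1) by (auto simp: augmented_cells_def split: if_splits)
  then show ?thesis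
    using assms(2) facet_cell[OF _ assms(3)] facet_dim[OF _ assms(3)]
    by (simp add: augmented_cells_def)
qed

lemma Some_augmented: "Some \<nu> \<in> augmented_cells I X n \<Longrightarrow> \<nu> \<in> X \<and> cell_dim I \<nu> = n"
  by (auto simp: augmented_cells_def split: if_splits)

lemma coboundary_term_closed:
  assumes "c \<in> carrier (C n)" "Some \<nu> \<in> augmented_cells I X (n + 1)" "n \<noteq> - 1" "a \<in> facet_indices I \<nu>"
  shows "c (Some (facet \<nu> a)) \<in> carrier G"
  using cochain_closed[OF assms(1) facet_augmented[OF assms(2,3,4)]] .

lemma coboundary_closed:
  assumes "c \<in> carrier (C n)"
  shows "d n c \<in> carrier (C (n + 1))"
proof -
  have "d n c x \<in> carrier G" if x: "x \<in> augmented_cells I X (n + 1)" for x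
  proof (cases x)
    case (Some \<nu>)
    then show ?thesis
      using x cochain_closed[OF assms, of None] coboundary_term_closed[OF assms, of \<nu>]
      by (auto simp: coboundary_def augmented_cells_def[of I X "-1"] intro!: finprod_closed)
  qed (use x in \<open>auto simp: coboundary_def\<close>)
  then show ?thesis
    by (simp add: cochain_group_def coboundary_def PiE_iff)
qed

lemma coboundary_hom: "group_hom (C n) (C (n + 1)) (d n)"
proof -
  have "d n (c \<otimes>\<^bsub>C n\<^esub> e) = d n c \<otimes>\<^bsub>C (n + 1)\<^esub> d n e"
    if c: "c \<in> carrier (C n)" and e: "e \<in> carrier (C n)" for c e
  proof (rule ext)
    fix x
    show "d n (c \<otimes>\<^bsub>C n\<^esub> e) x = (d n c \<otimes>\<^bsub>C (n + 1)\<^esub> d n e) x"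
    proof (cases "x \<in> augmented_cells I X (n + 1)")
      case False
      then show ?thesis by (simp add: coboundary_def cochain_group_def)
    next
      case x: True
      show ?thesis
      proof (cases x)
        case None
        then show ?thesis using x by (simp add: coboundary_def cochain_group_def)
      next
        case (Some \<nu>)
        show ?thesis
        proof (cases "n = - 1")
          case True
          then show ?thesis using x Some
            by (simp add: coboundary_def cochain_group_def augmented_cells_def[of I X "-1"])
        next
          case False
          have xs: "Some \<nu> \<in> augmented_cells I X (n + 1)" using x Some by simp
          note cl = coboundary_term_closed[OF _ xs False]
          have "(\<Otimes>a\<in>facet_indices I \<nu>. (c \<otimes>\<^bsub>C n\<^esub> e) (Some (facet \<nu> a)) [^] incidence I \<nu> a) =
                (\<Otimes>a\<in>facet_indices I \<nu>. (c (Some (facet \<nu> a)) [^] incidence I \<nu> a)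
                   \<otimes> (e (Some (facet \<nu> a)) [^] incidence I \<nu> a))"
            by (rule finprod_cong')
              (use cl[OF c] cl[OF e] facet_augmented[OF xs False] in
                \<open>auto simp: cochain_group_def int_pow_distrib\<close>)
          also have "\<dots> = (\<Otimes>a\<in>facet_indices I \<nu>. c (Some (facet \<nu> a)) [^] incidence I \<nu> a)
                \<otimes> (\<Otimes>a\<in>facet_indices I \<nu>. e (Some (facet \<nu> a)) [^] incidence I \<nu> a)"
            by (rule finprod_multf) (use cl[OF c] cl[OF e] in auto)
          finally show ?thesis using x Some False
            by (simp add: coboundary_def cochain_group_def)
        qed
      qed
    qed
  qed
  then show ?thesis
    using comm_group_cochain coboundary_closed
    by (auto simp: group_hom_def group_hom_axioms_def hom_def comm_group_def)
qed

lemma coboundary_squared: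
  assumes c: "c \<in> carrier (C n)" and x: "x \<in> augmented_cells I X (n + 1 + 1)"
  shows "d (n + 1) (d n c) x = \<one>"
proof (cases x)
  case None
  then show ?thesis using x by (simp add: coboundary_def)
next
  case (Some \<nu>)
  have xs: "Some \<nu> \<in> augmented_cells I X (n + 1 + 1)" using x Some by simp
  then have \<nu>: "\<nu> \<in> X" and dim: "cell_dim I \<nu> = n + 1 + 1" using Some_augmented by auto
  show ?thesis
  proof (cases "n = - 2")
    case True
    then show ?thesis using x Some
      by (simp add: coboundary_def augmented_cells_def[of I X "-1"])
  next
    case n2: False
    then have n1: "n + 1 \<noteq> - 1" by simp
    have mem: "Some (facet \<nu> a) \<in> augmented_cells I X (n + 1)" if "a \<in> facet_indices I \<nu>" for a
      by (rule facet_augmented[OF xs n1 that])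
    have lhs: "d (n + 1) (d n c) x =
        (\<Otimes>a\<in>facet_indices I \<nu>. d n c (Some (facet \<nu> a)) [^] incidence I \<nu> a)"
      using x Some n1 by (simp add: coboundary_def[of I X G "n + 1"])
    show ?thesis
    proof (cases "n = - 1")
      case False
      let ?f = "\<lambda>(a, b). c (Some (facet (facet \<nu> a) b)) [^] (incidence I \<nu> a * incidence I (facet \<nu> a) b)"
      let ?P = "Sigma (facet_indices I \<nu>) (\<lambda>a. facet_indices I (facet \<nu> a))"
      have cl: "c (Some (facet (facet \<nu> a) b)) \<in> carrier G"
        if "a \<in> facet_indices I \<nu>" "b \<in> facet_indices I (facet \<nu> a)" for a b
        using coboundary_term_closed[OF c mem[OF that(1)] False that(2)] .
      have fin: "finite (facet_indices I \<nu>)"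
        "\<And>a. a \<in> facet_indices I \<nu> \<Longrightarrow> finite (facet_indices I (facet \<nu> a))"
        using finite_facet_indices \<nu> facet_cell by auto
      have "d (n + 1) (d n c) x =
          (\<Otimes>a\<in>facet_indices I \<nu>. \<Otimes>b\<in>facet_indices I (facet \<nu> a). ?f (a, b))"
        unfolding lhs
      proof (rule finprod_cong')
        fix a assume a: "a \<in> facet_indices I \<nu>"
        have "d n c (Some (facet \<nu> a)) [^] incidence I \<nu> a =
          (\<Otimes>b\<in>facet_indices I (facet \<nu> a).
             c (Some (facet (facet \<nu> a) b)) [^] incidence I (facet \<nu> a) b) [^] incidence I \<nu> a"
          using mem[OF a] False by (simp add: coboundary_def)
        also have "\<dots> = (\<Otimes>b\<in>facet_indices I (facet \<nu> a).
             (c (Some (facet (facet \<nu> a) b)) [^] incidence I (facet \<nu> a) b) [^] incidence I \<nu> a)"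
          by (rule int_pow_finprod) (use cl[OF a] in auto)
        also have "\<dots> = (\<Otimes>b\<in>facet_indices I (facet \<nu> a). ?f (a, b))"
          by (rule finprod_cong') (use cl[OF a] in \<open>auto simp: int_pow_pow mult.commute\<close>)
        finally show "d n c (Some (facet \<nu> a)) [^] incidence I \<nu> a =
          (\<Otimes>b\<in>facet_indices I (facet \<nu> a). ?f (a, b))" .
      qed (use cl in \<open>auto intro!: finprod_closed\<close>)
      also have "\<dots> = (\<Otimes>y\<in>?P. ?f y)"
        by (rule finprod_Sigma) (use fin cl in auto)
      also have "\<dots> = \<one>"
      proof (rule finprod_cancel[where s = prod.swap and h = "\<lambda>(a, b). lex a b"])
        show "finite ?P" using fin by auto
        show "?f \<in> ?P \<rightarrow> carrier G" using cl by auto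
        fix y assume "y \<in> ?P"
        then obtain a b where y: "y = (a, b)" and ab: "a \<in> facet_indices I \<nu>" "b \<in> facet_indices I (facet \<nu> a)"
          by auto
        note s = facet_swap[OF \<nu> ab]
        show "prod.swap y \<in> ?P \<and> prod.swap (prod.swap y) = y \<and>
              ((case prod.swap y of (a, b) \<Rightarrow> lex a b) \<longleftrightarrow> \<not> (case y of (a, b) \<Rightarrow> lex a b)) \<and>
              ?f (prod.swap y) = inv (?f y)"
          using s lex_linear[OF s(4)] cl[OF ab] incidence_swap[OF \<nu> ab]
          by (auto simp: y int_pow_neg)
      qed
      finally show ?thesis .
    next
      case True
      let ?f = "\<lambda>a. c None [^] incidence I \<nu> a"
      have cN: "c None \<in> carrier G"
        by (rule cochain_closed[OF c]) (simp add: True augmented_cells_def)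
      have d1: "cell_dim I \<nu> = 1" using dim True by simp
      obtain i where i: "i \<in> I" "card (\<nu> i) = 2" "\<And>j. j \<in> I \<Longrightarrow> j \<noteq> i \<Longrightarrow> card (\<nu> j) = 1"
      proof -
        have nn: "int (card (\<nu> j)) - 1 \<ge> 0" if "j \<in> I" for j
          using cellD(4)[OF \<nu> that] by linarith
        obtain i where i: "i \<in> I" "int (card (\<nu> i)) - 1 \<noteq> 0"
          using d1 sum.neutral[of I "\<lambda>j. int (card (\<nu> j)) - 1"] unfolding cell_dim_def by fastforce
        have "(\<Sum>j\<in>I. int (card (\<nu> j)) - 1) =
              (int (card (\<nu> i)) - 1) + (\<Sum>j\<in>I - {i}. int (card (\<nu> j)) - 1)"
          using finite_I i by (simp add: sum.remove)
        moreover have "(\<Sum>j\<in>I - {i}. int (card (\<nu> j)) - 1) \<ge> 0"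
          by (rule sum_nonneg) (use nn in auto)
        ultimately have *: "int (card (\<nu> i)) - 1 = 1" "(\<Sum>j\<in>I - {i}. int (card (\<nu> j)) - 1) = 0"
          using d1 i nn[OF i(1)] unfolding cell_dim_def by linarith+
        then have "\<forall>j\<in>I - {i}. int (card (\<nu> j)) - 1 = 0"
          using sum_nonneg_eq_0_iff[of "I - {i}" "\<lambda>j. int (card (\<nu> j)) - 1"] nn finite_I by auto
        then have "card (\<nu> j) = 1" if "j \<in> I" "j \<noteq> i" for j
          using that by fastforce
        moreover have "card (\<nu> i) = 2" using *(1) by linarith
        ultimately show ?thesis using that i(1) by blast
      qed
      obtain v w where vw: "\<nu> i = {v, w}" "v \<noteq> w"
        using i(2) by (auto simp: card_2_iff)
      have single: "\<nu> j = {u}" if "j \<in> I" "j \<noteq> i" "u \<in> \<nu> j" for j u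
        using i(3)[OF that(1,2)] that(3) by (auto simp: card_1_singleton_iff)
      have F: "facet_indices I \<nu> = {(i, v), (i, w)}"
        using i(1) vw single by (auto simp: facet_indices_def)
      have inc: "incidence I \<nu> (i, v) = - incidence I \<nu> (i, w)"
      proof (cases "fixed_less v w")
        case True
        then have *: "{u \<in> \<nu> i. fixed_less u w} = {v}" "{u \<in> \<nu> i. fixed_less u v} = {}"
          using vw fixed_less_linear[OF vw(2)] by auto
        show ?thesis unfolding incidence_def facet_exponent_def prod.case * by simp
      next
        case False
        then have *: "{u \<in> \<nu> i. fixed_less u v} = {w}" "{u \<in> \<nu> i. fixed_less u w} = {}"
          using vw fixed_less_linear[OF vw(2)] by auto
        show ?thesis unfolding incidence_def facet_exponent_def prod.case * by simp
      qed
      have "d (n + 1) (d n c) x = (\<Otimes>a\<in>facet_indices I \<nu>. ?f a)"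
        unfolding lhs
        by (rule finprod_cong') (use mem True cN in \<open>auto simp: coboundary_def\<close>)
      also have "\<dots> = ?f (i, v) \<otimes> ?f (i, w)"
        using cN vw by (simp add: F)
      also have "\<dots> = \<one>"
        using cN by (simp add: inc int_pow_neg)
      finally show ?thesis .
    qed
  qed
qed

theorem coboundary_coboundary:
  assumes "c \<in> carrier (C n)"
  shows "d (n + 1) (d n c) = \<one>\<^bsub>C (n + 1 + 1)\<^esub>"
proof (rule ext)
  fix x
  show "d (n + 1) (d n c) x = \<one>\<^bsub>C (n + 1 + 1)\<^esub> x"
  proof (cases "x \<in> augmented_cells I X (n + 1 + 1)")
    case True
    then show ?thesis using coboundary_squared[OF assms True] by (simp add: cochain_group_def)
  next
    case False
    then show ?thesis by (simp add: coboundary_def cochain_group_def)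
  qed
qed

lemma subgroup_cocycles: "subgroup (kernel (C n) (C (n + 1)) (d n)) (C n)"
  using group_hom.subgroup_kernel[OF coboundary_hom] .

lemma comm_group_cocycle_group: "comm_group (cocycle_group I X G n)"
  unfolding cocycle_group_def
  by (rule group.abelian_subgroup_generated[OF comm_group.axioms(2)[OF comm_group_cochain] comm_group_cochain])

lemma carrier_cocycle_group:
  "carrier (cocycle_group I X G n) = {c \<in> carrier (C n). d n c = \<one>\<^bsub>C (n + 1)\<^esub>}"
  using subgroup.carrier_subgroup_generated_subgroup[OF subgroup_cocycles]
  by (simp add: cocycle_group_def kernel_def)

lemma subgroup_coboundary_set: "subgroup (coboundary_set I X G n) (cocycle_group I X G n)"
proof -
  have "subgroup (coboundary_set I X G n) (C n)"
    using group_hom.img_is_subgroup[OF coboundary_hom[of "n - 1"]] by (simp add: coboundary_set_def)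
  moreover have "coboundary_set I X G n \<subseteq> kernel (C n) (C (n + 1)) (d n)"
    using coboundary_coboundary[of _ "n - 1"] coboundary_closed[of _ "n - 1"]
    by (auto simp: coboundary_set_def kernel_def)
  ultimately show ?thesis
    unfolding cocycle_group_def
    using group.subgroup_of_subgroup_generated[OF comm_group.axioms(2)[OF comm_group_cochain]]
    by blast
qed

theorem comm_group_reduced_cohomology_group: "comm_group (reduced_cohomology_group I X G n)"
  unfolding reduced_cohomology_group_def
  by (rule comm_group.abelian_FactGroup[OF comm_group_cocycle_group subgroup_coboundary_set])

end

lemma simplex_product_subcomplex_Ram:
  assumes "finite_simplicial_complex K" "finite_simplicial_complex L"
  shows "simplex_product_subcomplex (vertices K) (vertices L) (Ram K L)"
proof
  show "finite (vertices K)" "finite (vertices L)"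
    using assms by (auto simp: finite_simplicial_complex_def vertices_def)
  show "Ram K L \<subseteq> product_cells (vertices K) (vertices L)"
    by (auto simp: Ram_def induced_subcomplex_def)
  fix \<nu> \<mu> assume \<nu>: "\<nu> \<in> Ram K L" and \<mu>: "\<mu> \<in> product_cells (vertices K) (vertices L)"
    and sub: "\<forall>i\<in>vertices K. \<mu> i \<subseteq> \<nu> i"
  have "Pi\<^sub>E (vertices K) \<mu> \<subseteq> Pi\<^sub>E (vertices K) \<nu>"
    by (rule PiE_mono) (use sub in blast)
  also have "\<dots> \<subseteq> ramsey_vertices K L"
    using \<nu> by (simp add: Ram_def induced_subcomplex_def)
  finally show "\<mu> \<in> Ram K L"
    using \<mu> by (simp add: Ram_def induced_subcomplex_def)
qed

lemma finite_simplicial_complex_boundary_simplex: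
  assumes "m \<ge> 1"
  shows "finite_simplicial_complex (boundary_simplex m)"
proof -
  have "boundary_simplex m \<subseteq> Pow {1..m}"
    by (auto simp: boundary_simplex_def)
  then have "finite (boundary_simplex m)" "\<forall>\<sigma>\<in>boundary_simplex m. finite \<sigma>"
    by (auto intro: finite_subset)
  moreover have "{} \<in> boundary_simplex m"
    using assms by (auto simp: boundary_simplex_def)
  ultimately show ?thesis
    by (auto simp: finite_simplicial_complex_def boundary_simplex_def)
qed

lemma vertices_boundary_simplex:
  assumes "m \<ge> 2"
  shows "vertices (boundary_simplex m) = {1..m}"
proof
  show "vertices (boundary_simplex m) \<subseteq> {1..m}"
    unfolding vertices_def boundary_simplex_def by blast
  show "{1..m} \<subseteq> vertices (boundary_simplex m)"
  proof
    fix v assume v: "v \<in> {1..m}"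
    have "card {v} \<noteq> card {1..m}" using assms by simp
    then have "{v} \<noteq> {1..m}" by metis
    moreover have "{v} \<subseteq> {1..m}" using v by (rule insert_subsetI) (rule empty_subsetI)
    ultimately have "{v} \<in> boundary_simplex m"
      unfolding boundary_simplex_def by (intro CollectI psubsetI)
    then show "v \<in> vertices (boundary_simplex m)"
      unfolding vertices_def by (rule UnionI) (rule singletonI)
  qed
qed

end

theory Submission
  imports
    Defs
    "HOL-Library.Function_Algebras"
    "HOL-Computational_Algebra.Polynomial_Factorial"
    "HOL-Number_Theory.Cong"
begin

text \<open>
  A colouring of the vertices by faces of \<open>\<Sigma>\<close> maps the Ramsey complex
  \<open>X\<close> to the complex \<open>Y\<close> of those cells of a product of \<open>m =
  p\<^sup>k\<close> simplices on \<open>n\<close> colours that contain no constant colouring. It has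
  dimension less than \<open>q = (n - 1)(m - 1)\<close>, and when \<open>(\<int>/p)\<^sup>k\<close>,
  with generators \<open>g\<^sub>0, \<dots>, g\<^bsub>k-1\<^esub>\<close>, permutes the factors
  simply transitively, no cell of \<open>Y\<close> is fixed.

  Over the coefficients \<open>(\<int>/p)[s]\<close> consider the operator \<open>t = \<Sum>\<^sub>j
  s\<^sup>j (g\<^sub>j - 1)\<close>, which satisfies \<open>t\<^sup>p = 0\<close>. Since
  \<open>X\<close> is acyclic below dimension \<open>q\<close>, there are chains
  \<open>\<phi>\<^sub>0, \<dots>, \<phi>\<^sub>q\<close> on \<open>X\<close> with augmentation
  \<open>1\<close> and \<open>\<partial>\<phi>\<^sub>1 = t\<phi>\<^sub>0\<close>,
  \<open>\<partial>\<phi>\<^sub>2 = t\<^bsup>p-1\<^esup>\<phi>\<^sub>1\<close>,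
  \<open>\<partial>\<phi>\<^sub>3 = t\<phi>\<^sub>2\<close>, and so on. The image of
  \<open>\<phi>\<^sub>q\<close> in \<open>Y\<close> vanishes. On the chains of \<open>Y\<close> the
  kernel of \<open>t\<close> is, up to a nonzero scalar, the image of
  \<open>t\<^bsup>p-1\<^esup>\<close>, and conversely, because \<open>1, s, \<dots>,
  s\<^bsup>k-1\<^esup>\<close> are linearly independent over \<open>\<int>/p\<close> and so
  \<open>t\<close> generates a shifted subgroup that acts freely on every orbit of cells. Hence one
  can descend from \<open>\<phi>\<^sub>q\<close> to \<open>\<phi>\<^sub>0\<close> and finds that a
  nonzero multiple of \<open>\<phi>\<^sub>0\<close> is a boundary plus an element of the image of
  \<open>t\<^bsup>p-1\<^esup>\<close>. Both have augmentation \<open>0\<close>, a contradiction.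
\<close>

section \<open>Congruences in a ring\<close>

text \<open>For \<open>k > 1\<close> the group has no periodic resolution, and a descent along one
  chain per degree needs one. The single operator \<open>t\<close> replaces the group algebra by a
  truncated polynomial ring, over which the trivial module has a resolution of rank one in each
  degree. A combination of the \<open>g j - 1\<close> with coefficients in Z/p would lose freeness
  on every orbit whose stabilizer contains the corresponding vector; the indeterminate
  \<open>s\<close> avoids all proper stabilizers at once. As Z[s] is not a field, freeness holds
  only up to a scalar not divisible by \<open>p\<close>. Powers of it accumulate in the descent,
  which is harmless because \<open>p\<close> is prime in Z[s]. All computations take place over Z[s]
  with congruences modulo \<open>p\<close>, not in characteristic \<open>p\<close>: in
  characteristic 0 the equation \<open>x = - x\<close> forces \<open>x = 0\<close>, so alternating
  functions vanish on lists with repetitions and the boundary squares to 0, also for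
  \<open>p = 2\<close>. The hypothesis concerns cohomology but the argument uses chains; over the
  field Z/p the two are related by duality of finite matrices.\<close>

definition congruent_mod :: "nat \<Rightarrow> 'a::ring_1 \<Rightarrow> 'a \<Rightarrow> bool" where
  "congruent_mod p a b \<longleftrightarrow> (\<exists>c. a = b + of_nat p * c)"

lemma congruent_mod_refl [simp, intro!]: "congruent_mod p a a"
  unfolding congruent_mod_def by (rule exI[of _ 0]) simp

lemma congruent_mod_sym: "congruent_mod p a b \<Longrightarrow> congruent_mod p b a"
  unfolding congruent_mod_def
proof (elim exE)
  fix c assume "a = b + of_nat p * c"
  then have "b = a + of_nat p * (- c)" by simp
  then show "\<exists>c. b = a + of_nat p * c" by blast
qed

lemma congruent_mod_trans [trans]:
  "congruent_mod p a b \<Longrightarrow> congruent_mod p b c \<Longrightarrow> congruent_mod p a c"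
  unfolding congruent_mod_def by (metis add.assoc distrib_left)

lemma congruent_mod_add:
  "congruent_mod p a b \<Longrightarrow> congruent_mod p c d \<Longrightarrow> congruent_mod p (a + c) (b + d)"
  unfolding congruent_mod_def
proof (elim exE)
  fix x y assume "a = b + of_nat p * x" "c = d + of_nat p * y"
  then have "a + c = b + d + of_nat p * (x + y)" by (simp add: algebra_simps)
  then show "\<exists>z. a + c = b + d + of_nat p * z" by blast
qed

text \<open>The congruence is also applied to noncommuting operators; it respects products because
  \<open>of_nat p\<close> is central in every ring.\<close>

lemma congruent_mod_mult:
  assumes "congruent_mod p a b" "congruent_mod p c d"
  shows "congruent_mod p (a * c) (b * d)"
proof -
  obtain x y where "a = b + of_nat p * x" "c = d + of_nat p * y"
    using assms by (auto simp: congruent_mod_def)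
  then have "a * c = b * d + of_nat p * (b * y + x * d + x * (of_nat p * y))"
    using mult_of_nat_commute[of p b] by (simp add: algebra_simps flip: mult.assoc)
  then show ?thesis by (auto simp: congruent_mod_def)
qed

lemma congruent_mod_mult_left: "congruent_mod p b c \<Longrightarrow> congruent_mod p (a * b) (a * c)"
  by (rule congruent_mod_mult) auto

lemma congruent_mod_mult_right: "congruent_mod p a b \<Longrightarrow> congruent_mod p (a * c) (b * c)"
  by (rule congruent_mod_mult) auto

lemma congruent_mod_uminus: "congruent_mod p a b \<Longrightarrow> congruent_mod p (- a) (- b)"
  using congruent_mod_mult_left[of p a b "- 1"] by simp

lemma congruent_mod_diff:
  "congruent_mod p a b \<Longrightarrow> congruent_mod p c d \<Longrightarrow> congruent_mod p (a - c) (b - d)"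
  using congruent_mod_add[of p a b "- c" "- d"] congruent_mod_uminus[of p c d] by simp

lemma congruent_mod_sum:
  "(\<And>x. x \<in> A \<Longrightarrow> congruent_mod p (f x) (g x)) \<Longrightarrow>
    congruent_mod p (sum f A) (sum g A)"
  by (induction A rule: infinite_finite_induct) (auto intro: congruent_mod_add)

lemma congruent_mod_diff_0_iff: "congruent_mod p (a - b) 0 \<longleftrightarrow> congruent_mod p a b"
  by (simp add: congruent_mod_def diff_eq_eq add.commute)

lemma congruent_mod_0_mult: "congruent_mod p a 0 \<Longrightarrow> congruent_mod p (c * a) 0"
  using congruent_mod_mult_left[of p a 0 c] by simp

lemma congruent_mod_of_nat_dvd: "p dvd n \<Longrightarrow> congruent_mod p (of_nat n) 0"
  by (auto simp: congruent_mod_def dvd_def)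

lemma congruent_mod_sum_0:
  "(\<And>x. x \<in> A \<Longrightarrow> congruent_mod p (f x) 0) \<Longrightarrow> congruent_mod p (sum f A) 0"
  using congruent_mod_sum[of A p f "\<lambda>_. 0"] by simp

lemma congruent_mod_iff_dvd: "congruent_mod p (a::'a::comm_ring_1) b \<longleftrightarrow> of_nat p dvd a - b"
  unfolding congruent_mod_def dvd_def by (metis add.commute diff_add_cancel add_diff_cancel_right')

section \<open>Commuting elements\<close>

lemma power_mult_distrib_commuting:
  fixes a b :: "'a::monoid_mult"
  assumes "a * b = b * a"
  shows "(a * b) ^ n = a ^ n * b ^ n"
proof (induction n)
  case (Suc n)
  have "(a * b) ^ Suc n = a * (b * a ^ n) * b ^ n"
    by (simp add: Suc mult.assoc)
  also have "b * a ^ n = a ^ n * b"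
    using power_commuting_commutes[OF assms, of n] by simp
  finally show ?case by (simp add: mult.assoc)
qed simp

lemma binomial_commuting:
  fixes a b :: "'a::ring_1"
  assumes "a * b = b * a"
  shows "(a + b) ^ n = (\<Sum>i\<le>n. of_nat (n choose i) * (a ^ i * b ^ (n - i)))"
proof (induction n)
  case (Suc n)
  have comm: "b * a ^ i = a ^ i * b" for i
    using power_commuting_commutes[OF assms, of i] by simp
  have *: "(b + a) * (of_nat c * (a ^ i * b ^ j)) =
      of_nat c * (a ^ i * b ^ Suc j) + of_nat c * (a ^ Suc i * b ^ j)" for c i j
  proof -
    have "(b + a) * (of_nat c * (a ^ i * b ^ j)) = of_nat c * ((b + a) * (a ^ i * b ^ j))"
      by (metis mult.assoc mult_of_nat_commute)
    also have "\<dots> = of_nat c * ((b * a ^ i) * b ^ j + a ^ Suc i * b ^ j)"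
      by (simp add: distrib_right mult.assoc)
    also have "\<dots> = of_nat c * (a ^ i * b ^ Suc j) + of_nat c * (a ^ Suc i * b ^ j)"
      by (simp add: comm distrib_left mult.assoc)
    finally show ?thesis .
  qed
  have "(a + b) ^ Suc n = (b + a) * (\<Sum>i\<le>n. of_nat (n choose i) * (a ^ i * b ^ (n - i)))"
    by (simp add: Suc add.commute)
  also have "\<dots> = (\<Sum>i\<le>n. of_nat (n choose i) * (a ^ i * b ^ Suc (n - i)))
      + (\<Sum>i\<le>n. of_nat (n choose i) * (a ^ Suc i * b ^ (n - i)))"
    by (simp only: sum_distrib_left * sum.distrib)
  also have "(\<Sum>i\<le>n. of_nat (n choose i) * (a ^ i * b ^ Suc (n - i))) =
      (\<Sum>i\<le>n. of_nat (n choose i) * (a ^ i * b ^ (Suc n - i)))"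
    by (rule sum.cong) (auto simp: Suc_diff_le)
  also have "\<dots> = (\<Sum>i\<le>Suc n. of_nat (n choose i) * (a ^ i * b ^ (Suc n - i)))"
    by (simp add: binomial_eq_0)
  also have "\<dots> = b ^ Suc n + (\<Sum>i\<le>n. of_nat (n choose Suc i) * (a ^ Suc i * b ^ (n - i)))"
    by (subst sum.atMost_Suc_shift) simp
  also have "\<dots> + (\<Sum>i\<le>n. of_nat (n choose i) * (a ^ Suc i * b ^ (n - i))) =
     b ^ Suc n + (\<Sum>i\<le>n. of_nat (Suc n choose Suc i) * (a ^ Suc i * b ^ (n - i)))"
    by (simp add: sum.distrib[symmetric] distrib_right add.assoc add.commute)
  also have "\<dots> = (\<Sum>i\<le>Suc n. of_nat (Suc n choose i) * (a ^ i * b ^ (Suc n - i)))"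
    by (subst sum.atMost_Suc_shift) simp
  finally show ?case .
qed simp

text \<open>Frobenius for operators, of which only selected pairs commute: \<open>p\<close> divides
  the inner binomial coefficients.\<close>

lemma freshman_commuting:
  fixes a b :: "'a::ring_1"
  assumes "prime p" "a * b = b * a"
  shows "congruent_mod p ((a + b) ^ p) (a ^ p + b ^ p)"
proof -
  have p: "p > 0" using assms(1) by (rule prime_gt_0_nat)
  have "congruent_mod p (of_nat (p choose i) * (a ^ i * b ^ (p - i))) 0" if "0 < i" "i < p" for i
  proof -
    have "p dvd (p choose i)" by (rule dvd_choose_prime) (use that assms(1) in auto)
    then show ?thesis
      using congruent_mod_mult_right[OF congruent_mod_of_nat_dvd] by fastforce
  qed
  then have *: "congruent_mod p (\<Sum>i\<in>{0<..<p}. of_nat (p choose i) * (a ^ i * b ^ (p - i))) 0"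
    by (intro congruent_mod_sum_0) auto
  have "{..p} = insert 0 (insert p {0<..<p})" using p by auto
  then have "(a + b) ^ p = a ^ p + b ^ p + (\<Sum>i\<in>{0<..<p}. of_nat (p choose i) * (a ^ i * b ^ (p - i)))"
    unfolding binomial_commuting[OF assms(2)] using p by (simp add: add.commute add.left_commute)
  then show ?thesis
    using congruent_mod_add[OF congruent_mod_refl *, of "a ^ p + b ^ p"] by simp
qed

lemma freshman_sum_commuting:
  fixes f :: "'i \<Rightarrow> 'a::ring_1"
  assumes "prime p" "\<And>i j. i \<in> A \<Longrightarrow> j \<in> A \<Longrightarrow> f i * f j = f j * f i"
  shows "congruent_mod p (sum f A ^ p) (\<Sum>i\<in>A. f i ^ p)"
  using assms(2)
proof (induction A rule: infinite_finite_induct)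
  case (insert x A)
  have "f x * sum f A = sum f A * f x"
    unfolding sum_distrib_left sum_distrib_right by (rule sum.cong) (use insert.prems in auto)
  then have "congruent_mod p ((f x + sum f A) ^ p) (f x ^ p + sum f A ^ p)"
    by (rule freshman_commuting[OF assms(1)])
  also have "congruent_mod p \<dots> (f x ^ p + (\<Sum>i\<in>A. f i ^ p))"
    by (intro congruent_mod_add congruent_mod_refl insert.IH insert.prems) auto
  finally show ?case using insert.hyps by simp
qed (use prime_gt_0_nat[OF assms(1)] in \<open>auto simp: power_0_left\<close>)

section \<open>Iterated commutators\<close>

text \<open>The derivation \<open>ad t\<close>. Its power \<open>p - 1\<close> is, modulo
  \<open>p\<close>, a relative trace, and this is how freeness over the ring generated by
  \<open>t\<close> is detected.\<close>

definition commutator :: "'a::ring_1 \<Rightarrow> 'a \<Rightarrow> 'a" where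
  "commutator t x = t * x - x * t"

lemma commutator_sum: "commutator t (sum f A) = (\<Sum>i\<in>A. commutator t (f i))"
  by (simp add: commutator_def sum_distrib_left sum_distrib_right sum_subtractf)

lemma commutator_power_sum:
  "(commutator t ^^ r) (sum f A) = (\<Sum>i\<in>A. (commutator t ^^ r) (f i))"
  by (induction r) (auto simp: commutator_sum)

lemma commutator_power_mult_right:
  assumes "t * y = y * t"
  shows "(commutator t ^^ r) (x * y) = (commutator t ^^ r) x * y"
proof (induction r)
  case (Suc r)
  have "commutator t (z * y) = commutator t z * y" for z
    using assms by (simp add: commutator_def left_diff_distrib mult.assoc)
  then show ?case using Suc by simp
qed simp

lemma commutator_congruent:
  "congruent_mod p x y \<Longrightarrow> congruent_mod p (commutator t x) (commutator t y)"
  unfolding commutator_def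
  by (intro congruent_mod_diff congruent_mod_mult congruent_mod_refl)

lemma commutator_power_congruent:
  "congruent_mod p x y \<Longrightarrow> congruent_mod p ((commutator t ^^ r) x) ((commutator t ^^ r) y)"
  by (induction r) (auto intro: commutator_congruent)

lemma commutator_power_of_nat:
  "(commutator t ^^ r) (of_nat c * x) = of_nat c * (commutator t ^^ r) x"
proof (induction r)
  case (Suc r)
  have "commutator t (of_nat c * z) = of_nat c * commutator t z" for z
    unfolding commutator_def right_diff_distrib by (metis mult.assoc mult_of_nat_commute)
  then show ?case using Suc by simp
qed simp

text \<open>Neighbours in row \<open>p - 1\<close> of Pascal's triangle add up to an inner entry of
  row \<open>p\<close>, which \<open>p\<close> divides; so each entry is the negative of the
  previous one.\<close>

lemma choose_pred_prime_congruent: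
  assumes "prime p" "i < p"
  shows "congruent_mod p (of_nat (p - 1 choose i)) ((- 1) ^ i :: 'a::ring_1)"
  using assms(2)
proof (induction i)
  case (Suc i)
  have "p dvd (p choose Suc i)" by (rule dvd_choose_prime) (use Suc.prems assms(1) in auto)
  moreover have "p choose Suc i = (p - 1 choose i) + (p - 1 choose Suc i)"
    using Suc.prems by (metis binomial_Suc_Suc Suc_diff_1 gr_implies_not0 not_gr_zero)
  ultimately have "congruent_mod p (of_nat (p - 1 choose i) + of_nat (p - 1 choose Suc i)) (0::'a)"
    using congruent_mod_of_nat_dvd[of p "p choose Suc i", where 'a = 'a] by simp
  from congruent_mod_diff[OF this Suc.IH] show ?case using Suc.prems by simp
qed simp

text \<open>Left and right multiplication by \<open>t\<close> commute, and this is the binomial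
  theorem for their difference.\<close>

lemma commutator_power:
  "(commutator t ^^ r) x = (\<Sum>i\<le>r. (- 1) ^ i * of_nat (r choose i) * (t ^ (r - i) * x * t ^ i))"
proof (induction r)
  case (Suc r)
  have c: "y * ((- 1) ^ i * of_nat n * z) = (- 1) ^ i * of_nat n * (y * z)" for y z :: 'a and i n
  proof -
    have "y * (- 1) ^ i = (- 1) ^ i * y" by (cases "even i") auto
    then show ?thesis by (metis mult.assoc mult_of_nat_commute)
  qed
  let ?u = "\<lambda>i. (- 1) ^ i * of_nat (r choose i) * (t ^ (Suc r - i) * x * t ^ i)"
  have "t * (\<Sum>i\<le>r. (- 1) ^ i * of_nat (r choose i) * (t ^ (r - i) * x * t ^ i)) =
      (\<Sum>i\<le>r. ?u i)"
    unfolding sum_distrib_left c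
    by (rule sum.cong) (auto simp: Suc_diff_le mult.assoc)
  also have "\<dots> = (\<Sum>i\<le>Suc r. ?u i)" by (simp add: binomial_eq_0)
  also have "\<dots> = t ^ Suc r * x +
    (\<Sum>i\<le>r. (- 1) ^ Suc i * of_nat (r choose Suc i) * (t ^ (r - i) * x * t ^ Suc i))"
    by (subst sum.atMost_Suc_shift) simp
  finally have 1: "t * (\<Sum>i\<le>r. (- 1) ^ i * of_nat (r choose i) * (t ^ (r - i) * x * t ^ i)) =
     t ^ Suc r * x + (\<Sum>i\<le>r. (- 1) ^ Suc i * of_nat (r choose Suc i) * (t ^ (r - i) * x * t ^ Suc i))" .
  have 2: "(\<Sum>i\<le>r. (- 1) ^ i * of_nat (r choose i) * (t ^ (r - i) * x * t ^ i)) * t =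
      - (\<Sum>i\<le>r. (- 1) ^ Suc i * of_nat (r choose i) * (t ^ (r - i) * x * t ^ Suc i))"
    unfolding sum_distrib_right sum_negf[symmetric]
    by (rule sum.cong) (auto simp: mult.assoc power_commutes)
  have "(commutator t ^^ Suc r) x = t ^ Suc r * x
     + (\<Sum>i\<le>r. (- 1) ^ Suc i * of_nat (Suc r choose Suc i) * (t ^ (r - i) * x * t ^ Suc i))"
    unfolding funpow.simps comp_def Suc.IH commutator_def[of t] 1 2
    by (simp add: sum.distrib[symmetric] algebra_simps)
  also have "\<dots> = (\<Sum>i\<le>Suc r. (- 1) ^ i * of_nat (Suc r choose i) * (t ^ (Suc r - i) * x * t ^ i))"
    by (subst sum.atMost_Suc_shift) simp
  finally show ?case .
qed simp

text \<open>
  In characteristic \<open>p\<close> the binomial coefficients of \<open>p - 1\<close> are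
  alternating signs.
\<close>

lemma commutator_power_pred_prime:
  fixes t x :: "'a::ring_1"
  assumes "prime p"
  shows "congruent_mod p ((commutator t ^^ (p - 1)) x) (\<Sum>i<p. t ^ (p - 1 - i) * x * t ^ i)"
proof -
  have "{..p - 1} = {..<p}" using prime_gt_0_nat[OF assms] by auto
  then have eq: "(commutator t ^^ (p - 1)) x =
      (\<Sum>i<p. (- 1) ^ i * of_nat (p - 1 choose i) * (t ^ (p - 1 - i) * x * t ^ i))"
    by (simp add: commutator_power)
  have "congruent_mod p ((- 1) ^ i * of_nat (p - 1 choose i) * y) y" if "i < p" for i and y :: 'a
  proof -
    have "congruent_mod p ((- 1) ^ i * of_nat (p - 1 choose i) * y) ((- 1) ^ i * (- 1) ^ i * y)"
      by (intro congruent_mod_mult congruent_mod_refl choose_pred_prime_congruent that assms)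
    also have "(- 1) ^ i * (- 1) ^ i * y = y" by (cases "even i") auto
    finally show ?thesis .
  qed
  then show ?thesis unfolding eq by (intro congruent_mod_sum) auto
qed

text \<open>
  Modulo \<open>p\<close> the element \<open>L\<close> acts as a coordinate that \<open>\<tau>
  j\<close> shifts by \<open>a j\<close>, so that a commutator with \<open>t\<close> is a finite
  difference and lowers the degree in \<open>L\<close>.
\<close>

lemma commutator_power_shift:
  fixes \<tau> a :: "'j \<Rightarrow> 'a::ring_1" and t c L :: 'a
  assumes t: "t = (\<Sum>j\<in>J. \<tau> j) - c"
    and shift: "\<And>j. j \<in> J \<Longrightarrow> congruent_mod p (\<tau> j * L) ((L + a j) * \<tau> j)"
    and cL: "c * L = L * c" and aL: "\<And>j. j \<in> J \<Longrightarrow> a j * L = L * a j"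
    and t\<tau>: "\<And>j. j \<in> J \<Longrightarrow>
      t * \<tau> j = \<tau> j * t" and ta: "\<And>j. j \<in> J \<Longrightarrow> t * a j = a j * t"
    and U: "\<And>j. j \<in> J \<Longrightarrow> a j * \<tau> j = \<tau> j * a j"
    "U = (\<Sum>j\<in>J. a j * \<tau> j)"
    and "s \<le> r"
  shows "congruent_mod p ((commutator t ^^ r) (L ^ s)) (if s = r then of_nat (fact r) * U ^ r else 0)"
  using \<open>s \<le> r\<close>
proof (induction r arbitrary: s)
  case (Suc r)
  have shift_pow: "congruent_mod p (\<tau> j * L ^ s) ((L + a j) ^ s * \<tau> j)" if j: "j \<in> J" for j s
  proof (induction s)
    case (Suc s)
    have "congruent_mod p (\<tau> j * L ^ s * L) ((L + a j) ^ s * \<tau> j * L)"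
      by (rule congruent_mod_mult_right[OF Suc])
    also have "congruent_mod p ((L + a j) ^ s * \<tau> j * L) ((L + a j) ^ s * ((L + a j) * \<tau> j))"
      unfolding mult.assoc by (rule congruent_mod_mult_left[OF shift[OF j]])
    finally show ?case
      by (simp add: mult.assoc power_commutes) (simp add: power_commutes flip: mult.assoc)
  qed simp
  \<comment> \<open>The factors to the right of \<open>L ^ q\<close> commute with \<open>t\<close>,
    so further commutators act on \<open>L ^ q\<close> alone.\<close>
  define y where "y j q = a j ^ (s - q) * \<tau> j" for j q
  have ty: "t * y j q = y j q * t" if "j \<in> J" for j q
    unfolding y_def using power_commuting_commutes[OF ta[OF that, symmetric], of "s - q"] t\<tau>[OF that]
    by (metis mult.assoc)
  have diff: "congruent_mod p (commutator t (L ^ s))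
      (\<Sum>j\<in>J. \<Sum>q<s. of_nat (s choose q) * (L ^ q * y j q))"
  proof -
    have "c * L ^ s = L ^ s * c"
      using power_commuting_commutes[OF cL[symmetric], of s] by simp
    then have "commutator t (L ^ s) = (\<Sum>j\<in>J. \<tau> j * L ^ s - L ^ s * \<tau> j)"
      by (simp add: commutator_def t left_diff_distrib right_diff_distrib sum_distrib_left
          sum_distrib_right sum_subtractf)
    also have "congruent_mod p \<dots> (\<Sum>j\<in>J. (L + a j) ^ s * \<tau> j - L ^ s * \<tau> j)"
      by (intro congruent_mod_sum congruent_mod_diff shift_pow congruent_mod_refl)
    also have "\<dots> = (\<Sum>j\<in>J. \<Sum>q<s. of_nat (s choose q) * (L ^ q * y j q))"
    proof (rule sum.cong)
      fix j assume j: "j \<in> J"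
      have "(L + a j) ^ s = (\<Sum>q\<le>s. of_nat (s choose q) * (L ^ q * a j ^ (s - q)))"
        by (rule binomial_commuting) (use aL[OF j] in simp)
      also have "{..s} = insert s {..<s}" by auto
      finally have "(L + a j) ^ s = L ^ s + (\<Sum>q<s. of_nat (s choose q) * (L ^ q * a j ^ (s - q)))"
        by simp
      then show "(L + a j) ^ s * \<tau> j - L ^ s * \<tau> j = (\<Sum>q<s. of_nat (s choose q) * (L ^ q * y j q))"
        by (simp add: distrib_right sum_distrib_right y_def mult.assoc)
    qed simp
    finally show ?thesis .
  qed
  have "congruent_mod p ((commutator t ^^ Suc r) (L ^ s))
      ((commutator t ^^ r) (\<Sum>j\<in>J. \<Sum>q<s. of_nat (s choose q) * (L ^ q * y j q)))"
    unfolding funpow_Suc_right comp_def by (rule commutator_power_congruent[OF diff])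
  also have "\<dots> = (\<Sum>j\<in>J. \<Sum>q<s. of_nat (s choose q) * ((commutator t ^^ r) (L ^ q) * y j q))"
    by (simp add: commutator_power_sum commutator_power_of_nat commutator_power_mult_right ty)
  \<comment> \<open>Since \<open>q < s \<le> Suc r\<close>, the induction hypothesis covers every
    \<open>L ^ q\<close>. Only \<open>q = r\<close> survives, hence only \<open>s = Suc r\<close>,
    with coefficient \<open>Suc r choose r = Suc r\<close>.\<close>
  also have "congruent_mod p \<dots> (\<Sum>j\<in>J. \<Sum>q<s. of_nat (s choose q) *
      ((if q = r then of_nat (fact r) * U ^ r else 0) * y j q))"
    by (intro congruent_mod_sum congruent_mod_mult congruent_mod_refl Suc.IH) (use Suc.prems in auto)
  also have "\<dots> = (if s = Suc r then of_nat (fact (Suc r)) * U ^ Suc r else 0)"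
  proof (cases "s = Suc r")
    case True
    then have "(\<Sum>q<s. of_nat (s choose q) * ((if q = r then of_nat (fact r) * U ^ r else 0) * y j q)) =
        of_nat (Suc r) * (of_nat (fact r) * U ^ r * (a j * \<tau> j))" for j
      by (simp add: y_def)
    then have "(\<Sum>j\<in>J. \<Sum>q<s. of_nat (s choose q) *
      ((if q = r then of_nat (fact r) * U ^ r else 0) * y j q)) =
       of_nat (Suc r) * (of_nat (fact r) * U ^ r * U)"
      by (simp only: sum_distrib_left U(2))
    also have "\<dots> = of_nat (Suc r * fact r) * (U ^ r * U)"
      by (simp only: of_nat_mult mult.assoc)
    finally show ?thesis using True by (simp add: power_commutes)
  next
    case False
    then have "(\<Sum>q<s. of_nat (s choose q) * ((if q = r then of_nat (fact r) * U ^ r else 0) * y j q)) = 0" for j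
      using Suc.prems by (intro sum.neutral) auto
    then show ?thesis using False by simp
  qed
  finally show ?case .
qed simp

section \<open>Operators on functions\<close>

text \<open>Additivity is all that is demanded, so that precomposition with a map and multiplication
  by a non-constant function lie in one ring, to which the identities above apply.\<close>

typedef (overloaded) 'm endo = "{f :: 'm::ring_1 \<Rightarrow> 'm. \<forall>x y. f (x + y) = f x + f y}"
  morphisms app Endo
  by (rule exI[of _ "\<lambda>x. x"]) simp

lemma app_add: "app a (x + y) = app a x + app a y"
  using app[of a] by simp

lemma app_Endo: "(\<And>x y. f (x + y) = f x + f y) \<Longrightarrow> app (Endo f) = f"
  by (rule Endo_inverse) simp

lemma endo_eqI: "(\<And>x. app a x = app b x) \<Longrightarrow> a = b"
  by (metis app_inject ext)

lemma app_0 [simp]: "app a 0 = 0"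
  using app_add[of a 0 0] by simp

lemma app_uminus: "app a (- x) = - app a x"
  by (metis app_0 app_add add.right_inverse minus_unique)

lemma app_diff: "app a (x - y) = app a x - app a y"
  using app_add[of a x "- y"] app_uminus[of a y] by simp

instantiation endo :: (ring_1) ring_1
begin

definition "0 = Endo (\<lambda>_. 0)"
definition "1 = Endo (\<lambda>x. x)"
definition "a + b = Endo (\<lambda>x. app a x + app b x)"
definition "a - b = Endo (\<lambda>x. app a x - app b x)"
definition "- a = Endo (\<lambda>x. - app a x)"
definition "a * b = Endo (\<lambda>x. app a (app b x))"

lemma app_zero [simp]: "app 0 x = 0"
  unfolding zero_endo_def by (subst app_Endo) auto

lemma app_one [simp]: "app 1 x = x"
  unfolding one_endo_def by (subst app_Endo) auto

lemma app_plus [simp]: "app (a + b) x = app a x + app b x"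
  unfolding plus_endo_def by (subst app_Endo) (auto simp: app_add)

lemma app_minus [simp]: "app (a - b) x = app a x - app b x"
  unfolding minus_endo_def by (subst app_Endo) (auto simp: app_add)

lemma app_neg [simp]: "app (- a) x = - app a x"
  unfolding uminus_endo_def by (subst app_Endo) (auto simp: app_add)

lemma app_times [simp]: "app (a * b) x = app a (app b x)"
  unfolding times_endo_def by (subst app_Endo) (auto simp: app_add)

instance
proof
  have "app (0 :: 'a endo) 1 \<noteq> app 1 1" by simp
  then show "(0 :: 'a endo) \<noteq> 1" by metis
qed (rule endo_eqI; simp add: app_add algebra_simps)+

end

lemma app_sum: "app (sum f A) x = (\<Sum>i\<in>A. app (f i) x)"
  by (induction A rule: infinite_finite_induct) auto

lemma app_sum_right: "app a (sum f A) = (\<Sum>i\<in>A. app a (f i))"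
  by (induction A rule: infinite_finite_induct)
    (simp_all only: sum.infinite sum.empty sum.insert app_0 app_add simp_thms)

lemma app_of_nat: "app (of_nat n) x = of_nat n * x"
  by (induction n) (auto simp: distrib_right)

lemma app_of_nat_mult: "app a (of_nat n * x) = of_nat n * app a x"
  by (induction n) (auto simp: distrib_right app_add)

lemma app_congruent: "congruent_mod p x y \<Longrightarrow> congruent_mod p (app a x) (app a y)"
  by (auto simp: congruent_mod_def app_add app_of_nat_mult)

lemma app_congruent_operator: "congruent_mod p a b \<Longrightarrow> congruent_mod p (app a x) (app b x)"
  by (auto simp: congruent_mod_def app_of_nat)

text \<open>Precomposition reverses products; for the commuting permutations used below it is still
  an action.\<close>

definition shift :: "('x \<Rightarrow> 'x) \<Rightarrow> ('x \<Rightarrow> 'r::comm_ring_1) endo" where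
  "shift g = Endo (\<lambda>f. f \<circ> g)"

definition scale :: "('x \<Rightarrow> 'r::comm_ring_1) \<Rightarrow> ('x \<Rightarrow> 'r) endo" where
  "scale w = Endo (\<lambda>f. w * f)"

lemma app_shift [simp]: "app (shift g) f = f \<circ> g"
  unfolding shift_def by (subst app_Endo) auto

lemma app_scale [simp]: "app (scale w) f = w * f"
  unfolding scale_def by (subst app_Endo) (auto simp: distrib_left)

lemma shift_mult: "shift g * shift h = shift (h \<circ> g)"
  by (rule endo_eqI) (simp add: comp_assoc)

lemma shift_id: "shift id = 1"
  by (rule endo_eqI) (simp only: app_shift app_one o_id)

lemma shift_power: "shift g ^ n = shift (g ^^ n)"
proof (induction n)
  case (Suc n)
  have "g ^^ n \<circ> g = g ^^ Suc n" by (simp add: funpow_Suc_right del: funpow.simps)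
  then show ?case using Suc by (simp add: shift_mult del: funpow.simps)
qed (simp only: power_0 funpow.simps shift_id)

lemma scale_add: "scale (v + w) = scale v + scale w"
  and scale_mult: "scale (v * w) = scale v * scale w"
  and scale_uminus: "scale (- v) = - scale v"
  and scale_0: "scale 0 = 0"
  and scale_1: "scale 1 = 1"
  by (rule endo_eqI; simp add: distrib_right mult.assoc)+

lemma scale_commute: "scale v * scale w = scale w * scale v"
  by (simp flip: scale_mult add: mult.commute)

lemma scale_of_nat: "scale (of_nat n) = of_nat n"
  by (rule endo_eqI) (simp add: app_of_nat)

lemma scale_sum: "scale (sum f A) = (\<Sum>i\<in>A. scale (f i))"
  by (induction A rule: infinite_finite_induct)
    (simp_all only: sum.insert sum.empty sum.infinite scale_0 scale_add simp_thms)

lemma scale_power: "scale (w ^ n) = scale w ^ n"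
  by (induction n) (simp_all only: power_0 power_Suc scale_1 scale_mult)

lemma scale_congruent: "congruent_mod p v w \<Longrightarrow> congruent_mod p (scale v) (scale w)"
  by (auto simp: congruent_mod_def scale_add scale_mult scale_of_nat)

lemma shift_scale: "shift g * scale w = scale (w \<circ> g) * shift g"
  by (rule endo_eqI) (auto simp: fun_eq_iff)

lemma of_nat_fun_apply: "(of_nat n :: 'x \<Rightarrow> 'r::comm_ring_1) x = of_nat n"
  by (induction n) auto

lemma congruent_mod_fun_iff:
  "congruent_mod p (f :: 'x \<Rightarrow> 'r::comm_ring_1) g \<longleftrightarrow> (\<forall>x. congruent_mod p (f x)
    (g x))"
proof
  assume "\<forall>x. congruent_mod p (f x) (g x)"
  then obtain c where "\<And>x. f x = g x + of_nat p * c x"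
    unfolding congruent_mod_def by metis
  then have "f = g + of_nat p * c" by (simp add: fun_eq_iff of_nat_fun_apply)
  then show "congruent_mod p f g" by (auto simp: congruent_mod_def)
qed (auto simp: congruent_mod_def of_nat_fun_apply)

lemma sum_fun_apply: "(sum F A :: 'x \<Rightarrow> 'r::comm_ring_1) x = (\<Sum>i\<in>A. F i x)"
  by (induction A rule: infinite_finite_induct) auto

lemma power_fun_apply: "((f :: 'x \<Rightarrow> 'r::comm_ring_1) ^ n) x = f x ^ n"
  by (induction n) auto

section \<open>Linear algebra modulo a prime\<close>

text \<open>Double annihilator over the field Z/p, by induction on the number of forms. It serves
  twice: to find a character vanishing on a stabilizer, and to pass from cohomology to
  homology.\<close>

lemma orthogonal_to_kernel_imp_combination:
  fixes A :: "'t \<Rightarrow> 's \<Rightarrow> int" and z :: "'s \<Rightarrow> int" and p :: nat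
  assumes "prime p" "finite S" "finite T"
    and "\<And>f. (\<And>t. t \<in> T \<Longrightarrow>
      [(\<Sum>s\<in>S. A t s * f s) = 0] (mod int p)) \<Longrightarrow> [(\<Sum>s\<in>S. z s * f s) = 0] (mod int p)"
  shows "\<exists>c. \<forall>s\<in>S. [z s = (\<Sum>t\<in>T. c t * A t s)] (mod int p)"
  using assms(3,4)
proof (induction T arbitrary: z rule: finite_induct)
  case empty
  have "[z s = 0] (mod int p)" if "s \<in> S" for s
    using empty[of "\<lambda>x. if x = s then 1 else 0"] that assms(2) by (simp add: if_distrib cong: if_cong)
  then show ?case by simp
next
  case (insert t T)
  show ?case
  proof (cases "\<forall>f. (\<forall>u\<in>T. [(\<Sum>s\<in>S. A u s * f s) = 0] (mod int p)) \<longrightarrow>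
    [(\<Sum>s\<in>S. A t s * f s) = 0] (mod int p)")
    case True
    then obtain c where c: "\<forall>s\<in>S. [z s = (\<Sum>t\<in>T. c t * A t s)] (mod int p)"
      using insert.IH[of z] insert.prems by blast
    have "(\<Sum>u\<in>insert t T. (c(t := 0)) u * A u s) = (\<Sum>u\<in>T. c u * A u s)" for s
      using insert.hyps by (simp add: sum.insert) (rule sum.cong, auto)
    with c show ?thesis by (intro exI[of _ "c(t := 0)"]) simp
  next
    case False
    \<comment> \<open>The vector \<open>f\<close> is killed by the other forms but not by
      \<open>A t\<close>; along it every vector can be projected to the kernel of
      \<open>A t\<close>.\<close>
    then obtain f where f: "\<And>u. u \<in> T \<Longrightarrow> [(\<Sum>s\<in>S. A u s * f s) = 0] (mod int p)"
      and ft: "\<not> [(\<Sum>s\<in>S. A t s * f s) = 0] (mod int p)" by blast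
    define a where "a = (\<Sum>s\<in>S. A t s * f s)"
    have "coprime a (int p)"
      using ft assms(1) prime_imp_coprime[of "int p" a] unfolding a_def
      by (simp add: cong_0_iff coprime_commute)
    then obtain b where b: "[a * b = 1] (mod int p)" using cong_solve_coprime_int by blast
    define y where "y = (\<Sum>s\<in>S. z s * f s)"
    have "\<exists>c. \<forall>s\<in>S. [z s - y * b * A t s = (\<Sum>t\<in>T. c t * A t s)] (mod int p)"
    proof (rule insert.IH)
      fix h assume h: "\<And>u. u \<in> T \<Longrightarrow> [(\<Sum>s\<in>S. A u s * h s) = 0] (mod int p)"
      define x where "x = (\<Sum>s\<in>S. A t s * h s)"
      \<comment> \<open>The projection of \<open>h\<close>: with \<open>b\<close> inverse to
        \<open>a\<close>, the value of \<open>A t\<close> on \<open>w\<close> is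
        \<open>x - x * b * a\<close>, which is 0 modulo \<open>p\<close>.\<close>
      define w where "w s = h s - x * b * f s" for s
      have *: "(\<Sum>s\<in>S. B s * w s) =
        (\<Sum>s\<in>S. B s * h s) - x * b * (\<Sum>s\<in>S. B s * f s)" for B :: "'s \<Rightarrow> int"
        by (simp add: w_def right_diff_distrib sum_subtractf sum_distrib_left algebra_simps)
      have "[(\<Sum>s\<in>S. z s * w s) = 0] (mod int p)"
      proof (rule insert.prems)
        fix u assume u: "u \<in> insert t T"
        show "[(\<Sum>s\<in>S. A u s * w s) = 0] (mod int p)"
        proof (cases "u = t")
          case True
          have "[x - x * (a * b) = x - x * 1] (mod int p)"
            using b by (intro cong_diff cong_mult cong_refl)
          then show ?thesis using True unfolding * by (simp add: x_def a_def algebra_simps)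
        next
          case False
          then have "u \<in> T" using u by simp
          then show ?thesis
            unfolding * using cong_diff[OF h cong_mult[OF cong_refl f], of u u "x * b"] by simp
        qed
      qed
      then have "[(\<Sum>s\<in>S. z s * h s) - x * b * y = 0] (mod int p)"
        unfolding * by (simp add: y_def)
      then show "[(\<Sum>s\<in>S. (z s - y * b * A t s) * h s) = 0] (mod int p)"
        by (simp add: left_diff_distrib sum_subtractf x_def sum_distrib_left algebra_simps)
    qed
    then obtain c where c: "\<And>s. s \<in> S \<Longrightarrow>
      [z s - y * b * A t s = (\<Sum>t\<in>T. c t * A t s)] (mod int p)" by blast
    have "[z s = (\<Sum>u\<in>insert t T. (c(t := y * b)) u * A u s)] (mod int p)" if "s \<in> S" for s
    proof -
      have "(\<Sum>u\<in>insert t T. (c(t := y * b)) u * A u s) = (\<Sum>u\<in>T. c u * A u s) + y * b * A t s"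
        using insert.hyps by (simp add: sum.insert) (rule sum.cong, auto)
      then show ?thesis using cong_add[OF c[OF that] cong_refl, of "y * b * A t s"] by simp
    qed
    then show ?thesis by blast
  qed
qed

section \<open>Commuting permutations of order \<open>p\<close>\<close>

locale commuting_maps =
  fixes p k :: nat and g :: "nat \<Rightarrow> 'x \<Rightarrow> 'x"
  assumes p: "prime p"
    and commute: "\<And>i j x. i < k \<Longrightarrow> j < k \<Longrightarrow> g i (g j x) = g j (g i x)"
    and order: "\<And>j x. j < k \<Longrightarrow> (g j ^^ p) x = x"
begin

text \<open>The group element with exponent vector \<open>a\<close>; the bound \<open>l\<close>
  serves induction over the generators and the full action is \<open>l = k\<close>. Exponents are
  natural numbers, so inverses appear as multiples by \<open>p - 1\<close>.\<close>

primrec act :: "nat \<Rightarrow> (nat \<Rightarrow> nat) \<Rightarrow> 'x \<Rightarrow> 'x" where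
  "act 0 a x = x"
| "act (Suc l) a x = (g l ^^ a l) (act l a x)"

lemma act_zero: "act l (\<lambda>_. 0) x = x"
  by (induction l) auto

lemma commute_pow:
  assumes "i < k" "j < k"
  shows "(g i ^^ n) (g j x) = g j ((g i ^^ n) x)"
  by (induction n) (auto simp: commute assms)

lemma commute_pow_pow:
  assumes "i < k" "j < k"
  shows "(g i ^^ n) ((g j ^^ m) x) = (g j ^^ m) ((g i ^^ n) x)"
  by (induction m) (auto simp: commute_pow assms)

lemma commute_act: "l \<le> k \<Longrightarrow> i < k \<Longrightarrow>
  (g i ^^ n) (act l a x) = act l a ((g i ^^ n) x)"
proof (induction l)
  case (Suc l)
  then show ?case using commute_pow_pow[of i l n "a l" "act l a x"] by simp
qed simp

lemma act_add: "l \<le> k \<Longrightarrow> act l (\<lambda>j. a j + b j) x = act l a (act l b x)"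
  by (induction l) (auto simp: funpow_add commute_act[symmetric])

lemma pow_mod:
  assumes "j < k" "[m = n] (mod p)"
  shows "(g j ^^ m) x = (g j ^^ n) x"
proof -
  have *: "(g j ^^ (p * q)) x = x" for q x
    by (induction q) (auto simp: funpow_add order assms(1))
  have "(g j ^^ m) x = (g j ^^ (m mod p)) x" for m
    using *[of "m div p"] funpow_add[of "m mod p" "p * (m div p)" "g j"] by simp
  then show ?thesis using assms(2) unfolding cong_def by metis
qed

lemma power_pred_inverse:
  assumes "j < k"
  shows "(g j ^^ (p - 1)) (g j x) = x" "g j ((g j ^^ (p - 1)) x) = x"
proof -
  have p': "Suc (p - 1) = p" using prime_gt_0_nat[OF p] by simp
  have "(g j ^^ Suc (p - 1)) x = x" unfolding p' by (rule order[OF assms])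
  then show "(g j ^^ (p - 1)) (g j x) = x" "g j ((g j ^^ (p - 1)) x) = x"
    by (simp_all only: funpow.simps funpow_Suc_right comp_apply funpow_swap1)
qed

lemma act_cong: "l \<le> k \<Longrightarrow> (\<And>j. j < l \<Longrightarrow> [a j = b j] (mod p)) \<Longrightarrow>
  act l a x = act l b x"
proof (induction l)
  case (Suc l)
  then show ?case using pow_mod[of l "a l" "b l"] by simp
qed simp

lemma act_single: "l \<le> k \<Longrightarrow> j < k \<Longrightarrow> act l (\<lambda>i.
  if i = j then 1 else 0) x = (if j < l then g j x else x)"
  by (induction l) (auto simp: less_Suc_eq)

lemma act_mult: "l \<le> k \<Longrightarrow> act l a x = x \<Longrightarrow> act l (\<lambda>j. n * a j) x = x"
proof (induction n)
  case 0
  show ?case by (simp add: act_zero)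
next
  case (Suc n)
  then show ?case using act_add[of l "\<lambda>j. n * a j" a x] by (simp add: add.commute)
qed

lemma act_sum:
  "finite T \<Longrightarrow> l \<le> k \<Longrightarrow> (\<And>t. t \<in> T \<Longrightarrow>
    act l (a t) x = x) \<Longrightarrow> act l (\<lambda>j. \<Sum>t\<in>T. n t * a t j) x = x"
proof (induction T rule: finite_induct)
  case empty
  show ?case by (simp add: act_zero)
next
  case (insert t T)
  then show ?case using act_add[of l "\<lambda>j. n t * a t j"] by (simp add: act_mult)
qed

text \<open>One reduced representative for each nonzero linear form on
  \<open>(\<int>/p)\<^sup>k\<close>. A product over this set enters \<open>\<kappa>\<close>, so it
  must be finite and no member may vanish modulo \<open>p\<close>.\<close>

definition characters :: "(nat \<Rightarrow> int) set" where
  "characters = {\<alpha> \<in> {..<k} \<rightarrow>\<^sub>E {0..<int p}. \<exists>j<k. \<alpha> j \<noteq> 0}"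

lemma finite_characters: "finite characters"
proof (rule finite_subset)
  show "characters \<subseteq> {..<k} \<rightarrow>\<^sub>E {0..<int p}" by (auto simp: characters_def)
  show "finite ({..<k} \<rightarrow>\<^sub>E {0..<int p})" by (intro finite_PiE) auto
qed

text \<open>
  The stabilizer of a point that is not fixed is a proper subspace of
  \<open>(\<int>/p)\<^sup>k\<close>, so a nonzero linear form vanishes on it.
\<close>

lemma exists_character:
  assumes "j < k" "g j x \<noteq> x"
  shows "\<exists>\<alpha>\<in>characters. \<forall>a. act k a x = x \<longrightarrow>
    [(\<Sum>i<k. \<alpha> i * int (a i)) = 0] (mod int p)"
proof (rule ccontr)
  assume neg: "\<not> ?thesis"
  define T where "T = {a \<in> {..<k} \<rightarrow>\<^sub>E {..<p}. act k a x = x}"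
  have "finite ({..<k} \<rightarrow>\<^sub>E {..<p})" by (intro finite_PiE) auto
  then have "finite T" unfolding T_def by (rule rev_finite_subset) auto
  \<comment> \<open>If no character vanishes on the stabilizer, every form that does has
    \<open>j\<close>-th coordinate 0. By duality the \<open>j\<close>-th unit vector is then a
    combination of stabilizer elements, and \<open>g j\<close> fixes \<open>x\<close>.\<close>
  have "\<exists>c. \<forall>s\<in>{..<k}. [(if s = j then 1 else 0) = (\<Sum>t\<in>T. c t * int (t s))] (mod int p)"
  proof (rule orthogonal_to_kernel_imp_combination[OF p])
    fix f :: "nat \<Rightarrow> int" assume f: "\<And>t. t \<in> T \<Longrightarrow>
      [(\<Sum>s<k. int (t s) * f s) = 0] (mod int p)"
    define \<alpha> where "\<alpha> = (\<lambda>i\<in>{..<k}. f i mod int p)"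
    have ann: "[(\<Sum>i<k. \<alpha> i * int (a i)) = 0] (mod int p)" if a: "act k a x = x" for a
    proof -
      define b where "b = (\<lambda>i\<in>{..<k}. a i mod p)"
      have ba: "[b i = a i] (mod p)" if "i < k" for i using that by (simp add: b_def)
      have "act k b x = x" using act_cong[of k b a x] ba a by simp
      then have "b \<in> T" using prime_gt_0_nat[OF p] by (auto simp: T_def b_def)
      have "[(\<Sum>i<k. \<alpha> i * int (a i)) = (\<Sum>i<k. int (b i) * f i)] (mod int p)"
      proof (rule cong_sum)
        fix i assume i: "i \<in> {..<k}"
        have "[\<alpha> i = f i] (mod int p)" using i by (simp add: \<alpha>_def)
        moreover have "[int (a i) = int (b i)] (mod int p)" using ba[of i] i by (simp add: cong_int_iff cong_sym)
        ultimately have "[\<alpha> i * int (a i) = f i * int (b i)] (mod int p)" by (rule cong_mult)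
        then show "[\<alpha> i * int (a i) = int (b i) * f i] (mod int p)" by (simp add: mult.commute)
      qed
      then show ?thesis using f[OF \<open>b \<in> T\<close>] cong_trans by blast
    qed
    have "\<alpha> \<in> {..<k} \<rightarrow>\<^sub>E {0..<int p}" using prime_gt_0_nat[OF p]
      by (auto simp: \<alpha>_def)
    then have "\<alpha> j = 0" using neg ann assms(1) unfolding characters_def by blast
    then show "[(\<Sum>s<k. (if s = j then 1 else 0) * f s) = 0] (mod int p)"
      using assms(1) by (simp add: if_distrib if_distribR \<alpha>_def cong_def cong: if_cong)
  qed (use \<open>finite T\<close> in auto)
  then obtain c where c: "\<And>s. s < k \<Longrightarrow>
    [(if s = j then 1 else 0) = (\<Sum>t\<in>T. c t * int (t s))] (mod int p)"
    by auto
  \<comment> \<open>Exponents must be natural numbers, so the coefficients are replaced by their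
    residues.\<close>
  define n where "n t = nat (c t mod int p)" for t
  have n: "[int (n t) = c t] (mod int p)" for t
    using prime_gt_0_nat[OF p] by (simp add: n_def)
  have "[(if s = j then 1 else 0) = (\<Sum>t\<in>T. n t * t s)] (mod p)" if "s < k" for s
  proof -
    have "[(\<Sum>t\<in>T. c t * int (t s)) = (\<Sum>t\<in>T. int (n t) * int (t s))] (mod int p)"
      by (intro cong_sum cong_mult cong_refl cong_sym[OF n])
    from cong_trans[OF c[OF that] this]
    have "[int (if s = j then 1 else 0) = int (\<Sum>t\<in>T. n t * t s)] (mod int p)"
      by (simp add: if_distrib cong: if_cong)
    then show ?thesis by (simp only: cong_int_iff)
  qed
  then have "act k (\<lambda>i. if i = j then 1 else 0) x = act k (\<lambda>s. \<Sum>t\<in>T. n t * t s) x"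
    by (intro act_cong) auto
  also have "\<dots> = x"
    by (rule act_sum[OF \<open>finite T\<close>]) (auto simp: T_def)
  finally show False using act_single[of k j x] assms by simp
qed

lemma act_inverse: "act k (\<lambda>j. (p - 1) * a j) (act k a x) = x"
proof -
  have "act k (\<lambda>j. (p - 1) * a j + a j) x = act k (\<lambda>_. 0) x"
  proof (rule act_cong)
    fix j
    have "(p - 1) * a j + a j = p * a j" using prime_gt_0_nat[OF p] by (cases p) auto
    then show "[(p - 1) * a j + a j = 0] (mod p)" by (simp add: cong_0_iff)
  qed simp
  then show ?thesis using act_add[of k "\<lambda>j. (p - 1) * a j" a x] by (simp add: act_zero)
qed

definition orbit :: "'x \<Rightarrow> 'x set" where "orbit x = range (\<lambda>a. act k a x)"

lemma orbit_act: "orbit (act k b x) = orbit x"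
proof -
  have sub: "orbit (act k b x) \<subseteq> orbit x" for b x
  proof
    fix y assume "y \<in> orbit (act k b x)"
    then obtain a where "y = act k a (act k b x)" by (auto simp: orbit_def)
    then have "y = act k (\<lambda>j. a j + b j) x" using act_add[of k a b x] by simp
    then show "y \<in> orbit x" by (simp add: orbit_def)
  qed
  show ?thesis
    using sub[of b x] sub[of "\<lambda>j. (p - 1) * b j" "act k b x"] unfolding act_inverse by blast
qed

lemma act_step: "i < k \<Longrightarrow> g i x = act k (\<lambda>j. if j = i then 1 else 0) x"
  using act_single[of k i] by simp

text \<open>Write \<open>x\<close> as a translate of a representative of its orbit and apply to the
  exponent vector a character that vanishes on the stabilizer. The result \<open>\<rho> x\<close>
  does not depend on the exponents chosen, and \<open>g i\<close> raises it by the
  \<open>i\<close>-th coordinate of the character.\<close>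

lemma exists_coordinates:
  "\<exists>\<alpha> \<rho>. \<forall>x. (\<exists>j<k. g j x \<noteq> x) \<longrightarrow>
    \<alpha> x \<in> characters \<and>
     (\<forall>i<k. \<alpha> (g i x) = \<alpha> x \<and> [\<rho> (g i x) = \<rho> x + \<alpha> x i] (mod int p))"
proof -
  \<comment> \<open>The choice depends only on the orbit as a set, so \<open>r\<close> is constant
    on orbits.\<close>
  define r where "r x = (SOME y. y \<in> orbit x)" for x
  have "r x \<in> orbit x" for x
    unfolding r_def by (rule someI_ex) (auto simp: orbit_def)
  then have r: "\<exists>a. r x = act k a x" for x by (auto simp: orbit_def)
  then have "\<exists>a. act k a (r x) = x" for x by (metis act_inverse)
  then obtain A where A: "\<And>x. act k (A x) (r x) = x" by metis
  have r_step: "r (g i x) = r x" if "i < k" for i x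
    unfolding r_def act_step[OF that] orbit_act ..
  have "\<forall>x. \<exists>\<alpha>. (\<exists>j<k. g j x \<noteq> x) \<longrightarrow>
    \<alpha> \<in> characters \<and>
      (\<forall>a. act k a x = x \<longrightarrow> [(\<Sum>i<k. \<alpha> i * int (a i)) = 0] (mod int p))"
    using exists_character by blast
  from choice[OF this] obtain \<beta> where \<beta>: "\<And>x. \<exists>j<k. g j x \<noteq> x \<Longrightarrow>
    \<beta> x \<in> characters"
    "\<And>x a. \<exists>j<k. g j x \<noteq> x \<Longrightarrow> act k a x = x \<Longrightarrow>
      [(\<Sum>i<k. \<beta> x i * int (a i)) = 0] (mod int p)"
    by blast
  define \<alpha> where "\<alpha> x = \<beta> (r x)" for x
  define \<rho> where "\<rho> x = (\<Sum>i<k. \<alpha> x i * int (A x i))" for x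
  have "\<alpha> x \<in> characters \<and> (\<forall>i<k. \<alpha> (g i x) = \<alpha> x \<and>
    [\<rho> (g i x) = \<rho> x + \<alpha> x i] (mod int p))"
    if nfx: "\<exists>j<k. g j x \<noteq> x" for x
  proof -
    obtain j where j: "j < k" "g j x \<noteq> x" using nfx by auto
    have "g j (r x) \<noteq> r x"
    proof
      assume "g j (r x) = r x"
      then have "g j (act k (A x) (r x)) = act k (A x) (r x)"
        using commute_act[of k j 1 "A x" "r x"] j(1) by simp
      then show False using j A by simp
    qed
    then have nf: "\<exists>j<k. g j (r x) \<noteq> r x" using j by blast
    \<comment> \<open>Two exponent vectors with the same effect on \<open>r x\<close> differ by a
      stabilizer element, on which the character vanishes.\<close>
    have well_def: "[(\<Sum>i<k. \<alpha> x i * int (a i)) = (\<Sum>i<k. \<alpha> x i * int (b i))] (mod int p)"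
      if "act k a (r x) = act k b (r x)" for a b
    proof -
      have "act k (\<lambda>j. (p - 1) * b j + a j) (r x) = r x"
        using act_add[of k "\<lambda>j. (p - 1) * b j" a "r x"] that act_inverse by simp
      from \<beta>(2)[OF nf this]
      have "[(\<Sum>i<k. \<alpha> x i * int ((p - 1) * b i + a i)) = 0] (mod int p)"
        by (simp add: \<alpha>_def)
      also have "(\<Sum>i<k. \<alpha> x i * int ((p - 1) * b i + a i)) =
          (\<Sum>i<k. \<alpha> x i * int (a i)) - (\<Sum>i<k. \<alpha> x i * int (b i)) +
            int p * (\<Sum>i<k. \<alpha> x i * int (b i))"
      proof -
        have "int (p - 1) = int p - 1" using prime_gt_0_nat[OF p] by (simp add: of_nat_diff)
        then have "\<alpha> x i * int ((p - 1) * b i + a i) =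
            \<alpha> x i * int (a i) - \<alpha> x i * int (b i) + int p * (\<alpha> x i * int (b i))" for i
          by (simp only: of_nat_add of_nat_mult) (simp add: algebra_simps)
        then show ?thesis by (simp add: sum.distrib sum_subtractf sum_distrib_left)
      qed
      finally show ?thesis
        unfolding cong_iff_dvd_diff diff_0_right by (metis dvd_add_left_iff dvd_triv_left)
    qed
    have "\<alpha> (g i x) = \<alpha> x \<and> [\<rho> (g i x) = \<rho> x + \<alpha> x i] (mod int p)"
      if i: "i < k" for i
    proof -
      have "act k (A (g i x)) (r x) = g i x" using A[of "g i x"] r_step[OF i] by simp
      also have "\<dots> = act k (\<lambda>j. (if j = i then 1 else 0) + A x j) (r x)"
        using act_add[of k "\<lambda>j. if j = i then 1 else 0" "A x" "r x"] act_step[OF i, of x] A[of x] by simp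
      finally have "[(\<Sum>j<k. \<alpha> x j * int (A (g i x) j)) =
          (\<Sum>j<k. \<alpha> x j * int ((if j = i then 1 else 0) + A x j))] (mod int p)"
        by (rule well_def)
      moreover have "(\<Sum>j<k. \<alpha> x j * int ((if j = i then 1 else 0) + A x j)) = \<rho> x + \<alpha> x i"
      proof -
        have "(\<Sum>j<k. \<alpha> x j * int ((if j = i then 1 else 0) + A x j)) =
            (\<Sum>j<k. (if j = i then \<alpha> x i else 0) + \<alpha> x j * int (A x j))"
          by (rule sum.cong) (auto simp: distrib_left)
        then show ?thesis using i by (simp add: sum.distrib \<rho>_def)
      qed
      moreover have "\<alpha> (g i x) = \<alpha> x" by (simp add: \<alpha>_def r_step[OF i])
      ultimately show ?thesis by (simp add: \<rho>_def)
    qed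
    then show ?thesis using \<beta>(1)[OF nf] by (simp add: \<alpha>_def)
  qed
  then show ?thesis by blast
qed

end

section \<open>The operator \<open>t\<close>\<close>

definition X_pow :: "nat \<Rightarrow> int poly" where "X_pow j = monom 1 j"

lemma prime_elem_dvd_prod_iff:
  "finite A \<Longrightarrow> prime_elem q \<Longrightarrow>
    q dvd prod f A \<longleftrightarrow> (\<exists>x\<in>A. q dvd f x)"
  by (induction A rule: finite_induct) (auto simp: prime_elem_dvd_mult_iff prime_elem_not_unit)

context commuting_maps
begin

text \<open>The scalar is absorbed into the group element, so that \<open>t\<close> is a sum of
  commuting operators minus a constant scalar, the shape required by
  \<open>commutator_power_shift\<close>.\<close>

definition \<tau> :: "nat \<Rightarrow> ('x \<Rightarrow> int poly) endo" where
  "\<tau> j = scale (\<lambda>_. X_pow j) * shift (g j)"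

definition t :: "('x \<Rightarrow> int poly) endo" where
  "t = (\<Sum>j<k. \<tau> j) - scale (\<lambda>_. \<Sum>j<k. X_pow j)"

lemma \<tau>_commute: "i < k \<Longrightarrow> j < k \<Longrightarrow> \<tau> i * \<tau> j = \<tau> j * \<tau> i"
  unfolding \<tau>_def by (rule endo_eqI) (auto simp: fun_eq_iff commute)

lemma scale_\<tau>_commute: "w \<circ> g j = w \<Longrightarrow> scale w * \<tau> j = \<tau> j * scale w"
  unfolding \<tau>_def by (rule endo_eqI) (auto simp: fun_eq_iff)

lemma \<tau>_power: "j < k \<Longrightarrow> \<tau> j ^ p = scale (\<lambda>_. X_pow j ^ p)"
proof -
  assume j: "j < k"
  have "scale (\<lambda>_. X_pow j) * shift (g j) = shift (g j) * scale (\<lambda>_. X_pow j)"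
    by (rule endo_eqI) (auto simp: fun_eq_iff)
  then have "\<tau> j ^ p = scale (\<lambda>_. X_pow j) ^ p * shift (g j) ^ p"
    unfolding \<tau>_def by (rule power_mult_distrib_commuting)
  also have "shift (g j) ^ p = shift id"
    unfolding shift_power using order[OF j] by (metis eq_id_iff)
  finally show ?thesis
    unfolding scale_power[symmetric] shift_id mult_1_right
    by (auto intro!: arg_cong[of _ _ scale] simp: fun_eq_iff power_fun_apply)
qed

lemma t_\<tau>_commute: "j < k \<Longrightarrow> t * \<tau> j = \<tau> j * t"
  unfolding t_def left_diff_distrib right_diff_distrib sum_distrib_left sum_distrib_right
  using scale_\<tau>_commute[of "\<lambda>_. \<Sum>j<k. X_pow j" j] by (simp add: \<tau>_commute comp_def)

lemma t_scale_commute: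
  assumes "\<And>j. j < k \<Longrightarrow> w \<circ> g j = w"
  shows "t * scale w = scale w * t"
  unfolding t_def left_diff_distrib right_diff_distrib sum_distrib_left sum_distrib_right
  using scale_commute[of w "\<lambda>_. \<Sum>j<k. X_pow j"] assms by (simp add: scale_\<tau>_commute)

text \<open>By Frobenius the \<open>p\<close>-th power may be taken termwise, and \<open>g j\<close>
  has order dividing \<open>p\<close>.\<close>

lemma t_power_p: "congruent_mod p (t ^ p) 0"
proof -
  define s where "s = (scale (\<lambda>_. \<Sum>j<k. X_pow j) :: ('x \<Rightarrow> int poly) endo)"
  have "(\<Sum>j<k. \<tau> j) * s = s * (\<Sum>j<k. \<tau> j)"
    unfolding s_def sum_distrib_left sum_distrib_right
    by (rule sum.cong) (use scale_\<tau>_commute[of "\<lambda>_. \<Sum>j<k. X_pow j"] in \<open>auto simp: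
      comp_def\<close>)
  then have "congruent_mod p (((\<Sum>j<k. \<tau> j) + (- s)) ^ p) ((\<Sum>j<k. \<tau> j) ^ p + (- s) ^ p)"
    by (intro freshman_commuting p) simp
  also have "congruent_mod p ((\<Sum>j<k. \<tau> j) ^ p + (- s) ^ p) ((\<Sum>j<k. \<tau> j ^ p) + (- s) ^ p)"
    by (intro congruent_mod_add congruent_mod_refl freshman_sum_commuting p) (auto simp: \<tau>_commute)
  also have "(\<Sum>j<k. \<tau> j ^ p) = scale (\<lambda>_. \<Sum>j<k. X_pow j ^ p)"
  proof -
    have "(\<Sum>j<k. \<tau> j ^ p) = (\<Sum>j<k. scale (\<lambda>_. X_pow j ^ p))"
      by (rule sum.cong) (auto simp: \<tau>_power)
    also have "\<dots> = scale (\<Sum>j<k. (\<lambda>_. X_pow j ^ p))" by (simp only: scale_sum)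
    also have "(\<Sum>j<k. (\<lambda>_. X_pow j ^ p)) = (\<lambda>_::'x. \<Sum>j<k. X_pow j ^ p)"
      by (auto simp: fun_eq_iff sum_fun_apply)
    finally show ?thesis .
  qed
  also have "\<dots> + (- s) ^ p = scale (\<lambda>_. (\<Sum>j<k. X_pow j ^ p) + (- (\<Sum>j<k. X_pow j)) ^ p)"
    unfolding s_def scale_uminus[symmetric] scale_power[symmetric] scale_add[symmetric]
    by (rule arg_cong[of _ _ scale]) (auto simp: fun_eq_iff power_fun_apply)
  \<comment> \<open>Frobenius applied to \<open>?X + (- ?X) = 0\<close> disposes of the scalar part
    without a case distinction on the sign of \<open>(- 1) ^ p\<close>.\<close>
  also have "congruent_mod p \<dots> (scale 0)"
  proof (rule scale_congruent, unfold congruent_mod_fun_iff, rule allI)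
    fix x :: 'x
    let ?X = "\<Sum>j<k. X_pow j"
    have "congruent_mod p ((?X + (- ?X)) ^ p) (?X ^ p + (- ?X) ^ p)"
      by (rule freshman_commuting[OF p]) simp
    also have "congruent_mod p (?X ^ p + (- ?X) ^ p) ((\<Sum>j<k. X_pow j ^ p) + (- ?X) ^ p)"
      by (intro congruent_mod_add congruent_mod_refl freshman_sum_commuting p) simp
    finally show "congruent_mod p ((\<Sum>j<k. X_pow j ^ p) + (- ?X) ^ p) (0 x)"
      using prime_gt_0_nat[OF p] by (simp add: congruent_mod_sym power_0_left)
  qed
  finally show ?thesis by (simp add: t_def s_def scale_0)
qed

text \<open>Modulo \<open>p\<close> this is the \<open>p\<close>-th power of
  \<open>\<Sum>j<k. of_int (\<alpha> j) * X_pow j\<close>. It is the scalar by which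
  \<open>U ^ p\<close> below acts at points with character \<open>\<alpha>\<close>; the distinct
  exponents \<open>j * p\<close> keep the coordinates of \<open>\<alpha>\<close> apart.\<close>

definition char_norm :: "(nat \<Rightarrow> int) \<Rightarrow> int poly" where
  "char_norm \<alpha> = (\<Sum>j<k. of_int (\<alpha> j) ^ p * X_pow j ^ p)"

text \<open>The factorial comes from taking \<open>p - 1\<close> differences of a power with
  exponent \<open>p - 1\<close>. The product over all characters gives the same scalar on all
  orbits; being constant, it commutes with the boundary, although a cell and its facets may have
  different characters.\<close>

definition \<kappa> :: "int poly" where
  "\<kappa> = of_nat (fact (p - 1)) * (\<Prod>\<beta>\<in>characters. char_norm \<beta>)"

lemma prime_elem_p: "prime_elem (of_nat p :: int poly)"
  using p by (simp add: of_nat_poly lift_prime_elem_poly)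

text \<open>As \<open>p\<close> is prime in Z[s], the factors can be treated separately;
  \<open>char_norm \<alpha>\<close> has the coefficient \<open>\<alpha> j ^ p\<close> in degree
  \<open>j * p\<close>.\<close>

lemma \<kappa>_not_dvd: "\<not> of_nat p dvd \<kappa>"
proof -
  have "\<not> of_nat p dvd char_norm \<alpha>" if \<alpha>: "\<alpha> \<in> characters" for \<alpha>
  proof
    assume dvd: "of_nat p dvd char_norm \<alpha>"
    obtain j where j: "j < k" "\<alpha> j \<noteq> 0" using \<alpha> by (auto simp: characters_def)
    have "\<alpha> j \<in> {0..<int p}"
      using \<alpha> j(1) unfolding characters_def
        by (intro PiE_mem[of \<alpha> "{..<k}" "\<lambda>_. {0..<int p}"]) simp_all
    then have nd: "\<not> int p dvd \<alpha> j" using j(2) by (auto dest: zdvd_imp_le)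
    have "int p dvd coeff (char_norm \<alpha>) (j * p)"
      using dvd by (simp add: of_nat_poly const_poly_dvd_iff)
    also have "coeff (char_norm \<alpha>) (j * p) = (\<Sum>i<k. if i = j then \<alpha> j ^ p else 0)"
      unfolding char_norm_def coeff_sum
    proof (rule sum.cong)
      fix i
      have "of_int (\<alpha> i) ^ p = (monom (\<alpha> i) 0 ^ p :: int poly)" by (simp add: of_int_poly monom_0)
      then have "of_int (\<alpha> i) ^ p * X_pow i ^ p = monom (\<alpha> i ^ p) (i * p)"
        by (simp add: X_pow_def monom_power mult_monom)
      then show "coeff (of_int (\<alpha> i) ^ p * X_pow i ^ p) (j * p) = (if i = j then \<alpha> j ^ p else 0)"
        using prime_gt_0_nat[OF p] by simp
    qed simp
    finally have "int p dvd \<alpha> j ^ p" using j(1) by simp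
    then show False using nd p prime_dvd_power[of "int p" "\<alpha> j"] by simp
  qed
  moreover have "\<not> of_nat p dvd (of_nat (fact (p - 1)) :: int poly)"
  proof -
    have "\<not> p dvd fact (p - 1)" using p prime_dvd_fact_iff[OF p, of "p - 1"] prime_gt_0_nat[OF p] by auto
    then have "\<not> int p dvd int (fact (p - 1))" by (simp only: of_nat_dvd_iff) simp
    then show ?thesis
      unfolding of_nat_poly const_poly_dvd_iff by (intro notI) (drule spec[of _ 0], simp)
  qed
  ultimately show ?thesis
    unfolding \<kappa>_def using prime_elem_p finite_characters
    by (auto simp: prime_elem_dvd_mult_iff prime_elem_dvd_prod_iff)
qed

end

section \<open>Freeness over the ring generated by \<open>t\<close>, from a coordinate on the
  orbits\<close>

locale coordinate_maps = commuting_maps +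
  fixes S :: "'a set" and \<alpha> :: "'a \<Rightarrow> nat \<Rightarrow> int" and \<rho> :: "'a \<Rightarrow> int"
  assumes S: "\<And>i x. i < k \<Longrightarrow> g i x \<in> S \<longleftrightarrow> x \<in> S"
    and \<alpha>: "\<And>x. x \<in> S \<Longrightarrow> \<alpha> x \<in> characters"
    and \<alpha>_inv: "\<And>i x. i < k \<Longrightarrow> x \<in> S \<Longrightarrow> \<alpha> (g i x) = \<alpha> x"
    and \<rho>: "\<And>i x. i < k \<Longrightarrow> x \<in> S \<Longrightarrow>
      [\<rho> (g i x) = \<rho> x + \<alpha> x i] (mod int p)"
begin

definition slope :: "nat \<Rightarrow> 'a \<Rightarrow> int poly" where
  "slope j x = (if x \<in> S then of_int (\<alpha> x j) else 0)"

definition height :: "'a \<Rightarrow> int poly" where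
  "height x = (if x \<in> S then of_int (\<rho> x) else 0)"

text \<open>Completes \<open>char_norm (\<alpha> x)\<close>, which varies with the orbit, to the
  product over all characters, which does not.\<close>

definition cofactor :: "'a \<Rightarrow> int poly" where
  "cofactor x = (if x \<in> S then \<Prod>\<beta>\<in>characters - {\<alpha> x}. char_norm \<beta> else 0)"

text \<open>Modulo \<open>p\<close> this is the commutator of \<open>t\<close> with multiplication
  by \<open>height\<close>.\<close>

definition U :: "('a \<Rightarrow> int poly) endo" where
  "U = (\<Sum>j<k. scale (slope j) * \<tau> j)"

text \<open>The \<open>p - 1\<close> commutators turn the power of \<open>height\<close> into a
  multiple of \<open>U ^ (p - 1)\<close>. The extra factor \<open>U\<close> makes this
  \<open>U ^ p\<close>, a scalar, and \<open>cofactor\<close> makes the scalar uniform.\<close>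

definition K :: "('a \<Rightarrow> int poly) endo" where
  "K = scale cofactor * U * scale height ^ (p - 1)"

lemma of_int_congruent: "[a = b] (mod int p) \<Longrightarrow> congruent_mod p (of_int a :: int poly) (of_int b)"
proof -
  assume "[a = b] (mod int p)"
  then obtain c where "a = b + int p * c" by (metis cong_iff_lin cong_sym)
  then show ?thesis by (auto simp: congruent_mod_def)
qed

lemma slope_inv: "i < k \<Longrightarrow> slope j \<circ> g i = slope j"
  by (auto simp: slope_def fun_eq_iff S \<alpha>_inv)

text \<open>The summands commute, so Frobenius applies, and each \<open>\<tau> j ^ p\<close> is
  already a scalar.\<close>

lemma U_power: "congruent_mod p (U ^ p) (scale (\<lambda>x. if x \<in> S then char_norm (\<alpha> x) else 0))"
proof -
  have "congruent_mod p (U ^ p) (\<Sum>j<k. (scale (slope j) * \<tau> j) ^ p)"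
    unfolding U_def
  proof (rule freshman_sum_commuting[OF p])
    fix i j assume ij: "i \<in> {..<k}" "j \<in> {..<k}"
    have *: "scale (slope i) * \<tau> i * (scale (slope j) * \<tau> j) =
        scale (slope i) * scale (slope j) * (\<tau> i * \<tau> j)" if "i < k" for i j
    proof -
      have "scale (slope i) * \<tau> i * (scale (slope j) * \<tau> j) =
        scale (slope i) * (\<tau> i * scale (slope j)) * \<tau> j"
        by (simp only: mult.assoc)
      also have "\<tau> i * scale (slope j) = scale (slope j) * \<tau> i"
        by (rule scale_\<tau>_commute[OF slope_inv[OF that], symmetric])
      finally show ?thesis by (simp only: mult.assoc)
    qed
    have "scale (slope i) * \<tau> i * (scale (slope j) * \<tau> j) =
      scale (slope i) * scale (slope j) * (\<tau> i * \<tau> j)"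
      by (rule *) (use ij in simp)
    also have "\<dots> = scale (slope j) * scale (slope i) * (\<tau> j * \<tau> i)"
      using ij \<tau>_commute[of i j] scale_commute[of "slope i" "slope j"] by simp
    also have "\<dots> = scale (slope j) * \<tau> j * (scale (slope i) * \<tau> i)"
      by (rule *[symmetric]) (use ij in simp)
    finally show "scale (slope i) * \<tau> i * (scale (slope j) * \<tau> j) =
        scale (slope j) * \<tau> j * (scale (slope i) * \<tau> i)" .
  qed
  also have "(\<Sum>j<k. (scale (slope j) * \<tau> j) ^ p) =
    (\<Sum>j<k. scale (slope j ^ p * (\<lambda>_. X_pow j ^ p)))"
  proof (rule sum.cong)
    fix j assume "j \<in> {..<k}"
    then show "(scale (slope j) * \<tau> j) ^ p = scale (slope j ^ p * (\<lambda>_. X_pow j ^ p))"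
      using power_mult_distrib_commuting[OF scale_\<tau>_commute[OF slope_inv], of j j p]
      by (simp only: scale_mult scale_power \<tau>_power lessThan_iff)
  qed simp
  also have "\<dots> = scale (\<Sum>j<k. slope j ^ p * (\<lambda>_. X_pow j ^ p))" by (simp only: scale_sum)
  also have "(\<Sum>j<k. slope j ^ p * (\<lambda>_. X_pow j ^ p)) = (\<lambda>x.
    if x \<in> S then char_norm (\<alpha> x) else 0)"
    using prime_gt_0_nat[OF p]
    by (auto simp: fun_eq_iff sum_fun_apply power_fun_apply slope_def char_norm_def power_0_left)
  finally show ?thesis .
qed

lemma t_commute_U: "t * U = U * t"
  unfolding U_def sum_distrib_left sum_distrib_right
proof (rule sum.cong)
  fix j assume "j \<in> {..<k}"
  then have "t * \<tau> j = \<tau> j * t" by (simp add: t_\<tau>_commute)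
  moreover have "t * scale (slope j) = scale (slope j) * t" by (rule t_scale_commute) (rule slope_inv)
  ultimately show "t * (scale (slope j) * \<tau> j) = scale (slope j) * \<tau> j * t"
    by (simp only: mult.assoc[symmetric]) (simp only: mult.assoc)
qed simp

lemma t_commute_cofactor: "t * scale cofactor = scale cofactor * t"
  by (rule t_scale_commute) (auto simp: cofactor_def fun_eq_iff S \<alpha>_inv)

text \<open>
  Higman's criterion: the identity is, up to the scalar \<open>\<kappa>\<close>, a trace with
  respect to \<open>t\<close>, so the module is free over the truncated polynomial ring generated by
  \<open>t\<close>.
\<close>

lemma trace_K:
  "congruent_mod p (\<Sum>i<p. t ^ (p - 1 - i) * K * t ^ i) (scale (\<lambda>x. if x \<in> S then \<kappa> else 0))"
proof -
  let ?L = "scale height"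
  have shift: "congruent_mod p (\<tau> j * ?L) ((?L + scale (slope j)) * \<tau> j)" if j: "j < k" for j
  proof -
    have eq: "\<tau> j * ?L = scale (\<lambda>_. X_pow j) * (scale (height \<circ> g j) * shift (g j))"
      by (simp only: \<tau>_def mult.assoc shift_scale)
    have "congruent_mod p (\<tau> j * ?L) (scale (\<lambda>_. X_pow j) * (scale (height + slope j) * shift (g j)))"
      unfolding eq
    proof (intro congruent_mod_mult_left congruent_mod_mult_right scale_congruent, unfold congruent_mod_fun_iff, rule
      allI)
      fix x
      show "congruent_mod p ((height \<circ> g j) x) ((height + slope j) x)"
        using of_int_congruent[OF \<rho>[OF j, of x]] by (auto simp: height_def slope_def S j)
    qed
    also have "scale (\<lambda>_. X_pow j) * (scale (height + slope j) * shift (g j)) = (?L +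
      scale (slope j)) * \<tau> j"
      unfolding \<tau>_def mult.assoc[symmetric] scale_add[symmetric] scale_commute[of "\<lambda>_. X_pow j"] ..
    finally show ?thesis .
  qed
  \<comment> \<open>The exponent \<open>p - 1\<close> is the one for which \<open>p - 1\<close>
    differences leave a term without \<open>height\<close>.\<close>
  have "congruent_mod p ((commutator t ^^ (p - 1)) (?L ^ (p - 1)))
      (if p - 1 = p - 1 then of_nat (fact (p - 1)) * U ^ (p - 1) else 0)"
  proof (rule commutator_power_shift[where J = "{..<k}" and \<tau> = \<tau> and a = "\<lambda>j. scale (slope j)"])
    show "t = sum \<tau> {..<k} - scale (\<lambda>_. \<Sum>j<k. X_pow j)" by (rule t_def)
  qed (use shift in \<open>simp_all add: scale_commute t_\<tau>_commute t_scale_commute slope_inv scale_\<tau>_commute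
    U_def\<close>)
  then have *: "congruent_mod p (\<Sum>i<p. t ^ (p - 1 - i) * ?L ^ (p - 1) * t ^ i) (of_nat (fact (p - 1)) * U ^ (p -
    1))"
    using congruent_mod_trans[OF congruent_mod_sym[OF commutator_power_pred_prime[OF p]]] by simp
  \<comment> \<open>The part of \<open>K\<close> that commutes with \<open>t\<close> can be moved
    out of the trace.\<close>
  define V where "V = scale cofactor * U"
  have "t * V = V * t"
    unfolding V_def
    by (simp only: mult.assoc[symmetric] t_commute_cofactor) (simp only: mult.assoc t_commute_U)
  then have tV: "t ^ i * V = V * t ^ i" for i by (rule power_commuting_commutes)
  have "(\<Sum>i<p. t ^ (p - 1 - i) * K * t ^ i) = V * (\<Sum>i<p. t ^ (p - 1 - i) * ?L ^ (p - 1) * t ^ i)"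
    unfolding sum_distrib_left K_def V_def[symmetric]
    by (rule sum.cong) (simp_all only: mult.assoc[symmetric] tV)
  also have "congruent_mod p \<dots> (V * (of_nat (fact (p - 1)) * U ^ (p - 1)))"
    by (rule congruent_mod_mult_left[OF *])
  also have "V * (of_nat (fact (p - 1)) * U ^ (p - 1)) = of_nat (fact (p - 1)) * (scale cofactor * U ^ p)"
  proof -
    have "U * U ^ (p - 1) = U ^ p" using prime_gt_0_nat[OF p] by (simp flip: power_Suc)
    then have "V * U ^ (p - 1) = scale cofactor * U ^ p" by (simp only: V_def mult.assoc)
    moreover have "V * of_nat (fact (p - 1)) = of_nat (fact (p - 1)) * V"
      by (rule mult_of_nat_commute[symmetric])
    ultimately show ?thesis by (simp only: mult.assoc[symmetric]) (simp only: mult.assoc)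
  qed
  also have "congruent_mod p \<dots> (of_nat (fact (p - 1)) * (scale cofactor * scale (\<lambda>x.
    if x \<in> S then char_norm (\<alpha> x) else 0)))"
    by (intro congruent_mod_mult_left U_power)
  also have "of_nat (fact (p - 1)) * (scale cofactor * scale (\<lambda>x.
    if x \<in> S then char_norm (\<alpha> x) else 0)) =
      scale (\<lambda>x. if x \<in> S then \<kappa> else 0)"
    unfolding scale_of_nat[symmetric] scale_mult[symmetric]
  proof (intro arg_cong[of _ _ scale] ext)
    fix x
    show "(of_nat (fact (p - 1)) * (cofactor * (\<lambda>x.
      if x \<in> S then char_norm (\<alpha> x) else 0))) x = (if x \<in> S then \<kappa> else 0)"
      using prod.remove[OF finite_characters \<alpha>, of x char_norm]
      by (simp add: cofactor_def \<kappa>_def of_nat_fun_apply mult.commute mult.left_commute del: of_nat_fact)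
  qed
  finally show ?thesis .
qed

end

section \<open>Alternating functions on lists\<close>

text \<open>No order of the vertices is fixed, since the group would not preserve it; on alternating
  functions it acts by plain precomposition, without signs.\<close>

definition alternating :: "('a list \<Rightarrow> 'r::ab_group_add) \<Rightarrow> bool" where
  "alternating c \<longleftrightarrow> (\<forall>u a b v. c (u @ a # b # v) = - c (u @ b # a # v))"

lemma alternatingD: "alternating c \<Longrightarrow> c (u @ a # b # v) = - c (u @ b # a # v)"
  by (rule alternating_def[THEN iffD1, rule_format])

lemma alternatingI: "(\<And>u a b v. c (u @ a # b # v) = - c (u @ b # a # v)) \<Longrightarrow> alternating c"
  unfolding alternating_def by (intro allI)

lemma alternating_0: "alternating 0"
  by (rule alternatingI) (simp only: zero_fun_apply minus_zero)

lemma alternating_add: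
  assumes "alternating c" "alternating d"
  shows "alternating (c + d)"
proof (rule alternatingI)
  fix u a b v
  show "(c + d) (u @ a # b # v) = - (c + d) (u @ b # a # v)"
    using alternatingD[OF assms(1), of u a b v] alternatingD[OF assms(2), of u a b v] by simp
qed

lemma alternating_uminus:
  assumes "alternating c"
  shows "alternating (- c)"
proof (rule alternatingI)
  fix u a b v
  show "(- c) (u @ a # b # v) = - (- c) (u @ b # a # v)"
    using alternatingD[OF assms, of u a b v] by simp
qed

lemma alternating_map:
  assumes "alternating c"
  shows "alternating (c \<circ> map g)"
proof (rule alternatingI)
  fix u a b v
  show "(c \<circ> map g) (u @ a # b # v) = - (c \<circ> map g) (u @ b # a # v)"
    using alternatingD[OF assms, of "map g u" "g a" "g b" "map g v"] by simp
qed

lemma alternating_move: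
  fixes c :: "'a list \<Rightarrow> 'r::ring_1"
  assumes "alternating c"
  shows "c (u @ a # v @ w) = (- 1) ^ length v * c (u @ v @ a # w)"
proof (induction v arbitrary: u)
  case (Cons b v)
  have "c (u @ a # b # v @ w) = - c ((u @ [b]) @ a # v @ w)"
    using alternatingD[OF assms, of u a b "v @ w"] by simp
  then show ?case unfolding Cons.IH by simp
qed simp

lemma alternating_swap:
  fixes c :: "'a list \<Rightarrow> 'r::ring_1"
  assumes "alternating c"
  shows "c (u @ a # v @ b # w) = - c (u @ b # v @ a # w)"
proof -
  have "c (u @ a # v @ b # w) = (- 1) ^ length v * c (u @ v @ a # b # w)"
    by (rule alternating_move[OF assms])
  also have "c (u @ v @ a # b # w) = - c (u @ v @ b # a # w)"
    using alternatingD[OF assms, of "u @ v" a b w] by simp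
  also have "(- 1) ^ length v * - c (u @ v @ b # a # w) = - c (u @ b # v @ a # w)"
    using alternating_move[OF assms, of u b v "a # w"] by simp
  finally show ?thesis .
qed

lemma eq_uminus_imp_0: "(x::'r::{idom,ring_char_0}) = - x \<Longrightarrow> x = 0"
proof -
  assume x: "x = - x"
  have "2 * x = x + x" by (rule mult_2)
  also have "x + x = 0" by (subst (2) x) (rule right_minus)
  finally show "x = 0" unfolding mult_eq_0_iff by (rule disjE) (simp, assumption)
qed

text \<open>Swapping two equal entries gives \<open>c l = - c l\<close>, which decides the matter
  only because the coefficients have characteristic 0.\<close>

lemma alternating_distinct:
  fixes c :: "'a list \<Rightarrow> 'r::{idom,ring_char_0}"
  assumes "alternating c" "c l \<noteq> 0"
  shows "distinct l"
proof (rule ccontr)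
  assume "\<not> distinct l"
  from not_distinct_decomp[OF this] obtain u v w y where "l = u @ [y] @ v @ [y] @ w" by blast
  then have "l = u @ y # v @ y # w" by simp
  then show False using alternating_swap[OF assms(1), of u y v y w] eq_uminus_imp_0 assms(2) by auto
qed

lemma symmetric_permutation:
  assumes "\<And>u a b v. F (u @ a # b # v) = F (u @ b # a # v)" and "mset l = mset l'"
  shows "F l = F l'"
proof -
  have move: "F (u @ v @ a # w) = F (u @ a # v @ w)" for u v a w
  proof (induction v arbitrary: u)
    case (Cons b v)
    have "F (u @ b # v @ a # w) = F ((u @ [b]) @ a # v @ w)"
      using Cons.IH[of "u @ [b]"] by simp
    then show ?case using assms(1)[of u b a "v @ w"] by simp
  qed simp
  have "F (u @ l) = F (u @ l')" for u
    using assms(2)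
  proof (induction l arbitrary: u l')
    case (Cons a l)
    then have "a \<in> set l'" by (metis list.set_intros(1) mset_eq_setD)
    then obtain v w where l': "l' = v @ a # w" by (meson split_list)
    then have "mset l = mset (v @ w)" using Cons.prems by simp
    then have "F ((u @ [a]) @ l) = F ((u @ [a]) @ v @ w)" by (rule Cons.IH)
    then show ?case by (simp add: l' move)
  qed simp
  from this[of "[]"] show ?thesis by simp
qed

text \<open>Parity of the number of inversions. The cardinality counts correctly only for distinct
  lists; on the others \<open>list_sign\<close> is 0, as an alternating function must be.\<close>

primrec inversion_sign :: "('a \<Rightarrow> 'a \<Rightarrow> bool) \<Rightarrow> 'a list \<Rightarrow> int" where
  "inversion_sign lt [] = 1"
| "inversion_sign lt (a # l) = (- 1) ^ card {x \<in> set l. lt x a} * inversion_sign lt l"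

definition list_sign :: "('a \<Rightarrow> 'a \<Rightarrow> bool) \<Rightarrow> 'a list \<Rightarrow> int" where
  "list_sign lt l = (if distinct l then inversion_sign lt l else 0)"

lemma inversion_sign_square: "inversion_sign lt l * inversion_sign lt l = 1"
proof (induction l)
  case (Cons a l)
  let ?e = "(- 1) ^ card {x \<in> set l. lt x a} :: int"
  have "?e * inversion_sign lt l * (?e * inversion_sign lt l) =
      ?e * ?e * (inversion_sign lt l * inversion_sign lt l)" by (simp only: mult.assoc mult.left_commute)
  then show ?case by (simp only: inversion_sign.simps Cons) (simp flip: power_mult_distrib)
qed simp

lemma list_sign_square: "distinct l \<Longrightarrow> list_sign lt l * list_sign lt l = 1"
  unfolding list_sign_def by (simp only: if_True inversion_sign_square)

lemma alternating_list_sign: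
  assumes lt: "\<And>a b. a \<noteq> b \<Longrightarrow> lt a b \<longleftrightarrow> \<not> lt b a"
  shows "alternating (list_sign lt)"
proof (rule alternatingI)
  fix u a b v
  have "inversion_sign lt (u @ a # b # v) = - inversion_sign lt (u @ b # a # v)"
    if "distinct (u @ a # b # v)"
    using that
  proof (induction u)
    case Nil
    then have ab: "a \<noteq> b" "a \<notin> set v" "b \<notin> set v" by auto
    have c: "card {x \<in> set (b # v). lt x a} = card {x \<in> set v. lt x a} + (if lt b a then 1 else 0)"
      if "b \<notin> set v" for a b
    proof -
      have "{x \<in> set (b # v). lt x a} =
        (if lt b a then insert b {x \<in> set v. lt x a} else {x \<in> set v. lt x a})"
        by auto
      then show ?thesis using that by simp
    qed
    show ?case using lt[OF ab(1)] by (simp only: append_Nil inversion_sign.simps c ab not_False_eq_True)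
        (simp add: power_add)
  qed (auto simp: insert_commute)
  moreover have "distinct (u @ a # b # v) \<longleftrightarrow> distinct (u @ b # a # v)" by auto
  ultimately show "list_sign lt (u @ a # b # v) = - list_sign lt (u @ b # a # v)"
    by (simp add: list_sign_def)
qed

text \<open>A product of two alternating functions is symmetric. This replaces all computations with
  signs of permutations.\<close>

lemma alternating_ratio:
  fixes c :: "'a list \<Rightarrow> 'r::{idom,ring_char_0}"
  assumes "alternating c" "alternating s" "mset l = mset l'"
  shows "of_int (s l) * c l = of_int (s l') * c l'"
proof (rule symmetric_permutation[where F = "\<lambda>l. of_int (s l) * c l", OF _ assms(3)])
  fix u a b v
  show "of_int (s (u @ a # b # v)) * c (u @ a # b # v) = of_int (s (u @ b # a # v)) * c (u @ b # a # v)"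
    using alternatingD[OF assms(1), of u a b v] alternatingD[OF assms(2), of u a b v] by simp
qed

section \<open>Chains as alternating functions\<close>

text \<open>
  A family \<open>P\<close> of finite sets that contains everything between two of its members is
  the set of simplices of a relative simplicial complex. Chains are alternating functions on the
  orderings of simplices. The simplices are counted by their number of elements.
\<close>

locale relative_complex =
  fixes A :: "'a set" and P :: "'a set set"
  assumes finite_A: "finite A" and P_subset: "\<And>S. S \<in> P \<Longrightarrow> S \<subseteq> A"
    and P_convex: "\<And>S T R. S \<in> P \<Longrightarrow> R \<in> P \<Longrightarrow>
      S \<subseteq> T \<Longrightarrow> T \<subseteq> R \<Longrightarrow> T \<in> P"
begin

definition chain :: "nat \<Rightarrow> ('a list \<Rightarrow> int poly) \<Rightarrow> bool" where
  "chain L c \<longleftrightarrow> alternating c \<and> (\<forall>l. c l \<noteq> 0 \<longrightarrow>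
    set l \<in> P \<and> length l = L)"

text \<open>The coefficient of a face is collected from the simplices that have one more vertex;
  putting that vertex in front accounts for the sign. The condition discards faces outside the
  relative complex.\<close>

definition boundary :: "('a list \<Rightarrow> int poly) endo" where
  "boundary = Endo (\<lambda>c l. if set l \<in> P then \<Sum>a\<in>A. c (a # l) else 0)"

lemma app_boundary: "app boundary c l = (if set l \<in> P then \<Sum>a\<in>A. c (a # l) else 0)"
proof -
  have "(\<lambda>l. if set l \<in> P then \<Sum>a\<in>A. (c + d) (a # l) else 0) =
      (\<lambda>l. if set l \<in> P then \<Sum>a\<in>A. c (a # l) else 0) + (\<lambda>l.
        if set l \<in> P then \<Sum>a\<in>A. d (a # l) else 0)"
    for c d :: "'a list \<Rightarrow> int poly"
    by (rule ext) (simp add: sum.distrib)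
  then show ?thesis unfolding boundary_def by (subst app_Endo) simp_all
qed

lemma chain_alternating: "chain L c \<Longrightarrow> alternating c"
  unfolding chain_def by (rule conjunct1)

lemma chain_support: "chain L c \<Longrightarrow> c l \<noteq> 0 \<Longrightarrow> set l \<in> P \<and> length l = L"
  unfolding chain_def by (drule conjunct2) (drule spec, drule mp)

lemma chainI: "alternating c \<Longrightarrow> (\<And>l. c l \<noteq> 0 \<Longrightarrow> set l \<in> P \<and>
  length l = L) \<Longrightarrow> chain L c"
  unfolding chain_def by (rule conjI) (assumption, intro allI impI)

lemma chain_0: "chain L 0"
proof (rule chainI)
  fix l assume "(0 :: 'a list \<Rightarrow> int poly) l \<noteq> 0"
  then show "set l \<in> P \<and> length l = L" unfolding zero_fun_apply by (rule notE) (rule refl)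
qed (rule alternating_0)

lemma chain_add:
  assumes "chain L c" "chain L d"
  shows "chain L (c + d)"
proof (rule chainI)
  show "alternating (c + d)"
    by (rule alternating_add[OF chain_alternating[OF assms(1)] chain_alternating[OF assms(2)]])
  fix l assume "(c + d) l \<noteq> 0"
  then have "c l \<noteq> 0 \<or> d l \<noteq> 0" by auto
  then show "set l \<in> P \<and> length l = L"
    by (rule disjE) (rule chain_support[OF assms(1)], assumption, rule chain_support[OF assms(2)])
qed

lemma chain_uminus:
  assumes "chain L c"
  shows "chain L (- c)"
proof (rule chainI)
  show "alternating (- c)" by (rule alternating_uminus[OF chain_alternating[OF assms]])
  fix l assume "(- c) l \<noteq> 0"
  then have "c l \<noteq> 0" by simp
  then show "set l \<in> P \<and> length l = L" by (rule chain_support[OF assms])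
qed

lemma chain_diff:
  assumes "chain L c" "chain L d"
  shows "chain L (c - d)"
proof -
  have "c - d = c + - d" by (rule diff_conv_add_uminus)
  then show ?thesis using chain_add[OF assms(1) chain_uminus[OF assms(2)]] by (simp only:)
qed

lemma chain_scale:
  assumes "chain L c"
  shows "chain L (app (scale (\<lambda>l. w (set l))) c)"
proof (rule chainI)
  show "alternating (app (scale (\<lambda>l. w (set l))) c)"
  proof (rule alternatingI)
    fix u v :: "'a list" and a b
    have "set (u @ a # b # v) = set (u @ b # a # v)" by auto
    then show "app (scale (\<lambda>l. w (set l))) c (u @ a # b # v) =
      - app (scale (\<lambda>l. w (set l))) c (u @ b # a # v)"
      using alternatingD[OF chain_alternating[OF assms], of u a b v]
      by (simp only: app_scale times_fun_apply mult_minus_right)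
  qed
  fix l assume "app (scale (\<lambda>l. w (set l))) c l \<noteq> 0"
  then have "c l \<noteq> 0" by auto
  then show "set l \<in> P \<and> length l = L" by (rule chain_support[OF assms])
qed

lemma chain_shift:
  assumes "chain L c" "\<And>S. g ` S \<in> P \<Longrightarrow> S \<in> P"
  shows "chain L (app (shift (map g)) c)"
proof (rule chainI)
  show "alternating (app (shift (map g)) c)"
    unfolding app_shift by (rule alternating_map[OF chain_alternating[OF assms(1)]])
  fix l assume "app (shift (map g)) c l \<noteq> 0"
  then have "c (map g l) \<noteq> 0" by simp
  from chain_support[OF assms(1) this] show "set l \<in> P \<and> length l = L"
    using assms(2)[of "set l"] by simp
qed

lemma chain_distinct: "chain L c \<Longrightarrow> c l \<noteq> 0 \<Longrightarrow> distinct l"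
  by (rule alternating_distinct[OF chain_alternating])

lemma chain_boundary:
  assumes "chain (Suc L) c"
  shows "chain L (app boundary c)"
proof (rule chainI)
  have alt: "alternating c" by (rule chain_alternating[OF assms])
  show "alternating (app boundary c)"
  proof (rule alternatingI)
    fix u v :: "'a list" and a b
    have "(\<Sum>x\<in>A. c (x # u @ a # b # v)) = (\<Sum>x\<in>A. - c (x # u @ b # a # v))"
      using alternatingD[OF alt, of "x # u" a b v for x, unfolded append_Cons] by (intro sum.cong refl)
    then show "app boundary c (u @ a # b # v) = - app boundary c (u @ b # a # v)"
      by (simp add: app_boundary insert_commute sum_negf)
  qed
  fix l assume "app boundary c l \<noteq> 0"
  then have "set l \<in> P" "(\<Sum>a\<in>A. c (a # l)) \<noteq> 0"
    unfolding app_boundary by (simp_all split: if_splits)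
  moreover from this(2) obtain a where "c (a # l) \<noteq> 0" by (rule sum.not_neutral_contains_not_neutral)
  ultimately show "set l \<in> P \<and> length l = L" using chain_support[OF assms, of "a # l"] by simp
qed

text \<open>The double sum over the two added vertices is antisymmetric in them.\<close>

lemma boundary_boundary:
  assumes "chain L c"
  shows "app boundary (app boundary c) = 0"
proof (rule ext)
  fix l
  have alt: "alternating c" by (rule chain_alternating[OF assms])
  show "app boundary (app boundary c) l = 0 l"
  proof (cases "set l \<in> P")
    case True
    let ?s = "\<Sum>a\<in>A. \<Sum>b\<in>A. c (b # a # l)"
    have "app boundary c (a # l) = (\<Sum>b\<in>A. c (b # a # l))" for a
    proof (cases "set (a # l) \<in> P")
      \<comment> \<open>Discarding this face loses nothing: if \<open>l\<close> and
        \<open>b # a # l\<close> gave members of \<open>P\<close>, convexity would put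
        \<open>a # l\<close> between them.\<close>
      case False
      have "c (b # a # l) = 0" for b
      proof (rule ccontr)
        assume "c (b # a # l) \<noteq> 0"
        from chain_support[OF assms this] have "set (b # a # l) \<in> P" by simp
        then have "set (a # l) \<in> P" by (rule P_convex[OF True]) auto
        then show False using False by simp
      qed
      then show ?thesis using False by (simp add: app_boundary)
    qed (simp add: app_boundary)
    then have "app boundary (app boundary c) l = ?s" using True by (simp add: app_boundary)
    also have "?s = - ?s"
    proof -
      have "?s = (\<Sum>a\<in>A. \<Sum>b\<in>A. - c (a # b # l))"
        using alternatingD[OF alt, of "[]", unfolded append_Nil] by (intro sum.cong refl)
      also have "\<dots> = - (\<Sum>a\<in>A. \<Sum>b\<in>A. c (a # b # l))" by (simp add: sum_negf)
      also have "(\<Sum>a\<in>A. \<Sum>b\<in>A. c (a # b # l)) = ?s" by (rule sum.swap)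
      finally show ?thesis .
    qed
    then have "?s = 0" by (rule eq_uminus_imp_0)
    finally show ?thesis by simp
  qed (simp add: app_boundary)
qed

lemma boundary_shift:
  assumes "bij_betw g A A" "\<And>S. g ` S \<in> P \<longleftrightarrow> S \<in> P"
  shows "boundary * shift (map g) = shift (map g) * boundary"
proof (rule endo_eqI, rule ext)
  fix c :: "'a list \<Rightarrow> int poly" and l
  have "(\<Sum>a\<in>A. c (g a # map g l)) = (\<Sum>a\<in>A. c (a # map g l))"
    using sum.reindex_bij_betw[OF assms(1), of "\<lambda>a. c (a # map g l)"] .
  then show "app (boundary * shift (map g)) c l = app (shift (map g) * boundary) c l"
    using assms(2)[of "set l"] by (simp add: app_boundary)
qed

lemma boundary_scale_const: "boundary * scale (\<lambda>_. r) = scale (\<lambda>_. r) * boundary"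
proof (rule endo_eqI, rule ext)
  fix c :: "'a list \<Rightarrow> int poly" and l
  show "app (boundary * scale (\<lambda>_. r)) c l = app (scale (\<lambda>_. r) * boundary) c l"
    by (simp add: app_boundary sum_distrib_left)
qed

end

section \<open>Subcomplexes of a product of simplices\<close>

text \<open>
  A cell \<open>\<nu>\<close> of a product of simplices is encoded by the set of all pairs
  \<open>(i, v)\<close> with \<open>v \<in> \<nu> i\<close>; such a set meets every \<open>{i}
  \<times> W\<close>. Counting elements shifts the dimension by \<open>card I\<close>.
\<close>

locale grid =
  fixes I :: "'i::linorder set" and W :: "'v set" and P :: "('i \<times> 'v) set set"
    and \<gamma> :: "nat \<Rightarrow> 'i \<Rightarrow> 'i" and p k :: nat
  assumes finite_I: "finite I" and finite_W: "finite W"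
    and P_grid: "\<And>S. S \<in> P \<Longrightarrow> S \<subseteq> I \<times> W"
    and hits: "\<And>S. S \<in> P \<Longrightarrow> I \<subseteq> fst ` S"
    and faces: "\<And>S T. S \<in> P \<Longrightarrow> T \<subseteq> S \<Longrightarrow>
      I \<subseteq> fst ` T \<Longrightarrow> T \<in> P"
    and prime_p: "prime p"
    and \<gamma>_bij: "\<And>j. j < k \<Longrightarrow> bij_betw (\<gamma> j) I I"
    and \<gamma>_commute: "\<And>i j x. i < k \<Longrightarrow> j < k \<Longrightarrow>
      \<gamma> i (\<gamma> j x) = \<gamma> j (\<gamma> i x)"
    and \<gamma>_order: "\<And>j x. j < k \<Longrightarrow> (\<gamma> j ^^ p) x = x"
    and P_invariant: "\<And>j S. j < k \<Longrightarrow>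
      map_prod (\<gamma> j) id ` S \<in> P \<longleftrightarrow> S \<in> P"
begin

abbreviation G :: "nat \<Rightarrow> 'i \<times> 'v \<Rightarrow> 'i \<times> 'v" where
  "G j \<equiv> map_prod (\<gamma> j) id"

sublocale relative_complex "I \<times> W" P
proof
  show "finite (I \<times> W)" by (intro finite_cartesian_product finite_I finite_W)
  show "S \<subseteq> I \<times> W" if "S \<in> P" for S by (rule P_grid[OF that])
  show "T \<in> P" if "S \<in> P" "R \<in> P" "S \<subseteq> T" "T \<subseteq> R" for S T R
  proof (rule faces[OF that(2,4)])
    show "I \<subseteq> fst ` T" using hits[OF that(1)] image_mono[OF that(3), of fst] by (rule order_trans)
  qed
qed

lemma G_order: "j < k \<Longrightarrow> (G j ^^ p) x = x"
proof -
  assume j: "j < k"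
  have "(G j ^^ n) x = ((\<gamma> j ^^ n) (fst x), snd x)" for n
    by (induction n) (auto simp: map_prod_def split: prod.splits)
  then show ?thesis using \<gamma>_order[OF j] by simp
qed

sublocale lists: commuting_maps p k "\<lambda>j. map (G j)"
proof
  show "prime p" by (rule prime_p)
  show "map (G i) (map (G j) l) = map (G j) (map (G i) l)" if "i < k" "j < k" for i j l
    using \<gamma>_commute[OF that] by auto
  show "(map (G j) ^^ p) l = l" if "j < k" for j l
  proof -
    have "(map (G j) ^^ n) l = map (G j ^^ n) l" for n
      by (induction n) (auto simp: comp_def)
    then show ?thesis using G_order[OF that] by (simp add: map_idI)
  qed
qed

text \<open>Stabilizers and coordinates are taken for cells and not for their orderings: a group
  element can fix a cell and move its orderings, and multiplication by a coordinate preserves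
  alternation when it depends only on the underlying set.\<close>

sublocale sets: commuting_maps p k "\<lambda>j S. G j ` S"
proof
  show "prime p" by (rule prime_p)
  show "G i ` G j ` S = G j ` G i ` S" if "i < k" "j < k" for i j S
    unfolding image_image using \<gamma>_commute[OF that] by (intro image_cong) auto
  show "((\<lambda>S. G j ` S) ^^ p) S = S" if "j < k" for j S
  proof -
    have "((\<lambda>S. G j ` S) ^^ n) S = (G j ^^ n) ` S" for n
      by (induction n) (auto simp: image_comp comp_def)
    then show ?thesis using G_order[OF that] by simp
  qed
qed

lemma G_bij: "j < k \<Longrightarrow> bij_betw (G j) (I \<times> W) (I \<times> W)"
  using \<gamma>_bij[of j] by (intro bij_betw_map_prod) auto

abbreviation "t \<equiv> lists.t"

lemma chain_\<tau>: "j < k \<Longrightarrow> chain L c \<Longrightarrow> chain L (app (lists.\<tau> j) c)"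
  unfolding lists.\<tau>_def app_times
  by (intro chain_scale chain_shift) (simp_all only: P_invariant)

lemma chain_sum: "(\<And>i. i \<in> B \<Longrightarrow> chain L (f i)) \<Longrightarrow> chain L (sum f B)"
  by (induction B rule: infinite_finite_induct) (simp_all only: sum.infinite sum.empty sum.insert chain_0 chain_add
    insert_iff simp_thms)

lemma chain_t:
  assumes "chain L c"
  shows "chain L (app t c)"
  unfolding lists.t_def app_minus app_sum
  by (intro chain_diff chain_sum chain_\<tau> chain_scale assms) simp

lemma chain_t_power: "chain L c \<Longrightarrow> chain L (app (t ^ n) c)"
  by (induction n) (simp_all only: power_0 power_Suc app_one app_times chain_t)

lemma boundary_t: "boundary * t = t * boundary"
proof -
  have "boundary * lists.\<tau> j = lists.\<tau> j * boundary" if "j < k" for j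
  proof -
    have "boundary * lists.\<tau> j = (boundary * scale (\<lambda>_. X_pow j)) * shift (map (G j))"
      by (simp only: lists.\<tau>_def mult.assoc)
    also have "\<dots> = scale (\<lambda>_. X_pow j) * (boundary * shift (map (G j)))"
      by (simp only: boundary_scale_const mult.assoc)
    also have "boundary * shift (map (G j)) = shift (map (G j)) * boundary"
      by (rule boundary_shift[OF G_bij[OF that] P_invariant[OF that]])
    finally show ?thesis by (simp only: lists.\<tau>_def mult.assoc)
  qed
  then show ?thesis
    unfolding lists.t_def left_diff_distrib right_diff_distrib sum_distrib_left sum_distrib_right
      boundary_scale_const by (intro arg_cong2[of _ _ _ _ minus] sum.cong) auto
qed

lemma boundary_t_power: "boundary * t ^ n = t ^ n * boundary"
  using power_commuting_commutes[OF boundary_t[symmetric], of n] by (rule sym)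

subsection \<open>Augmentation\<close>

definition vertex_lists :: "'i list \<Rightarrow> ('i \<times> 'v) list set" where
  "vertex_lists u = {l. set l \<subseteq> I \<times> W \<and> map fst l = u}"

text \<open>A vertex of the product is itself a simplex, with one element over each index. Its
  orderings carry different signs, so just one of them is counted, the one along the sorted
  indices.\<close>

definition aug :: "(('i \<times> 'v) list \<Rightarrow> int poly) \<Rightarrow> int poly" where
  "aug c = (\<Sum>l\<in>vertex_lists (sorted_list_of_set I). c l)"

lemma aug_add: "aug (c + d) = aug c + aug d"
  by (simp add: aug_def sum.distrib)

lemma aug_diff: "aug (c - d) = aug c - aug d"
  by (simp add: aug_def sum_subtractf)

lemma aug_sum: "aug (sum f B) = (\<Sum>i\<in>B. aug (f i))"
  unfolding aug_def sum_fun_apply by (rule sum.swap)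

lemma aug_scale_const: "aug (app (scale (\<lambda>_. r)) c) = r * aug c"
  by (simp add: aug_def sum_distrib_left)

lemma aug_congruent: "congruent_mod p c d \<Longrightarrow> congruent_mod p (aug c) (aug d)"
  unfolding aug_def congruent_mod_fun_iff by (rule congruent_mod_sum) (erule spec)

lemma vertex_list_eq:
  assumes "l \<in> vertex_lists u" "distinct u"
  shows "map (\<lambda>i. (i, the (map_of l i))) u = l"
proof -
  have "distinct (map fst l)" and u: "u = map fst l" using assms by (auto simp: vertex_lists_def)
  then have "map (\<lambda>i. (i, the (map_of l i))) (map fst l) = map (\<lambda>x. x) l"
    unfolding map_map by (intro map_cong refl) (auto simp: comp_def)
  then show ?thesis using u by simp
qed

lemma map_of_map_key: "i \<in> set u \<Longrightarrow> map_of (map (\<lambda>i. (i, h i)) u) i = Some (h i)"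
  by (induction u) auto

text \<open>Relisting a vertex along \<open>u'\<close> instead of \<open>u\<close> permutes its
  entries as it permutes the indices, so all vertices acquire the same sign.\<close>

lemma aug_reorder:
  fixes c :: "('i \<times> 'v) list \<Rightarrow> int poly"
  assumes "alternating c" "distinct u" "distinct u'" "set u = set u'"
  shows "of_int (list_sign (<) u) * (\<Sum>l\<in>vertex_lists u. c l)
       = of_int (list_sign (<) u') * (\<Sum>l\<in>vertex_lists u'. c l)"
proof -
  have *: "map (\<lambda>i. (i, the (map_of l i))) u' \<in> vertex_lists u' \<and>
     map (\<lambda>i. (i, the (map_of (map (\<lambda>i. (i, the (map_of l i))) u') i))) u = l"
    if l: "l \<in> vertex_lists u" and u: "distinct u" "distinct u'" "set u = set u'" for l u u'
  proof
    have mem: "(i, the (map_of l i)) \<in> I \<times> W" if "i \<in> set u'" for i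
    proof -
      have "(i, the (map_of l i)) \<in> set (map (\<lambda>i. (i, the (map_of l i))) u)"
        using that unfolding set_map u(3) by (rule imageI)
      then have "(i, the (map_of l i)) \<in> set l" unfolding vertex_list_eq[OF l u(1)] .
      moreover have "set l \<subseteq> I \<times> W" using l unfolding vertex_lists_def by blast
      ultimately show ?thesis by (rule rev_subsetD)
    qed
    show "map (\<lambda>i. (i, the (map_of l i))) u' \<in> vertex_lists u'"
      unfolding vertex_lists_def
    proof (intro CollectI conjI subsetI)
      show "map fst (map (\<lambda>i. (i, the (map_of l i))) u') = u'" by (simp add: comp_def)
      fix x assume "x \<in> set (map (\<lambda>i. (i, the (map_of l i))) u')"
      then obtain i where "i \<in> set u'" "x = (i, the (map_of l i))" unfolding set_map by (elim imageE)
      then show "x \<in> I \<times> W" using mem by (simp only:)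
    qed
    have "map (\<lambda>i. (i, the (map_of (map (\<lambda>i. (i, the (map_of l i))) u') i))) u =
        map (\<lambda>i. (i, the (map_of l i))) u"
      by (rule map_cong[OF refl]) (simp only: u(3) map_of_map_key option.sel)
    also have "\<dots> = l" by (rule vertex_list_eq[OF l u(1)])
    finally show "map (\<lambda>i. (i, the (map_of (map (\<lambda>i. (i, the (map_of l i))) u') i))) u = l" .
  qed
  show ?thesis
    unfolding sum_distrib_left
  proof (rule sum.reindex_bij_witness[of _
      "\<lambda>l. map (\<lambda>i. (i, the (map_of l i))) u"
      "\<lambda>l. map (\<lambda>i. (i, the (map_of l i))) u'"])
    fix l assume l: "l \<in> vertex_lists u"
    from *[OF l assms(2,3,4)]
    show "map (\<lambda>i. (i, the (map_of (map (\<lambda>i. (i, the (map_of l i))) u') i))) u = l"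
      "map (\<lambda>i. (i, the (map_of l i))) u' \<in> vertex_lists u'" by (simp_all only: simp_thms)
    have "mset (map (\<lambda>i. (i, the (map_of l i))) u') = mset (map (\<lambda>i. (i, the (map_of l i))) u)"
    proof -
      have "mset u' = mset u" using set_eq_iff_mset_eq_distinct[OF assms(3,2)] assms(4) by simp
      then show ?thesis unfolding mset_map by (rule arg_cong)
    qed
    then have m: "mset (map (\<lambda>i. (i, the (map_of l i))) u') = mset l"
      unfolding vertex_list_eq[OF l assms(2)] .
    have "alternating (list_sign ((<) :: 'i \<Rightarrow> 'i \<Rightarrow> bool))"
      by (rule alternating_list_sign) auto
    then have "alternating (list_sign ((<) :: 'i \<Rightarrow> 'i \<Rightarrow> bool) \<circ> map fst)"
      by (rule alternating_map)
    from alternating_ratio[OF assms(1) this m]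
    show "of_int (list_sign (<) u') * c (map (\<lambda>i. (i, the (map_of l i))) u') = of_int (list_sign (<) u) * c l"
      using l unfolding vertex_lists_def by (simp add: comp_def)
  next
    fix l assume l: "l \<in> vertex_lists u'"
    from *[OF l assms(3,2) assms(4)[symmetric]]
    show "map (\<lambda>i. (i, the (map_of (map (\<lambda>i. (i, the (map_of l i))) u) i))) u' = l"
      "map (\<lambda>i. (i, the (map_of l i))) u \<in> vertex_lists u" by (simp_all only: simp_thms)
  qed
qed

text \<open>
  A permutation whose order is a power of \<open>p\<close> has sign \<open>1\<close> modulo
  \<open>p\<close>: it is even unless \<open>p = 2\<close>.
\<close>

lemma aug_shift:
  fixes c :: "('i \<times> 'v) list \<Rightarrow> int poly"
  assumes "alternating c" and j: "j < k"
  shows "congruent_mod p (aug (c \<circ> map (G j))) (aug c)"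
proof -
  define u where "u = sorted_list_of_set I"
  define s where "s l = list_sign (<) l" for l :: "'i list"
  have u: "distinct u" "set u = I" using finite_I by (auto simp: u_def)
  have inj: "inj_on (\<gamma> j) I" and img: "\<gamma> j ` I = I" using \<gamma>_bij[OF j]
    by (auto simp: bij_betw_def)
  have alt: "alternating s" unfolding s_def by (rule alternating_list_sign) auto
  \<comment> \<open>The sign of \<open>\<gamma> j\<close> as a permutation of
    \<open>I\<close>.\<close>
  define e where "e = s u * s (map (\<gamma> j) u)"
  have perm: "distinct (map (\<gamma> j) l)" "set (map (\<gamma> j) l) = I" if "distinct l" "set l = I" for l
    using that inj img by (auto simp: distinct_map)
  have step: "s (map (\<gamma> j) l) = e * s l" if l: "distinct l" "set l = I" for l
  proof -
    have "mset l = mset u" using set_eq_iff_mset_eq_distinct[OF l(1) u(1)] l(2) u(2) by simp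
    from alternating_ratio[OF alternating_map[OF alt, of "\<gamma> j"] alt this]
    have "s l * s (map (\<gamma> j) l) = s u * s (map (\<gamma> j) u)" by (simp add: comp_def)
    then have "s l * s l * s (map (\<gamma> j) l) = s l * e" by (simp add: e_def mult.assoc)
    then show ?thesis using list_sign_square[OF l(1)] by (simp add: s_def mult.commute)
  qed
  have iter: "s (map (\<gamma> j ^^ n) u) = e ^ n * s u \<and> distinct (map (\<gamma> j ^^ n) u) \<and>
    set (map (\<gamma> j ^^ n) u) = I" for n
  proof (induction n)
    case (Suc n)
    have "map (\<gamma> j ^^ Suc n) u = map (\<gamma> j) (map (\<gamma> j ^^ n) u)" by simp
    then show ?case using Suc step[of "map (\<gamma> j ^^ n) u"] perm[of "map (\<gamma> j ^^ n) u"]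
      by (simp add: comp_def)
  qed (use u in auto)
  have "map (\<gamma> j ^^ p) u = u" using \<gamma>_order[OF j] by (simp add: map_idI)
  with iter[of p] have "s u * s u = e ^ p * (s u * s u)" by simp
  then have ep: "e ^ p = 1" using list_sign_square[OF u(1)] by (simp add: s_def)
  have "e * e = (s u * s u) * (s (map (\<gamma> j) u) * s (map (\<gamma> j) u))" by (simp add: e_def)
  then have ee: "e * e = 1"
    using list_sign_square[OF u(1)] list_sign_square[OF perm(1)[OF u]] by (simp add: s_def)
  then have "e = 1 \<or> e = - 1" by (simp add: square_eq_1_iff)
  then have e: "congruent_mod p (of_int e :: int poly) 1"
  proof
    assume em: "e = - 1"
    then have "even p" using ep by (cases "even p") auto
    then have "p = 2" using prime_p primes_dvd_imp_eq two_is_prime_nat by blast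
    then have "of_int e = (1 :: int poly) + of_nat p * (- 1)" using em by simp
    then show ?thesis unfolding congruent_mod_def by blast
  qed simp
  have "(\<Sum>l\<in>vertex_lists u. c (map (G j) l)) = (\<Sum>l\<in>vertex_lists (map (\<gamma> j) u). c l)"
  proof (rule sum.reindex_bij_witness[of _ "map (G j) ^^ (p - 1)" "map (G j)"])
    have step: "map (G j) l \<in> vertex_lists (map (\<gamma> j) u)" if l: "l \<in> vertex_lists u" for l u
    proof -
      have "set (map (G j) l) \<subseteq> G j ` (I \<times> W)"
        unfolding set_map by (rule image_mono) (use l in \<open>simp add: vertex_lists_def\<close>)
      moreover have "G j ` (I \<times> W) = I \<times> W" using G_bij[OF j] unfolding bij_betw_def by (rule conjunct2)
      ultimately show ?thesis using l by (auto simp: vertex_lists_def comp_def)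
    qed
    have steps: "(map (G j) ^^ n) l \<in> vertex_lists (map (\<gamma> j ^^ n) u)"
      if l: "l \<in> vertex_lists u" for l u n
    proof (induction n)
      case (Suc n)
      from step[OF this] show ?case by (simp only: funpow.simps(2) map_map o_def)
    qed (use l in simp)
    fix l assume "l \<in> vertex_lists (map (\<gamma> j) u)"
    from steps[OF this, of "p - 1"] have "(map (G j) ^^ (p - 1)) l \<in> vertex_lists (map (\<gamma> j ^^ Suc (p - 1))
      u)"
      unfolding map_map funpow_Suc_right .
    moreover have "map (\<gamma> j ^^ Suc (p - 1)) u = u"
      using \<gamma>_order[OF j] prime_gt_0_nat[OF prime_p] by (intro map_idI) simp
    ultimately show "(map (G j) ^^ (p - 1)) l \<in> vertex_lists u" by (simp only:)
  next
    fix l assume l: "l \<in> vertex_lists u"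
    have "set (map (G j) l) \<subseteq> G j ` (I \<times> W)"
      unfolding set_map by (rule image_mono) (use l in \<open>simp add: vertex_lists_def\<close>)
    moreover have "G j ` (I \<times> W) = I \<times> W" using G_bij[OF j] unfolding bij_betw_def by (rule conjunct2)
    ultimately show "map (G j) l \<in> vertex_lists (map (\<gamma> j) u)"
      using l by (auto simp: vertex_lists_def comp_def)
  qed (simp_all only: lists.power_pred_inverse[OF j])
  then have 1: "aug (c \<circ> map (G j)) = (\<Sum>l\<in>vertex_lists (map (\<gamma> j) u). c l)"
    by (simp add: aug_def u_def)
  have "of_int (s u) * aug c = of_int (s (map (\<gamma> j) u)) * (\<Sum>l\<in>vertex_lists (map (\<gamma> j) u). c l)"
    unfolding s_def aug_def u_def[symmetric]
    by (rule aug_reorder[OF assms(1) u(1) perm(1)[OF u]]) (simp only: u(2) perm(2)[OF u])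
  also have "s (map (\<gamma> j) u) = e * s u" by (rule step[OF u])
  finally have "of_int (s u * s u) * aug c = of_int (s u * s u) * (of_int e * aug (c \<circ> map (G j)))"
    by (simp add: 1 algebra_simps)
  then have "aug c = of_int e * aug (c \<circ> map (G j))" using list_sign_square[OF u(1)] by (simp add: s_def)
  moreover have "congruent_mod p (of_int e * aug (c \<circ> map (G j))) (1 * aug (c \<circ> map (G j)))"
    by (rule congruent_mod_mult_right[OF e])
  ultimately show ?thesis by (simp add: congruent_mod_sym)
qed

lemma aug_t:
  assumes "chain L c"
  shows "congruent_mod p (aug (app t c)) 0"
proof -
  have alt: "alternating c" by (rule chain_alternating[OF assms])
  have "congruent_mod p (aug (app (lists.\<tau> j) c)) (X_pow j * aug c)" if "j < k" for j
    unfolding lists.\<tau>_def app_times aug_scale_const app_shift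
    by (rule congruent_mod_mult_left[OF aug_shift[OF alt that]])
  then have "congruent_mod p (\<Sum>j<k. aug (app (lists.\<tau> j) c)) (\<Sum>j<k. X_pow j * aug c)"
    by (intro congruent_mod_sum) simp
  moreover have "aug (app t c) = (\<Sum>j<k. aug (app (lists.\<tau> j) c)) - (\<Sum>j<k. X_pow j * aug c)"
    unfolding lists.t_def app_minus app_sum aug_diff aug_sum aug_scale_const sum_distrib_right ..
  ultimately show ?thesis using congruent_mod_diff_0_iff[THEN iffD2] by (simp only:)
qed

lemma aug_t_power:
  assumes "chain L c" "n \<ge> 1"
  shows "congruent_mod p (aug (app (t ^ n) c)) 0"
proof -
  obtain r where "n = Suc r" using assms(2) by (cases n) auto
  then have "app (t ^ n) c = app t (app (t ^ r) c)" by (simp only: power_Suc app_times)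
  then show ?thesis using aug_t[OF chain_t_power[OF assms(1)]] by (simp only:)
qed

text \<open>A vertex together with an extra element is an ordered pair of ends of an edge, and
  exchanging the ends reverses the sign.\<close>

lemma aug_boundary:
  assumes c: "chain L c"
  shows "aug (app boundary c) = 0"
proof -
  define u where "u = sorted_list_of_set I"
  have u: "distinct u" "set u = I" using finite_I by (auto simp: u_def)
  have alt: "alternating c" by (rule chain_alternating[OF c])
  define T where "T = vertex_lists u \<times> (I \<times> W)"
  have "app boundary c l = (\<Sum>a\<in>I \<times> W. c (a # l))" if l: "l \<in> vertex_lists u" for l
  proof (cases "set l \<in> P")
    case False
    have "c (a # l) = 0" for a
    proof (rule ccontr)
      assume "c (a # l) \<noteq> 0"
      from chain_support[OF c this] have "set (a # l) \<in> P" by (rule conjunct1)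
      then have "set l \<in> P"
      proof (rule faces)
        have "map fst l = u" using l by (simp add: vertex_lists_def)
        then have "fst ` set l = I" using u(2) by (metis set_map)
        then show "I \<subseteq> fst ` set l" by simp
      qed auto
      then show False using False by simp
    qed
    then show ?thesis using False by (simp add: app_boundary)
  qed (simp add: app_boundary)
  then have "aug (app boundary c) = (\<Sum>l\<in>vertex_lists u. \<Sum>a\<in>I \<times> W. c (a # l))"
    unfolding aug_def u_def by (intro sum.cong) auto
  also have "\<dots> = (\<Sum>(l, a)\<in>T. c (a # l))"
    unfolding T_def by (rule sum.cartesian_product)
  finally have aug: "aug (app boundary c) = (\<Sum>(l, a)\<in>T. c (a # l))" .
  \<comment> \<open>Puts the extra element in place of the entry over the same index and returns the
    displaced entry. Fixed points need no care: reindexing shows that the sum is its own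
    negative.\<close>
  define f where "f = (\<lambda>(l, a). (map (\<lambda>b. if fst b = fst a then a else b) l,
      (fst a, the (map_of l (fst a)))) :: ('i \<times> 'v) list \<times> ('i \<times> 'v))"
  have key: "f x \<in> T \<and> f (f x) = x \<and> c (snd (f x) # fst (f x)) = - c (snd x # fst x)"
    if xT: "x \<in> T" for x
  proof -
    obtain l i w where x: "x = (l, (i, w))" and l: "set l \<subseteq> I \<times> W" "map fst l =
      u" and iw: "i \<in> I" "w \<in> W"
      using xT by (cases x) (auto simp: T_def vertex_lists_def)
    have "i \<in> fst ` set l" using iw(1) u(2) l(2) by (metis set_map)
    then obtain v where v: "(i, v) \<in> set l" by auto
    then obtain l1 l2 where sp: "l = l1 @ (i, v) # l2" by (meson split_list)
    have d: "i \<notin> fst ` set l1" "i \<notin> fst ` set l2" using u(1) unfolding l(2)[symmetric] sp by auto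
    have id: "map (\<lambda>b. if fst b = i then (i, y) else b) l1 = l1" "map (\<lambda>b.
      if fst b = i then (i, y) else b) l2 = l2" for y
    proof -
      have "fst b \<noteq> i" if "b \<in> set l1 \<union> set l2" for b
      proof
        assume "fst b = i"
        then have "i \<in> fst ` (set l1 \<union> set l2)" using that by (rule image_eqI[OF sym])
        then show False using d unfolding image_Un by blast
      qed
      then show "map (\<lambda>b. if fst b = i then (i, y) else b) l1 = l1" "map (\<lambda>b.
        if fst b = i then (i, y) else b) l2 = l2"
        by (intro map_idI; simp)+
    qed
    have none: "map_of l1 i = None" using d by (simp add: map_of_eq_None_iff)
    have fx: "f x = (l1 @ (i, w) # l2, (i, v))"
      unfolding f_def x using none by (simp add: sp id map_of_append map_add_def)
    have ffx: "f (f x) = x"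
      unfolding fx f_def x using none by (simp add: sp id map_of_append map_add_def)
    have "f x \<in> T" unfolding fx T_def vertex_lists_def using l iw unfolding sp by auto
    moreover have "c (snd (f x) # fst (f x)) = - c (snd x # fst x)"
      using alternating_swap[OF alt, of "[]" "(i, v)" l1 "(i, w)" l2] unfolding fx unfolding x sp by simp
    ultimately show ?thesis using ffx by blast
  qed
  have "(\<Sum>x\<in>T. c (snd x # fst x)) = (\<Sum>x\<in>T. - c (snd x # fst x))"
  proof (rule sum.reindex_bij_witness[of _ f f])
    fix x assume "x \<in> T"
    note k = key[OF this]
    show "f (f x) = x" "f x \<in> T" "f (f x) = x" "f x \<in> T" using k by (simp_all only: simp_thms)
    from k show "- c (snd (f x) # fst (f x)) = c (snd x # fst x)" by simp
  qed
  also have "\<dots> = - (\<Sum>x\<in>T. c (snd x # fst x))" by (rule sum_negf)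
  finally have "(\<Sum>x\<in>T. c (snd x # fst x)) = - (\<Sum>x\<in>T. c (snd x # fst x))" .
  then have "(\<Sum>x\<in>T. c (snd x # fst x)) = 0" by (rule eq_uminus_imp_0)
  then show ?thesis unfolding aug by (simp add: case_prod_beta)
qed

end

section \<open>Periodic resolutions and their obstruction\<close>

context grid
begin

text \<open>The differentials of the periodic resolution of the trivial module over a polynomial
  ring truncated by \<open>t ^ p = 0\<close>.\<close>

definition D :: "nat \<Rightarrow> (('i \<times> 'v) list \<Rightarrow> int poly) endo" where
  "D i = (if even i then t else t ^ (p - 1))"

lemma chain_D: "chain L c \<Longrightarrow> chain L (app (D i) c)"
  unfolding D_def by (cases "even i") (simp_all only: if_True if_False chain_t chain_t_power)

lemma boundary_D: "boundary * D i = D i * boundary"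
  unfolding D_def by (cases "even i") (simp_all only: if_True if_False boundary_t boundary_t_power)

lemma D_D: "congruent_mod p (D (Suc i) * D i) 0"
proof -
  have "t ^ p = t * t ^ (p - 1)" "t ^ p = t ^ (p - 1) * t"
    using prime_gt_0_nat[OF prime_p] by (simp_all flip: power_Suc power_Suc2)
  then have "D (Suc i) * D i = t ^ p" by (cases "even i") (simp_all add: D_def)
  then show ?thesis using lists.t_power_p by simp
qed

lemma aug_D: "chain L c \<Longrightarrow> congruent_mod p (aug (app (D i) c)) 0"
proof (cases "even i")
  case False
  assume "chain L c"
  moreover have "p - 1 \<ge> 1" using prime_ge_2_nat[OF prime_p] by simp
  ultimately show ?thesis using aug_t_power False by (simp add: D_def)
qed (simp add: D_def aug_t)

lemma D_Suc_Suc: "D (Suc (Suc i)) = D i"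
  by (simp add: D_def)

text \<open>A chain map from the periodic resolution is given by the image \<open>\<phi> i\<close>
  of one generator in each degree; augmentation 1 says that it lifts the identity.\<close>

definition resolution :: "nat \<Rightarrow> (nat \<Rightarrow> ('i \<times> 'v) list \<Rightarrow> int poly)
  \<Rightarrow> bool" where
  "resolution q \<phi> \<longleftrightarrow> (\<forall>i\<le>q. chain (card I + i) (\<phi> i)) \<and>
    congruent_mod p (aug (\<phi> 0)) 1 \<and>
     (\<forall>i<q. congruent_mod p (app boundary (\<phi> (Suc i))) (app (D i) (\<phi> i)))"

text \<open>
  In an acyclic complex, the minimal resolution over the truncated polynomial ring generated by
  \<open>t\<close> maps to the chains.
\<close>

lemma resolution_exists:
  assumes start: "chain (card I) c0" "congruent_mod p (aug c0) 1"
    and fill0: "\<And>c. 0 < q \<Longrightarrow> chain (card I) c \<Longrightarrow>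
      congruent_mod p (aug c) 0 \<Longrightarrow>
      \<exists>e. chain (Suc (card I)) e \<and> congruent_mod p (app boundary e) c"
    and fill: "\<And>i c. 0 < i \<Longrightarrow> i < q \<Longrightarrow> chain (card I + i) c \<Longrightarrow>
      congruent_mod p (app boundary c) 0 \<Longrightarrow>
      \<exists>e. chain (Suc (card I + i)) e \<and> congruent_mod p (app boundary e) c"
  shows "\<exists>\<phi>. resolution q \<phi>"
proof -
  have "r \<le> q \<Longrightarrow> \<exists>\<phi>. resolution r \<phi>" for r
  proof (induction r)
    case 0
    show ?case using start by (intro exI[of _ "\<lambda>_. c0"]) (simp add: resolution_def)
  next
    case (Suc r)
    then obtain \<phi> where \<phi>: "resolution r \<phi>" by auto
    let ?c = "app (D r) (\<phi> r)"
    have ch: "chain (card I + r) (\<phi> r)" using \<phi> by (simp add: resolution_def)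
    then have c: "chain (card I + r) ?c" by (rule chain_D)
    \<comment> \<open>In degree 0 the chain to be filled has augmentation 0 by \<open>aug_D\<close>;
      in higher degrees it is a cycle because consecutive differentials compose to 0 modulo
      \<open>p\<close>.\<close>
    have "\<exists>e. chain (Suc (card I + r)) e \<and> congruent_mod p (app boundary e) ?c"
    proof (cases r)
      case 0
      then show ?thesis using fill0[of ?c] c aug_D[OF ch, of r] Suc.prems by simp
    next
      case (Suc s)
      have "congruent_mod p (app boundary (\<phi> r)) (app (D s) (\<phi> s))"
        using \<phi> Suc by (simp add: resolution_def)
      from app_congruent[OF this, of "D r"]
      have "congruent_mod p (app (D r * boundary) (\<phi> r)) (app (D r * D s) (\<phi> s))"
        by (simp only: app_times)
      also have "congruent_mod p \<dots> (app 0 (\<phi> s))"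
        unfolding Suc by (rule app_congruent_operator[OF D_D])
      finally have "congruent_mod p (app boundary ?c) 0"
        unfolding boundary_D[symmetric] by (simp only: app_times app_zero)
      then show ?thesis using fill[of r ?c] c Suc \<open>Suc r \<le> q\<close> by simp
    qed
    then obtain e where e: "chain (Suc (card I + r)) e" "congruent_mod p (app boundary e) ?c" by blast
    have "resolution (Suc r) (\<phi>(Suc r := e))"
      using \<phi> e by (auto simp: resolution_def le_Suc_eq less_Suc_eq)
    then show ?case by blast
  qed
  then show ?thesis by blast
qed

lemma chain_scale_const: "chain L c \<Longrightarrow> chain L (app (scale (\<lambda>_. r)) c)"
  by (rule chain_scale[where w = "\<lambda>_. r"])

abbreviation "\<kappa> \<equiv> lists.\<kappa>"

abbreviation \<kappa>_op :: "(('i \<times> 'v) list \<Rightarrow> int poly) endo" where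
  "\<kappa>_op \<equiv> scale (\<lambda>_. \<kappa>)"

text \<open>
  No cell is fixed by the group, so the chains are free up to the scalar \<open>\<kappa>\<close>.
\<close>

lemma exact_D:
  assumes nonfixed: "\<And>S. S \<in> P \<Longrightarrow> \<exists>j<k. G j ` S \<noteq> S"
    and c: "chain L c" "congruent_mod p (app (D i) c) 0"
  shows "\<exists>h. chain L h \<and> congruent_mod p (app \<kappa>_op c) (app (D (Suc i)) h)"
proof -
  obtain \<alpha> \<rho> where \<alpha>: "\<And>S. \<exists>j<k. G j ` S \<noteq> S \<Longrightarrow>
    \<alpha> S \<in> sets.characters \<and>
     (\<forall>i<k. \<alpha> (G i ` S) = \<alpha> S \<and> [\<rho> (G i ` S) = \<rho> S + \<alpha> S i] (mod int p))"
    using sets.exists_coordinates by blast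
  interpret co: coordinate_maps p k "\<lambda>j. map (G j)" "{l. set l \<in> P}" "\<lambda>l. \<alpha> (set l)"
    "\<lambda>l. \<rho> (set l)"
  proof
    show "map (G i) l \<in> {l. set l \<in> P} \<longleftrightarrow> l \<in> {l. set l \<in> P}" if "i < k" for i l
      using P_invariant[OF that, of "set l"] by simp
    show "\<alpha> (set l) \<in> lists.characters" if "l \<in> {l. set l \<in> P}" for l
      using \<alpha>[OF nonfixed[of "set l"]] that by simp
    show "\<alpha> (set (map (G i) l)) = \<alpha> (set l)"
      "[\<rho> (set (map (G i) l)) = \<rho> (set l) + \<alpha> (set l) i] (mod int p)"
      if "i < k" "l \<in> {l. set l \<in> P}" for i l
      using \<alpha>[OF nonfixed[of "set l"]] that by simp_all
  qed
  have chain_w: "chain M (app (scale w) f)" if "\<And>l. w l = w' (set l)" "chain M f" for w w' M f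
  proof -
    have "w = (\<lambda>l. w' (set l))" using that(1) by (rule ext)
    then show ?thesis using chain_scale[OF that(2), of w'] by (simp only:)
  qed
  have chain_U: "chain M (app co.U f)" if "chain M f" for M f
    unfolding co.U_def app_sum app_times
  proof (rule chain_sum)
    fix j assume j: "j \<in> {..<k}"
    show "chain M (app (scale (co.slope j)) (app (lists.\<tau> j) f))"
      by (rule chain_w[where w' = "\<lambda>S. if S \<in> P then of_int (\<alpha> S j) else 0"])
        (use j in \<open>auto simp: co.slope_def intro: chain_\<tau> that\<close>)
  qed
  have chain_L: "chain M (app (scale co.height ^ n) f)" if "chain M f" for M f n
  proof (induction n)
    case (Suc n)
    show ?case unfolding power_Suc app_times
      by (rule chain_w[where w' = "\<lambda>S. if S \<in> P then of_int (\<rho> S) else 0", OF _ Suc])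
        (simp add: co.height_def)
  qed (use that in simp)
  have chain_K: "chain M (app co.K f)" if "chain M f" for M f
    unfolding co.K_def app_times
    by (rule chain_w[where w' = "\<lambda>S.
      if S \<in> P then \<Prod>\<beta>\<in>lists.characters - {\<alpha> S}. lists.char_norm \<beta> else 0"])
      (auto simp: co.cofactor_def intro: chain_U chain_L that)
  define g where "g i = t ^ (p - 1 - i) * co.K * t ^ i" for i
  \<comment> \<open>The trace of \<open>K\<close> is a scalar supported on cells, and so is the
    chain \<open>c\<close>.\<close>
  have eq: "app (scale (\<lambda>l. if l \<in> {l. set l \<in> P} then \<kappa> else 0)) c = app \<kappa>_op c"
  proof (rule ext)
    fix l
    show "app (scale (\<lambda>l. if l \<in> {l. set l \<in> P} then \<kappa> else 0)) c l = app \<kappa>_op c l"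
      using chain_support[OF c(1), of l] by (cases "c l = 0") auto
  qed
  have tr: "congruent_mod p (app \<kappa>_op c) (\<Sum>i<p. app (g i) c)"
    using app_congruent_operator[OF co.trace_K, of c]
    unfolding eq app_sum g_def[symmetric] by (rule congruent_mod_sym)
  have p0: "p > 0" by (rule prime_gt_0_nat[OF prime_p])
  show ?thesis
  proof (cases "even i")
    case True
    then have tc: "congruent_mod p (app t c) 0" using c(2) by (simp add: D_def)
    \<comment> \<open>Every term of the trace with \<open>j \<ge> 1\<close> begins by applying
      \<open>t\<close> to \<open>c\<close>; what remains is \<open>t ^ (p - 1)\<close> applied to
      \<open>K\<close> of \<open>c\<close>.\<close>
    have z: "congruent_mod p (app (g j) c) 0" if "j \<in> {1..<p}" for j
    proof -
      obtain r where "j = Suc r" using \<open>j \<in> {1..<p}\<close> by (cases j) auto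
      then have "g j = (t ^ (p - 1 - j) * co.K * t ^ r) * t"
        by (simp only: g_def power_Suc2 mult.assoc)
      then show ?thesis using app_congruent[OF tc, of "t ^ (p - 1 - j) * co.K * t ^ r"]
        by (simp only: app_times app_0)
    qed
    have "{..<p} = insert 0 {1..<p}" using p0 by auto
    then have "(\<Sum>i<p. app (g i) c) = app (g 0) c + (\<Sum>i\<in>{1..<p}. app (g i) c)"
      by (simp only: sum.insert finite_atLeastLessThan) simp
    moreover have "congruent_mod p (app (g 0) c + (\<Sum>i\<in>{1..<p}. app (g i) c)) (app (g 0) c + 0)"
      by (intro congruent_mod_add congruent_mod_refl congruent_mod_sum_0 z)
    ultimately have "congruent_mod p (app \<kappa>_op c) (app (g 0) c)"
      using congruent_mod_trans[OF tr] by (simp only: add_0_right)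
    moreover have "app (g 0) c = app (D (Suc i)) (app co.K c)"
      using True by (simp add: g_def D_def)
    ultimately show ?thesis using chain_K[OF c(1)] by (intro exI[of _ "app co.K c"]) (simp only: simp_thms)
  next
    case False
    then have tc: "congruent_mod p (app (t ^ (p - 1)) c) 0" using c(2) by (simp add: D_def)
    \<comment> \<open>Here the last term vanishes, and all others contain a factor \<open>t\<close>
      on the left, which is taken out to give \<open>h\<close>.\<close>
    have z: "congruent_mod p (app (g (p - 1)) c) 0"
      using app_congruent[OF tc, of "co.K"] by (simp add: g_def)
    define h where "h = (\<Sum>i\<in>{..<p - 1}. app (t ^ (p - 2 - i) * co.K * t ^ i) c)"
    have "app (g j) c = app t (app (t ^ (p - 2 - j) * co.K * t ^ j) c)" if "j < p - 1" for j
    proof -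
      have "p - 1 - j = Suc (p - 2 - j)" using that by simp
      then show ?thesis by (simp only: g_def power_Suc app_times mult.assoc)
    qed
    then have th: "(\<Sum>i\<in>{..<p - 1}. app (g i) c) = app t h"
      unfolding h_def app_sum_right by (intro sum.cong) (simp_all only: lessThan_iff)
    have "{..<p} = insert (p - 1) {..<p - 1}" using p0 by auto
    then have "(\<Sum>i<p. app (g i) c) = app (g (p - 1)) c + app t h"
      using th by (simp only: sum.insert finite_lessThan) simp
    moreover have "congruent_mod p (app (g (p - 1)) c + app t h) (0 + app t h)"
      by (intro congruent_mod_add congruent_mod_refl z)
    moreover have "D (Suc i) = t" using False by (simp add: D_def)
    ultimately have "congruent_mod p (app \<kappa>_op c) (app (D (Suc i)) h)"
      using congruent_mod_trans[OF tr] by (simp only: add_0_left)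
    moreover have "chain L h" unfolding h_def app_times
      by (intro chain_sum chain_t_power chain_K c(1))
    ultimately show ?thesis by blast
  qed
qed

text \<open>Invariant of the descent: \<open>\<psi> i\<close> times a power of
  \<open>\<kappa>\<close> is congruent to \<open>app (D (Suc i)) h + app boundary h'\<close>. At
  \<open>i = q\<close> both chains are 0, and every step down costs one factor
  \<open>\<kappa>\<close>.\<close>

lemma no_resolution:
  assumes nonfixed: "\<And>S. S \<in> P \<Longrightarrow> \<exists>j<k. G j ` S \<noteq> S"
    and res: "resolution q \<psi>" and top: "\<psi> q = 0"
  shows False
proof -
  have \<psi>: "chain (card I + i) (\<psi> i)" if "i \<le> q" for i
    using res that by (simp add: resolution_def)
  have \<kappa>_comm: "\<kappa>_op ^ r = scale (\<lambda>_. \<kappa> ^ r)" for r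
    unfolding scale_power[symmetric] by (rule arg_cong[of _ _ scale]) (auto simp: fun_eq_iff power_fun_apply)
  have \<kappa>_bd: "boundary * \<kappa>_op ^ r = \<kappa>_op ^ r * boundary" for r
    unfolding \<kappa>_comm by (rule boundary_scale_const)
  have tk: "t * \<kappa>_op ^ r = \<kappa>_op ^ r * t" for r
    unfolding \<kappa>_comm by (rule lists.t_scale_commute) auto
  have \<kappa>_D: "D i * \<kappa>_op ^ r = \<kappa>_op ^ r * D i" for r i
    unfolding D_def using tk[of r] power_commuting_commutes[OF tk[of r], of "p - 1"] by (cases "even i") auto
  have main: "\<exists>r h h'. chain (card I + (q - n)) h \<and> chain (Suc (card I + (q - n))) h' \<and>
      congruent_mod p (app (\<kappa>_op ^ r) (\<psi> (q - n))) (app (D (Suc (q - n))) h + app boundary h')"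
    if "n \<le> q" for n
    using that
  proof (induction n)
    case 0
    show ?case
      by (intro exI[of _ 0] conjI chain_0)
        (simp only: power_0 app_one diff_zero top app_0 add_0_right congruent_mod_refl)
  next
    case (Suc n)
    define i where "i = q - Suc n"
    have i: "q - n = Suc i" "i < q" using Suc.prems by (auto simp: i_def)
    from Suc.IH[OF Suc_leD[OF Suc.prems]] obtain r h h' where h: "chain (card I + Suc i) h" "chain (Suc (card I +
      Suc i)) h'"
      "congruent_mod p (app (\<kappa>_op ^ r) (\<psi> (Suc i))) (app (D i) h + app boundary h')"
      unfolding i(1) D_Suc_Suc by (elim exE conjE)
    \<comment> \<open>Applying the boundary to the invariant at \<open>Suc i\<close> removes
      \<open>h'\<close> and shows that \<open>D i\<close> has the same effect on the multiple of
      \<open>\<psi> i\<close> and on the boundary of \<open>h\<close>. So \<open>D i\<close> kills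
      \<open>c\<close>, and exactness makes \<open>\<kappa>\<close> times \<open>c\<close> an image
      of \<open>D (Suc i)\<close>; the new \<open>h'\<close> is \<open>\<kappa>\<close> times the
      old \<open>h\<close>.\<close>
    define c where "c = app (\<kappa>_op ^ r) (\<psi> i) - app boundary h"
    have chb: "chain (card I + i) (app boundary h)" using chain_boundary[of "card I + i" h] h(1) by simp
    have chc: "chain (card I + i) c" unfolding c_def \<kappa>_comm
      by (intro chain_diff chain_scale_const \<psi> chb) (use i in simp)
    have "congruent_mod p (app boundary (\<psi> (Suc i))) (app (D i) (\<psi> i))"
      using res i(2) by (simp add: resolution_def)
    from app_congruent[OF this, of "\<kappa>_op ^ r"]
    have "congruent_mod p (app (D i) (app (\<kappa>_op ^ r) (\<psi> i))) (app boundary (app (\<kappa>_op ^ r) (\<psi>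
      (Suc i))))"
      unfolding app_times[symmetric] \<kappa>_D \<kappa>_bd by (rule congruent_mod_sym)
    also have "congruent_mod p \<dots> (app boundary (app (D i) h + app boundary h'))"
      by (rule app_congruent[OF h(3)])
    also have "app boundary (app (D i) h + app boundary h') = app (D i) (app boundary h)"
    proof -
      have "app boundary (app (D i) h) = app (D i) (app boundary h)"
        by (simp only: app_times[symmetric] boundary_D)
      then show ?thesis by (simp only: app_add boundary_boundary[OF h(2)] add_0_right)
    qed
    finally have "congruent_mod p (app (D i) c) 0"
      unfolding c_def app_diff congruent_mod_diff_0_iff .
    from exact_D[OF nonfixed chc this] obtain g where g: "chain (card I + i) g"
      "congruent_mod p (app \<kappa>_op c) (app (D (Suc i)) g)" by blast
    have "congruent_mod p (app \<kappa>_op c + app boundary (app \<kappa>_op h)) (app (D (Suc i)) g +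
      app boundary (app \<kappa>_op h))"
      by (rule congruent_mod_add[OF g(2) congruent_mod_refl])
    moreover have "app \<kappa>_op c + app boundary (app \<kappa>_op h) = app (\<kappa>_op ^ Suc r) (\<psi> i)"
    proof -
      have "app boundary (app \<kappa>_op h) = app \<kappa>_op (app boundary h)"
        using \<kappa>_bd[of 1] unfolding power_one_right by (metis app_times)
      then show ?thesis by (simp only: c_def app_diff power_Suc app_times diff_add_cancel)
    qed
    moreover have "chain (Suc (card I + i)) (app \<kappa>_op h)" using h(1) chain_scale_const by simp
    ultimately show ?case unfolding i_def[symmetric] using g(1) by metis
  qed
  obtain r h h' where h: "chain (card I) h" "chain (Suc (card I)) h'"
    "congruent_mod p (app (\<kappa>_op ^ r) (\<psi> 0)) (app (D (Suc 0)) h + app boundary h')"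
    using main[of q] by auto
  \<comment> \<open>Both terms have augmentation 0 modulo \<open>p\<close> while
    \<open>\<psi> 0\<close> has augmentation 1, so \<open>\<kappa> ^ r\<close> would be divisible by
    \<open>p\<close>.\<close>
  have "congruent_mod p (aug (app (\<kappa>_op ^ r) (\<psi> 0))) (aug (app (D (Suc 0)) h) + aug (app boundary h'))"
    using aug_congruent[OF h(3)] unfolding aug_add .
  also have "congruent_mod p \<dots> (0 + 0)"
    unfolding aug_boundary[OF h(2)] by (intro congruent_mod_add congruent_mod_refl aug_D[OF h(1)])
  finally have "congruent_mod p (\<kappa> ^ r * aug (\<psi> 0)) 0" unfolding \<kappa>_comm aug_scale_const by simp
  moreover have "congruent_mod p (\<kappa> ^ r * aug (\<psi> 0)) (\<kappa> ^ r * 1)"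
    using res by (intro congruent_mod_mult_left) (simp add: resolution_def)
  ultimately have "congruent_mod p (\<kappa> ^ r) 0"
    using congruent_mod_trans[OF congruent_mod_sym] by simp
  then have "of_nat p dvd \<kappa> ^ r" by (simp add: congruent_mod_iff_dvd)
  then have "of_nat p dvd \<kappa>" by (rule prime_elem_dvd_power[OF lists.prime_elem_p])
  then show False using lists.\<kappa>_not_dvd by blast
qed

end

section \<open>Pushing chains forward along a colouring\<close>

locale grid_map = X: grid I W P \<gamma> p k + Y: grid I W' P' \<gamma> p k
  for I :: "'i::linorder set" and W :: "'v set" and P and W' :: "'w set" and P' and \<gamma> p k +
  fixes f :: "'v \<Rightarrow> 'w"
  assumes f: "\<And>v. v \<in> W \<Longrightarrow> f v \<in> W'" and cell: "\<And>S. S \<in> P \<Longrightarrow>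
    map_prod id f ` S \<in> P'"
begin

abbreviation F :: "'i \<times> 'v \<Rightarrow> 'i \<times> 'w" where "F \<equiv> map_prod id f"

definition fiber :: "('i \<times> 'w) list \<Rightarrow> ('i \<times> 'v) list set" where
  "fiber l' = {l. set l \<subseteq> I \<times> W \<and> map F l = l'}"

text \<open>Degenerate images need no separate rule: the result is alternating, hence 0 on lists
  with repeated entries.\<close>

definition push :: "(('i \<times> 'v) list \<Rightarrow> int poly) \<Rightarrow> ('i \<times> 'w) list \<Rightarrow>
  int poly" where
  "push c l' = (\<Sum>l\<in>fiber l'. c l)"

lemma push_sum: "push (sum h A) = (\<Sum>a\<in>A. push (h a))"
proof
  fix l'
  show "push (sum h A) l' = (\<Sum>a\<in>A. push (h a)) l'"
    unfolding push_def sum_fun_apply by (rule sum.swap)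
qed

lemma push_diff: "push (c - d) = push c - push d"
  by (rule ext) (simp add: push_def sum_subtractf)

lemma push_scale_const: "push (app (scale (\<lambda>_. r)) c) = app (scale (\<lambda>_. r)) (push c)"
  by (rule ext) (simp add: push_def sum_distrib_left)

lemma push_congruent: "congruent_mod p c d \<Longrightarrow> congruent_mod p (push c) (push d)"
  unfolding congruent_mod_fun_iff push_def by (intro allI congruent_mod_sum) (erule spec)

lemma push_shift:
  assumes j: "j < k"
  shows "push (app (shift (map (X.G j))) c) = app (shift (map (Y.G j))) (push c)"
proof
  fix l'
  have step: "map (X.G j) l \<in> fiber (map (Y.G j) l')" if "l \<in> fiber l'" for l l'
  proof -
    have "set l \<subseteq> I \<times> W" "map F l = l'" using that by (simp_all add: fiber_def)
    moreover have "set (map (X.G j) l) \<subseteq> X.G j ` (I \<times> W)"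
      unfolding set_map by (rule image_mono) fact
    moreover have "X.G j ` (I \<times> W) = I \<times> W" using X.G_bij[OF j] unfolding bij_betw_def
      by (rule conjunct2)
    ultimately show ?thesis by (auto simp: fiber_def)
  qed
  have steps: "(map (X.G j) ^^ n) l \<in> fiber ((map (Y.G j) ^^ n) l')" if "l \<in> fiber l'" for l l' n
  proof (induction n)
    case (Suc n)
    then show ?case unfolding funpow.simps comp_apply by (rule step)
  qed (use that in simp)
  have "(\<Sum>l\<in>fiber l'. c (map (X.G j) l)) = (\<Sum>l\<in>fiber (map (Y.G j) l'). c l)"
  proof (rule sum.reindex_bij_witness[of _ "map (X.G j) ^^ (p - 1)" "map (X.G j)"])
    fix l assume "l \<in> fiber (map (Y.G j) l')"
    from steps[OF this, of "p - 1"] show "(map (X.G j) ^^ (p - 1)) l \<in> fiber l'"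
      unfolding Y.lists.power_pred_inverse(1)[OF j] .
  qed (simp_all only: X.lists.power_pred_inverse[OF j] step)
  then show "push (app (shift (map (X.G j))) c) l' = app (shift (map (Y.G j))) (push c) l'"
    by (simp add: push_def)
qed

lemma push_t: "push (app X.t c) = app Y.t (push c)"
  unfolding X.lists.t_def Y.lists.t_def X.lists.\<tau>_def Y.lists.\<tau>_def app_minus app_sum app_times
    push_diff push_sum push_scale_const
  by (intro arg_cong2[of _ _ _ _ minus] sum.cong refl) (simp only: push_shift lessThan_iff)

lemma push_t_power: "push (app (X.t ^ n) c) = app (Y.t ^ n) (push c)"
  by (induction n) (simp_all only: power_0 power_Suc app_one app_times push_t)

lemma push_D: "push (app (X.D i) c) = app (Y.D i) (push c)"
  unfolding X.D_def Y.D_def by (cases "even i") (simp_all only: if_True if_False push_t push_t_power)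

lemma chain_push:
  assumes c: "X.chain L c"
  shows "Y.chain L (push c)"
proof (rule Y.chainI)
  have alt: "alternating c" by (rule X.chain_alternating[OF c])
  show "alternating (push c)"
  proof (rule alternatingI)
    fix u v :: "('i \<times> 'w) list" and a b
    define sw where "sw l = take (length u) l @ l ! Suc (length u) # l ! length u # drop (Suc (Suc (length u))) l"
      for l :: "('i \<times> 'v) list"
    have sw: "sw l \<in> fiber (u @ b # a # v) \<and> sw (sw l) = l \<and> c (sw l) = - c l"
      if "l \<in> fiber (u @ a # b # v)" for l a b
    proof -
      have l: "set l \<subseteq> I \<times> W" "map F l = u @ a # b # v" using that by (simp_all add: fiber_def)
      from l(2) obtain u0 w0 where w0: "l = u0 @ w0" "map F u0 = u" "map F w0 = a # b # v"
        by (auto simp: map_eq_append_conv)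
      then obtain a0 b0 v0 where w1: "w0 = a0 # b0 # v0" "F a0 = a" "F b0 = b" "map F v0 = v"
        by (auto simp: map_eq_Cons_conv)
      have len: "length u = length u0" using w0(2) by auto
      have s1: "sw l = u0 @ b0 # a0 # v0" unfolding sw_def w0 w1 len by (simp add: nth_append)
      moreover have "sw (u0 @ b0 # a0 # v0) = u0 @ a0 # b0 # v0"
        unfolding sw_def len by (simp add: nth_append)
      moreover have "u0 @ b0 # a0 # v0 \<in> fiber (u @ b # a # v)"
        using l(1) w0 w1 by (simp add: fiber_def)
      moreover have "c (u0 @ b0 # a0 # v0) = - c (u0 @ a0 # b0 # v0)" by (rule alternatingD[OF alt])
      ultimately show ?thesis unfolding s1 using w0 w1 by simp
    qed
    have "(\<Sum>l\<in>fiber (u @ a # b # v). c l) = (\<Sum>l\<in>fiber (u @ b # a # v). - c l)"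
      by (rule sum.reindex_bij_witness[of _ sw sw]) (simp_all only: sw minus_minus)
    then show "push c (u @ a # b # v) = - push c (u @ b # a # v)"
      unfolding push_def sum_negf .
  qed
  fix l' assume "push c l' \<noteq> 0"
  then obtain l where l: "l \<in> fiber l'" "c l \<noteq> 0"
    unfolding push_def by (rule sum.not_neutral_contains_not_neutral)
  from X.chain_support[OF c l(2)] have "F ` set l \<in> P'" "length l = L" using cell by blast+
  moreover have "l' = map F l" using l(1) by (simp add: fiber_def)
  ultimately show "set l' \<in> P' \<and> length l' = L" by simp
qed

text \<open>Both sides sum \<open>c\<close> over the lists \<open>a # l\<close> with
  \<open>l\<close> in the fibre of \<open>l'\<close>; the point is that the truncations to
  \<open>P\<close> and to \<open>P'\<close> agree.\<close>

lemma boundary_push: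
  assumes c: "X.chain L c"
  shows "app Y.boundary (push c) = push (app X.boundary c)"
proof
  fix l'
  show "app Y.boundary (push c) l' = push (app X.boundary c) l'"
  proof (cases "set l' \<in> P'")
    case True
    define T where "T = {l. set l \<subseteq> I \<times> W \<and> l \<noteq> [] \<and> map F (tl l) = l'}"
    \<comment> \<open>A list over a cell of \<open>P'\<close> meets every index, so it is a cell of
      \<open>P\<close> whenever some \<open>a # l\<close> is.\<close>
    have bd: "app X.boundary c l = (\<Sum>a\<in>I \<times> W. c (a # l))" if l: "l \<in> fiber l'" for l
    proof (cases "set l \<in> P")
      case False
      have "c (a # l) = 0" for a
      proof (rule ccontr)
        assume "c (a # l) \<noteq> 0"
        from X.chain_support[OF c this] have "set (a # l) \<in> P" by (rule conjunct1)
        moreover have "I \<subseteq> fst ` set l"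
        proof -
          have "l' = map F l" using l by (simp add: fiber_def)
          then have "fst ` set l' = fst ` set l" by (simp only: set_map image_image fst_map_prod id_apply)
          then show ?thesis using Y.hits[OF True] by simp
        qed
        ultimately have "set l \<in> P" using X.faces[of "set (a # l)" "set l"] by auto
        then show False using False by simp
      qed
      then show ?thesis using False by (simp add: X.app_boundary)
    qed (simp add: X.app_boundary)
    have finT: "finite T"
    proof (rule finite_subset)
      show "T \<subseteq> {l. set l \<subseteq> I \<times> W \<and> length l = Suc (length l')}"
        unfolding T_def by (auto simp: neq_Nil_conv)
      show "finite {l. set l \<subseteq> I \<times> W \<and> length l = Suc (length l')}"
        by (rule finite_lists_length_eq[OF X.finite_A])
    qed
    have "app Y.boundary (push c) l' = (\<Sum>a\<in>I \<times> W'. push c (a # l'))"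
      using True by (simp add: Y.app_boundary)
    also have "\<dots> = (\<Sum>a\<in>I \<times> W'. \<Sum>l\<in>{l \<in> T. F (hd l) = a}. c l)"
      unfolding push_def
    proof (intro sum.cong refl)
      fix a
      show "fiber (a # l') = {l \<in> T. F (hd l) = a}"
      proof (intro equalityI subsetI)
        fix l assume "l \<in> fiber (a # l')"
        then show "l \<in> {l \<in> T. F (hd l) = a}" by (cases l) (simp_all add: fiber_def T_def)
      next
        fix l assume "l \<in> {l \<in> T. F (hd l) = a}"
        then show "l \<in> fiber (a # l')" by (cases l) (simp_all add: fiber_def T_def)
      qed
    qed
    also have "\<dots> = (\<Sum>l\<in>T. c l)"
    proof (rule sum.group[OF finT Y.finite_A])
      show "(\<lambda>l. F (hd l)) ` T \<subseteq> I \<times> W'"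
      proof (rule image_subsetI)
        fix l assume "l \<in> T"
        then obtain a l0 where "l = a # l0" "a \<in> I \<times> W" unfolding T_def by (cases l) auto
        then show "F (hd l) \<in> I \<times> W'" using f by (cases a) auto
      qed
    qed
    also have "\<dots> = (\<Sum>(l, a)\<in>fiber l' \<times> (I \<times> W). c (a # l))"
    proof (rule sum.reindex_bij_witness[of _ "\<lambda>(l, a). a # l" "\<lambda>l. (tl l, hd l)"])
      fix l assume "l \<in> T"
      then obtain a l0 where l: "l = a # l0" unfolding T_def by (cases l) auto
      then show "(case (tl l, hd l) of (l, a) \<Rightarrow> a # l) =
        l" "(tl l, hd l) \<in> fiber l' \<times> (I \<times> W)"
        "(case (tl l, hd l) of (l, a) \<Rightarrow> c (a # l)) = c l"
        using \<open>l \<in> T\<close> by (auto simp: T_def fiber_def)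
    next
      fix x assume "x \<in> fiber l' \<times> (I \<times> W)"
      then obtain l a where "x = (l, a)" "l \<in> fiber l'" "a \<in> I \<times> W" by blast
      then show "(tl (case x of (l, a) \<Rightarrow> a # l), hd (case x of (l, a) \<Rightarrow> a # l)) = x"
        "(case x of (l, a) \<Rightarrow> a # l) \<in> T"
        by (auto simp: T_def fiber_def)
    qed
    also have "\<dots> = (\<Sum>l\<in>fiber l'. \<Sum>a\<in>I \<times> W. c (a # l))"
      by (rule sum.cartesian_product[symmetric])
    also have "\<dots> = push (app X.boundary c) l'"
      unfolding push_def by (rule sum.cong[OF refl bd[symmetric]])
    finally show ?thesis .
  next
    case False
    have "app X.boundary c l = 0" if "l \<in> fiber l'" for l
    proof -
      have "l' = map F l" using that by (simp add: fiber_def)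
      then have "set l' = F ` set l" by (simp only: set_map)
      then have "set l \<notin> P" using cell False by metis
      then show ?thesis by (simp add: X.app_boundary)
    qed
    then show ?thesis using False by (simp add: Y.app_boundary push_def)
  qed
qed

lemma aug_push: "Y.aug (push c) = X.aug c"
proof -
  define u where "u = sorted_list_of_set I"
  have "Y.aug (push c) = (\<Sum>l'\<in>Y.vertex_lists u. \<Sum>l\<in>{l \<in> X.vertex_lists u. map F l = l'}. c l)"
    unfolding Y.aug_def u_def[symmetric] push_def
  proof (intro sum.cong refl)
    fix l' assume "l' \<in> Y.vertex_lists u"
    then show "fiber l' = {l \<in> X.vertex_lists u. map F l = l'}"
      by (auto simp: fiber_def X.vertex_lists_def Y.vertex_lists_def comp_def)
  qed
  also have "\<dots> = (\<Sum>l\<in>X.vertex_lists u. c l)"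
  proof (rule sum.group)
    have fin: "finite {l. set l \<subseteq> A \<and> map fst l = u}" if "finite A" for A :: "('i \<times> 'z) set"
    proof (rule finite_subset)
      show "{l. set l \<subseteq> A \<and> map fst l = u} \<subseteq> {l. set l \<subseteq> A \<and>
        length l = length u}" by auto
      show "finite {l. set l \<subseteq> A \<and> length l = length u}" by (rule finite_lists_length_eq[OF that])
    qed
    show "finite (X.vertex_lists u)" "finite (Y.vertex_lists u)"
      unfolding X.vertex_lists_def Y.vertex_lists_def by (rule fin[OF X.finite_A], rule fin[OF Y.finite_A])
    show "map F ` X.vertex_lists u \<subseteq> Y.vertex_lists u"
      using f by (fastforce simp: X.vertex_lists_def Y.vertex_lists_def comp_def)
  qed
  finally show ?thesis by (simp add: X.aug_def u_def)
qed

lemma resolution_push: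
  assumes "X.resolution q \<phi>"
  shows "Y.resolution q (\<lambda>i. push (\<phi> i))"
  unfolding Y.resolution_def
proof (intro conjI allI impI)
  have ch: "X.chain (card I + i) (\<phi> i)" if "i \<le> q" for i
    using assms that by (simp add: X.resolution_def)
  then show "Y.chain (card I + i) (push (\<phi> i))" if "i \<le> q" for i
    using chain_push that by blast
  show "congruent_mod p (Y.aug (push (\<phi> 0))) 1"
    using assms by (simp add: X.resolution_def aug_push)
  fix i assume i: "i < q"
  then have "congruent_mod p (app X.boundary (\<phi> (Suc i))) (app (X.D i) (\<phi> i))"
    using assms by (simp add: X.resolution_def)
  from push_congruent[OF this]
  show "congruent_mod p (app Y.boundary (push (\<phi> (Suc i)))) (app (Y.D i) (push (\<phi> i)))"
    using boundary_push[OF ch[of "Suc i"]] i by (simp add: push_D)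
qed

end

section \<open>From cohomology to homology\<close>

locale ordered_complex = relative_complex A P for A :: "'a set" and P +
  fixes lt :: "'a \<Rightarrow> 'a \<Rightarrow> bool"
  assumes lt: "\<And>a b. a \<noteq> b \<Longrightarrow> lt a b \<longleftrightarrow> \<not> lt b a"
begin

definition sign :: "'a \<Rightarrow> 'a set \<Rightarrow> int" where
  "sign a S = (- 1) ^ card {x \<in> S. lt x a}"

definition cells :: "nat \<Rightarrow> 'a set set" where
  "cells L = {S \<in> P. card S = L}"

text \<open>Polymorphic because it is used both for chains over Z[s] and for their coefficients over
  Z.\<close>

definition set_boundary :: "('a set \<Rightarrow> 'r::comm_ring_1) \<Rightarrow> 'a set \<Rightarrow> 'r" where
  "set_boundary z R = (\<Sum>a\<in>A.
    if a \<notin> R \<and> insert a R \<in> P then of_int (sign a R) * z (insert a R) else 0)"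

definition set_coboundary :: "('a set \<Rightarrow> int) \<Rightarrow> 'a set \<Rightarrow> int" where
  "set_coboundary f S = (\<Sum>a\<in>A.
    if a \<in> S \<and> S - {a} \<in> P then sign a (S - {a}) * f (S - {a}) else 0)"

text \<open>At most one summand is nonzero. The form of a sum lets rows and columns be evaluated
  alike by exchanging summations, so boundary and coboundary are transposes.\<close>

definition matrix :: "'a set \<Rightarrow> 'a set \<Rightarrow> int" where
  "matrix S R = (\<Sum>a\<in>A. if a \<notin> R \<and> S = insert a R then sign a R else 0)"

lemma finite_cell: "S \<in> P \<Longrightarrow> finite S"
  using P_subset finite_A by (rule finite_subset)

lemma finite_cells: "finite (cells L)"
proof (rule finite_subset)
  show "cells L \<subseteq> Pow A" using P_subset by (auto simp: cells_def)
  show "finite (Pow A)" using finite_A by simp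
qed

lemma coboundary_matrix:
  assumes S: "S \<in> cells (Suc L)"
  shows "(\<Sum>R\<in>cells L. matrix S R * f R) = set_coboundary f S"
proof -
  have "(\<Sum>R\<in>cells L. matrix S R * f R) =
      (\<Sum>a\<in>A. \<Sum>R\<in>cells L. (if a \<notin> R \<and> S = insert a R then sign a R else 0) * f R)"
    unfolding matrix_def sum_distrib_right by (rule sum.swap)
  also have "\<dots> = set_coboundary f S"
    unfolding set_coboundary_def
  proof (rule sum.cong[OF refl])
    fix a
    have eq: "(a \<notin> R \<and> S = insert a R) = (a \<in> S \<and> R = S - {a})" for R by auto
    have "(\<Sum>R\<in>cells L. (if a \<notin> R \<and> S = insert a R then sign a R else 0) * f R) =
        (\<Sum>R\<in>cells L. if R = S - {a} then (if a \<in> S then sign a R * f R else 0) else 0)"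
      unfolding eq by (rule sum.cong) auto
    also have "\<dots> = (if S - {a} \<in> cells L then (if a \<in> S then sign a (S - {a}) * f (S - {a}) else 0) else
      0)"
      using finite_cells by (simp add: sum.delta')
    also have "\<dots> = (if a \<in> S \<and> S - {a} \<in> P then sign a (S - {a}) * f (S - {a}) else 0)"
      using S finite_cell[of S] by (auto simp: cells_def)
    finally show "(\<Sum>R\<in>cells L. (if a \<notin> R \<and> S = insert a R then sign a R else 0) * f R) =
        (if a \<in> S \<and> S - {a} \<in> P then sign a (S - {a}) * f (S - {a}) else 0)" .
  qed
  finally show ?thesis .
qed

lemma boundary_matrix:
  assumes R: "R \<in> cells L"
  shows "(\<Sum>S\<in>cells (Suc L). z S * matrix S R) = set_boundary z R"
proof -
  have "(\<Sum>S\<in>cells (Suc L). z S * matrix S R) =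
      (\<Sum>a\<in>A. \<Sum>S\<in>cells (Suc L). z S * (if a \<notin> R \<and> S = insert a R then sign a R else 0))"
    unfolding matrix_def sum_distrib_left by (rule sum.swap)
  also have "\<dots> = set_boundary z R"
    unfolding set_boundary_def
  proof (rule sum.cong[OF refl])
    fix a
    have "(\<Sum>S\<in>cells (Suc L). z S * (if a \<notin> R \<and> S = insert a R then sign a R else 0)) =
        (\<Sum>S\<in>cells (Suc L). if S = insert a R then (if a \<notin> R then sign a R * z S else 0) else 0)"
      by (rule sum.cong) auto
    also have "\<dots> = (if insert a R \<in> cells (Suc L) then (if a \<notin> R then sign a R * z (insert a R) else
      0) else 0)"
      using finite_cells by (simp add: sum.delta')
    also have "\<dots> = (if a \<notin> R \<and> insert a R \<in> P then of_int (sign a R) * z (insert a R) else 0)"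
      using R finite_cell[of R] by (auto simp: cells_def)
    finally show "(\<Sum>S\<in>cells (Suc L). z S * (if a \<notin> R \<and> S = insert a R then sign a R else 0)) =
        (if a \<notin> R \<and> insert a R \<in> P then of_int (sign a R) * z (insert a R) else 0)" .
  qed
  finally show ?thesis .
qed

lemma boundary_coboundary_adjoint:
  "(\<Sum>S\<in>cells (Suc L). z S * set_coboundary g S) = (\<Sum>R\<in>cells L. set_boundary z R * g R)"
proof -
  have "(\<Sum>S\<in>cells (Suc L). z S * set_coboundary g S) =
      (\<Sum>S\<in>cells (Suc L). \<Sum>R\<in>cells L. z S * (matrix S R * g R))"
    by (simp only: coboundary_matrix[symmetric] sum_distrib_left cong: sum.cong)
  also have "\<dots> = (\<Sum>R\<in>cells L. \<Sum>S\<in>cells (Suc L). z S * matrix S R * g R)"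
    by (subst sum.swap) (simp only: mult.assoc)
  also have "\<dots> = (\<Sum>R\<in>cells L. set_boundary z R * g R)"
    by (simp only: boundary_matrix[symmetric] sum_distrib_right cong: sum.cong)
  finally show ?thesis .
qed

text \<open>Modulo \<open>p\<close> the image of the boundary matrix is the annihilator of the
  cocycles, by duality.\<close>

lemma fill_sets:
  assumes "prime p"
    and "\<And>f. (\<And>S. S \<in> cells (Suc L) \<Longrightarrow>
      [set_coboundary f S = 0] (mod int p)) \<Longrightarrow>
      [(\<Sum>S\<in>cells L. z S * f S) = 0] (mod int p)"
  shows "\<exists>e. \<forall>S\<in>cells L. [z S = set_boundary e S] (mod int p)"
proof -
  have "\<exists>e. \<forall>S\<in>cells L. [z S = (\<Sum>T\<in>cells (Suc L). e T * matrix T S)] (mod int p)"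
  proof (rule orthogonal_to_kernel_imp_combination[OF assms(1) finite_cells finite_cells])
    fix f assume "\<And>T. T \<in> cells (Suc L) \<Longrightarrow>
      [(\<Sum>S\<in>cells L. matrix T S * f S) = 0] (mod int p)"
    then show "[(\<Sum>S\<in>cells L. z S * f S) = 0] (mod int p)"
      by (intro assms(2)) (simp only: coboundary_matrix)
  qed
  then show ?thesis by (simp add: boundary_matrix)
qed

text \<open>The sign of the chosen ordering cancels the dependence on the choice, as
  \<open>chain_set_chain\<close> makes precise.\<close>

definition set_chain :: "('a list \<Rightarrow> int poly) \<Rightarrow> 'a set \<Rightarrow> int poly" where
  "set_chain c S = (let l = (SOME l. distinct l \<and> set l = S) in of_int (list_sign lt l) * c l)"

lemma chain_set_chain:
  assumes c: "chain L c" and l: "distinct l"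
  shows "c l = of_int (list_sign lt l) * set_chain c (set l)"
proof -
  define l' where "l' = (SOME l'. distinct l' \<and> set l' = set l)"
  have l': "distinct l' \<and> set l' = set l" unfolding l'_def by (rule someI[of _ l]) (use l in simp)
  then have m: "mset l = mset l'" using l set_eq_iff_mset_eq_distinct by blast
  have "set_chain c (set l) = of_int (list_sign lt l') * c l'"
    by (simp add: set_chain_def l'_def Let_def)
  also have "\<dots> = of_int (list_sign lt l) * c l"
    by (rule alternating_ratio[OF chain_alternating[OF c] alternating_list_sign[OF lt] m, symmetric])
  finally have "of_int (list_sign lt l) * set_chain c (set l) = of_int (list_sign lt l * list_sign lt l) * c l"
    by (simp add: mult.assoc)
  then show ?thesis using list_sign_square[OF l] by simp
qed

lemma list_sign_Cons:
  "distinct (a # l) \<Longrightarrow> list_sign lt (a # l) = sign a (set l) * list_sign lt l"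
  by (simp add: list_sign_def sign_def)

lemma boundary_set_chain:
  assumes c: "chain L c" and l: "distinct l" "set l \<in> P"
  shows "app boundary c l = of_int (list_sign lt l) * set_boundary (set_chain c) (set l)"
proof -
  have "app boundary c l = (\<Sum>a\<in>A. c (a # l))" using l by (simp add: app_boundary)
  also have "\<dots> = (\<Sum>a\<in>A. of_int (list_sign lt l) *
      (if a \<notin> set l \<and>
        insert a (set l) \<in> P then of_int (sign a (set l)) * set_chain c (insert a (set l)) else 0))"
  proof (rule sum.cong[OF refl])
    fix a
    show "c (a # l) = of_int (list_sign lt l) *
      (if a \<notin> set l \<and>
        insert a (set l) \<in> P then of_int (sign a (set l)) * set_chain c (insert a (set l)) else 0)"
    proof (cases "a \<notin> set l \<and> insert a (set l) \<in> P")
      case True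
      then have "distinct (a # l)" using l by simp
      from chain_set_chain[OF c this] list_sign_Cons[OF this] True show ?thesis
        by (simp add: mult.commute mult.left_commute)
    next
      case False
      have "c (a # l) = 0"
      proof (rule ccontr)
        assume nz: "c (a # l) \<noteq> 0"
        show False using chain_distinct[OF c nz] chain_support[OF c nz] False by simp
      qed
      then show ?thesis by (simp only: False if_False mult_zero_right)
    qed
  qed
  finally show ?thesis by (simp add: set_boundary_def sum_distrib_left)
qed

definition list_chain :: "nat \<Rightarrow> ('a set \<Rightarrow> int poly) \<Rightarrow> 'a list \<Rightarrow> int
  poly" where
  "list_chain L e l = (if set l \<in> P \<and> length l = L then of_int (list_sign lt l) * e (set l) else 0)"

lemma chain_list_chain: "chain L (list_chain L e)"
proof (rule chainI)
  show "alternating (list_chain L e)"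
  proof (rule alternatingI)
    fix u v :: "'a list" and a b
    have "set (u @ a # b # v) = set (u @ b # a # v)" "length (u @ a # b # v) = length (u @ b # a # v)" by auto
    moreover have "list_sign lt (u @ a # b # v) = - list_sign lt (u @ b # a # v)"
      by (rule alternatingD[OF alternating_list_sign[OF lt]])
    ultimately show "list_chain L e (u @ a # b # v) = - list_chain L e (u @ b # a # v)"
      unfolding list_chain_def by (simp only:) simp
  qed
  fix l assume "list_chain L e l \<noteq> 0"
  then show "set l \<in> P \<and> length l = L" unfolding list_chain_def by (auto split: if_splits)
qed

lemma set_chain_list_chain:
  assumes "S \<in> cells L"
  shows "set_chain (list_chain L e) S = e S"
proof -
  have S: "S \<in> P" "card S = L" "finite S" using assms finite_cell by (auto simp: cells_def)
  obtain l where l: "distinct l" "set l = S" using finite_distinct_list[OF S(3)] by blast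
  define l' where "l' = (SOME l'. distinct l' \<and> set l' = S)"
  have l': "distinct l' \<and> set l' = S" unfolding l'_def by (rule someI[of _ l]) (use l in simp)
  then have "length l' = L" using S(2) distinct_card by force
  then have "set_chain (list_chain L e) S = of_int (list_sign lt l' * list_sign lt l') * e S"
    using l' S(1) by (simp add: set_chain_def Let_def l'_def[symmetric] list_chain_def mult.assoc)
  then show ?thesis using list_sign_square[of l' lt] l' by simp
qed

lemma set_boundary_coeff:
  fixes e :: "'a set \<Rightarrow> int poly"
  shows "coeff (set_boundary e S) r = set_boundary (\<lambda>S. coeff (e S) r) S"
proof -
  have "coeff (of_int s * q) r = of_int s * coeff q r" for s :: int and q :: "int poly"
    by (simp add: of_int_poly)
  then show ?thesis
    unfolding set_boundary_def coeff_sum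
      by (intro sum.cong refl) (simp only: if_distrib[of "\<lambda>q. coeff q r"] coeff_0)
qed

lemma congruent_mod_poly_iff:
  "congruent_mod p (a :: int poly) b \<longleftrightarrow> (\<forall>r. [coeff a r = coeff b r] (mod int p))"
  by (simp add: congruent_mod_iff_dvd of_nat_poly const_poly_dvd_iff cong_iff_dvd_diff)

text \<open>
  Every coefficient of a cycle with values in \<open>\<int>[s]\<close> is a cycle, so fillings over
  \<open>\<int>/p\<close> can be combined into a filling over \<open>(\<int>/p)[s]\<close>.
\<close>

lemma fill_chain:
  assumes p: "prime p" and c: "chain L c"
    and orth: "\<And>f r. (\<And>S. S \<in> cells (Suc L) \<Longrightarrow>
      [set_coboundary f S = 0] (mod int p)) \<Longrightarrow>
      [(\<Sum>S\<in>cells L. coeff (set_chain c S) r * f S) = 0] (mod int p)"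
  shows "\<exists>e. chain (Suc L) e \<and> congruent_mod p (app boundary e) c"
proof -
  have "\<forall>r. \<exists>e. \<forall>S\<in>cells L. [coeff (set_chain c S) r = set_boundary e S] (mod int p)"
    using fill_sets[OF p orth] by blast
  then obtain e where e: "\<And>r S. S \<in> cells L \<Longrightarrow>
    [coeff (set_chain c S) r = set_boundary (e r) S] (mod int p)"
    by metis
  \<comment> \<open>The degrees are bounded since there are finitely many cells, so finitely many
    fillings of coefficients assemble to polynomials.\<close>
  obtain N where N: "\<And>S. S \<in> cells L \<Longrightarrow> degree (set_chain c S) \<le> N"
    using finite_cells[of L] by (metis Max_ge finite_imageI imageI)
  define E where "E S = (\<Sum>r\<le>N. monom (e r S) r)" for S
  have coeff_E: "coeff (E S) r = (if r \<le> N then e r S else 0)" for S r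
    by (simp add: E_def coeff_sum)
  have bd: "congruent_mod p (set_boundary E S) (set_chain c S)" if S: "S \<in> cells L" for S
    unfolding congruent_mod_poly_iff
  proof
    fix r
    show "[coeff (set_boundary E S) r = coeff (set_chain c S) r] (mod int p)"
    proof (cases "r \<le> N")
      case True
      then have "coeff (set_boundary E S) r = set_boundary (e r) S"
        by (simp add: set_boundary_coeff coeff_E)
      then show ?thesis using e[OF S, of r] by (simp add: cong_sym)
    next
      case False
      then have "coeff (set_boundary E S) r = set_boundary (\<lambda>_. 0) S"
        by (simp add: set_boundary_coeff coeff_E)
      moreover have "coeff (set_chain c S) r = 0" using N[OF S] False by (intro coeff_eq_0) simp
      moreover have "set_boundary (\<lambda>_. 0 :: int) S = 0"
        unfolding set_boundary_def by (rule sum.neutral) auto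
      ultimately show ?thesis by simp
    qed
  qed
  let ?e = "list_chain (Suc L) E"
  have ch: "chain (Suc L) ?e" by (rule chain_list_chain)
  have "congruent_mod p (app boundary ?e l) (c l)" for l
  proof (cases "distinct l \<and> set l \<in> P \<and> length l = L")
    case True
    then have S: "set l \<in> cells L" by (simp add: cells_def distinct_card)
    have "set_boundary (set_chain ?e) (set l) = set_boundary E (set l)"
      unfolding set_boundary_def
    proof (intro sum.cong refl if_cong arg_cong2[of _ _ _ _ times])
      fix a assume "a \<notin> set l \<and> insert a (set l) \<in> P"
      then have "insert a (set l) \<in> cells (Suc L)" using S by (simp add: cells_def)
      then show "set_chain ?e (insert a (set l)) = E (insert a (set l))" by (rule set_chain_list_chain)
    qed
    then have "app boundary ?e l = of_int (list_sign lt l) * set_boundary E (set l)"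
      using boundary_set_chain[OF ch] True by simp
    moreover have "c l = of_int (list_sign lt l) * set_chain c (set l)"
      using chain_set_chain[OF c] True by simp
    ultimately show ?thesis using congruent_mod_mult_left[OF bd[OF S]] by simp
  next
    case False
    have z: "d l = 0" if "chain L d" for d
      using chain_distinct[OF that, of l] chain_support[OF that, of l] False by blast
    show ?thesis using z[OF c] z[OF chain_boundary[OF ch]] by simp
  qed
  then show ?thesis using ch unfolding congruent_mod_fun_iff by blast
qed

lemma coeff_set_boundary_set_chain:
  assumes c: "chain (Suc L) c" "congruent_mod p (app boundary c) 0" and R: "R \<in> cells L"
  shows "[set_boundary (\<lambda>S. coeff (set_chain c S) r) R = 0] (mod int p)"
proof -
  have "finite R" "R \<in> P" using R finite_cell by (auto simp: cells_def)
  obtain l where l: "distinct l" "set l = R" using finite_distinct_list[OF \<open>finite R\<close>] by blast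
  have "congruent_mod p (app boundary c l) 0" using c(2) by (simp add: congruent_mod_fun_iff)
  then have "congruent_mod p (of_int (list_sign lt l) * set_boundary (set_chain c) R) 0"
    using boundary_set_chain[OF c(1) l(1)] l \<open>R \<in> P\<close> by simp
  from congruent_mod_0_mult[OF this, of "of_int (list_sign lt l)"]
  have "congruent_mod p (of_int (list_sign lt l * list_sign lt l) * set_boundary (set_chain c) R) 0"
    by (simp add: mult.assoc)
  then have "congruent_mod p (set_boundary (set_chain c) R) 0" using list_sign_square[OF l(1)] by simp
  then show ?thesis by (simp add: congruent_mod_poly_iff set_boundary_coeff)
qed

end

section \<open>The cohomology of a product complex modulo \<open>p\<close>\<close>

lemma finprod_integer_mod_group:
  assumes "p > 0" "finite A" "f \<in> A \<rightarrow> carrier (integer_mod_group p)"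
  shows "finprod (integer_mod_group p) f A = (\<Sum>a\<in>A. f a) mod int p"
proof -
  interpret comm_group "integer_mod_group p" by (rule abelian_integer_mod_group)
  show ?thesis
    using assms(2,3)
  proof (induction A rule: finite_induct)
    case (insert a A)
    then show ?case by (simp add: mod_add_right_eq)
  qed (use assms(1) in simp)
qed

lemma trivial_quotient_imp_subset:
  assumes G: "group G" and H: "subgroup H G" and triv: "trivial_group (G Mod H)" and x: "x \<in> carrier G"
  shows "x \<in> H"
proof -
  interpret group G by (rule G)
  have "carrier (G Mod H) = {\<one>\<^bsub>G Mod H\<^esub>}" using triv by (simp add: trivial_group_def)
  then have "rcosets\<^bsub>G\<^esub> H = {H}" by (simp add: FactGroup_def)
  then have "H #>\<^bsub>G\<^esub> x = H" using rcosetsI[OF subgroup.subset[OF H] x] by blast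
  then show ?thesis using rcos_self[OF x H] by simp
qed

locale simplex_product_mod = simplex_product_subcomplex I V X
  for I :: "'i set" and V :: "'v set" and X +
  fixes p :: nat
  assumes prime: "prime p"
begin

abbreviation "Zp \<equiv> integer_mod_group p"

lemma p_pos: "p > 0"
  by (rule prime_gt_0_nat[OF prime])

sublocale simplex_product_cochains I V X Zp
  by (intro simplex_product_cochains.intro simplex_product_subcomplex_axioms abelian_integer_mod_group)

abbreviation graph :: "('i \<Rightarrow> 'v set) \<Rightarrow> ('i \<times> 'v) set" where
  "graph \<nu> \<equiv> Sigma I \<nu>"

abbreviation faces :: "('i \<times> 'v) set set" where
  "faces \<equiv> graph ` X"

lemma cell_extensional: "\<nu> \<in> X \<Longrightarrow> \<nu> \<in> extensional I"
  using cells by (auto simp: product_cells_def PiE_def)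

lemma inj_graph: "inj_on graph X"
proof (rule inj_onI)
  fix \<nu> \<mu> assume X: "\<nu> \<in> X" "\<mu> \<in> X" and eq: "graph \<nu> = graph \<mu>"
  have "\<nu> i = \<mu> i" if "i \<in> I" for i
  proof -
    have "graph \<nu> `` {i} = graph \<mu> `` {i}" using eq by (simp only:)
    moreover have "graph \<nu> `` {i} = \<nu> i" for \<nu> :: "'i \<Rightarrow> 'v set" using that by blast
    ultimately show ?thesis by (simp only:)
  qed
  then show "\<nu> = \<mu>" using cell_extensional X by (intro extensionalityI[of _ I])
qed

lemma faces_closed:
  assumes "S \<in> faces" "T \<subseteq> S" "I \<subseteq> fst ` T"
  shows "T \<in> faces"
proof -
  obtain \<nu> where \<nu>: "\<nu> \<in> X" "S = graph \<nu>" using assms(1) by blast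
  define \<mu> where "\<mu> = (\<lambda>i\<in>I. T `` {i})"
  have T: "T = graph \<mu>" using assms(2) unfolding \<nu> \<mu>_def by (auto simp: Sigma_def)
  have sub: "\<mu> i \<subseteq> \<nu> i" if "i \<in> I" for i using that assms(2) unfolding \<nu> \<mu>_def by auto
  have "\<mu> i \<in> Pow V - {{}}" if iI: "i \<in> I" for i
  proof -
    have "\<mu> i \<subseteq> V" using sub[OF iI] cellD(1)[OF \<nu>(1) iI] by blast
    moreover obtain v where "(i, v) \<in> T" using subsetD[OF assms(3) iI] by (elim imageE) (metis prod.collapse)
    then have "\<mu> i \<noteq> {}" using iI by (auto simp: \<mu>_def)
    ultimately show ?thesis by simp
  qed
  then have "\<mu> \<in> product_cells I V" unfolding product_cells_def \<mu>_def
    by (intro restrict_PiE_iff[THEN iffD2]) (auto simp: \<mu>_def)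
  then have "\<mu> \<in> X" by (rule face_closed[OF \<nu>(1)]) (use sub in blast)
  then show ?thesis unfolding T by (rule imageI)
qed

lemma faces_hit:
  assumes "S \<in> faces"
  shows "I \<subseteq> fst ` S"
proof
  fix i assume i: "i \<in> I"
  obtain \<nu> where \<nu>: "\<nu> \<in> X" "S = graph \<nu>" using assms by blast
  obtain v where "v \<in> \<nu> i" using cellD(2)[OF \<nu>(1) i] by blast
  then have "(i, v) \<in> S" using i \<nu> by simp
  then show "i \<in> fst ` S" by (rule rev_image_eqI) simp
qed

lemma faces_subset:
  assumes "S \<in> faces"
  shows "S \<subseteq> I \<times> V"
proof -
  obtain \<nu> where \<nu>: "\<nu> \<in> X" "S = graph \<nu>" using assms by blast
  show ?thesis unfolding \<nu>(2) by (rule Sigma_mono[OF subset_refl cellD(1)[OF \<nu>(1)]])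
qed

sublocale S: ordered_complex "I \<times> V" faces lex
proof
  show "finite (I \<times> V)" using finite_I finite_V by simp
  show "S \<subseteq> I \<times> V" if "S \<in> faces" for S by (rule faces_subset[OF that])
  show "T \<in> faces" if "S \<in> faces" "R \<in> faces" "S \<subseteq> T" "T \<subseteq> R" for S T R
    by (rule faces_closed[OF that(2,4) order_trans[OF faces_hit[OF that(1)] image_mono[OF that(3)]]])
  show "lex a b \<longleftrightarrow> \<not> lex b a" if "a \<noteq> b" for a b by (rule lex_linear[OF that])
qed

lemma card_graph: "\<nu> \<in> X \<Longrightarrow> int (card (graph \<nu>)) = cell_dim I \<nu> + int (card I)"
proof -
  assume \<nu>: "\<nu> \<in> X"
  have "card (graph \<nu>) = (\<Sum>i\<in>I. card (\<nu> i))"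
    using finite_I cellD(3)[OF \<nu>] by (intro card_SigmaI) auto
  then show ?thesis by (simp add: cell_dim_def sum_subtractf)
qed

lemma faces_cells_iff:
  "\<nu> \<in> X \<Longrightarrow> graph \<nu> \<in> S.cells (card I +
    i) \<longleftrightarrow> Some \<nu> \<in> augmented_cells I X (int i)"
  using card_graph[of \<nu>] by (auto simp: S.cells_def augmented_cells_def)

subsection \<open>Comparison of signs\<close>

text \<open>
  The incidence numbers of a product differ from those of the simplicial complex of graphs by the
  position of the factor; the sign \<open>\<chi>\<close> absorbs the difference.
\<close>

definition position :: "'i \<Rightarrow> nat" where
  "position i = card {j \<in> I. fixed_less j i}"

definition \<chi> :: "('i \<Rightarrow> 'v set) \<Rightarrow> int" where
  "\<chi> \<nu> = (- 1) ^ (\<Sum>i\<in>I. position i * card (\<nu> i))"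

lemma \<chi>_square: "\<chi> \<nu> * \<chi> \<nu> = 1"
  by (simp add: \<chi>_def flip: power_mult_distrib)

lemma graph_facet: "i \<in> I \<Longrightarrow> graph (facet \<nu> (i, v)) = graph \<nu> - {(i, v)}"
  by (auto simp: facet_def split: if_splits)

text \<open>The order on pairs counts \<open>card (\<nu> j)\<close> elements in each earlier factor,
  the product rule only the dimension \<open>card (\<nu> j) - 1\<close>. The discrepancy is
  \<open>position i\<close>, which is also the change in the exponent of \<open>\<chi>\<close> when
  factor \<open>i\<close> loses an element.\<close>

lemma incidence_sign:
  assumes \<nu>: "\<nu> \<in> X" and a: "a \<in> facet_indices I \<nu>"
  shows "incidence I \<nu> a * \<chi> (facet \<nu> a) = \<chi> \<nu> * S.sign a (graph \<nu> - {a})"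
proof -
  obtain i v where iv: "a = (i, v)" "i \<in> I" "v \<in> \<nu> i" using a by (auto simp: facet_indices_def)
  let ?J = "{j \<in> I. fixed_less j i}"
  have finJ: "finite ?J" using finite_I by simp
  have fin: "finite (\<nu> j)" "card (\<nu> j) \<ge> 1" if "j \<in> I" for j using cellD(3,4)[OF \<nu> that] .
  have "{x \<in> graph \<nu> - {a}. lex x a} = Sigma ?J \<nu> \<union> Pair i ` {w \<in> \<nu> i. fixed_less w v}"
    using iv by (auto simp: lex_def)
  moreover have "card (Sigma ?J \<nu> \<union> Pair i ` {w \<in> \<nu> i. fixed_less w v}) =
      card (Sigma ?J \<nu>) + card (Pair i ` {w \<in> \<nu> i. fixed_less w v})"
    using finJ fin iv by (intro card_Un_disjoint finite_imageI finite_SigmaI) auto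
  moreover have "card (Sigma ?J \<nu>) = (\<Sum>j\<in>?J. card (\<nu> j))"
    using finJ fin by (intro card_SigmaI) auto
  moreover have "card (Pair i ` {w \<in> \<nu> i. fixed_less w v}) = card {w \<in> \<nu> i. fixed_less w v}"
    by (intro card_image) (auto simp: inj_on_def)
  moreover have "(\<Sum>j\<in>?J. card (\<nu> j)) = (\<Sum>j\<in>?J. card (\<nu> j) - 1) + position i"
  proof -
    have "(\<Sum>j\<in>?J. card (\<nu> j)) = (\<Sum>j\<in>?J. (card (\<nu> j) - 1) + 1)"
      by (rule sum.cong) (use fin in force)+
    then show ?thesis by (simp only: sum.distrib position_def card_eq_sum)
  qed
  ultimately have 1: "card {x \<in> graph \<nu> - {a}. lex x a} = facet_exponent I \<nu> a + position i"
    by (simp add: facet_exponent_def iv)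
  have "(\<Sum>j\<in>I - {i}. position j * card (facet \<nu> a j)) =
    (\<Sum>j\<in>I - {i}. position j * card (\<nu> j))"
    by (rule sum.cong) (auto simp: facet_def iv)
  moreover have "card (facet \<nu> a i) = card (\<nu> i) - 1" using iv by (simp add: facet_def)
  moreover have "position i * card (\<nu> i) = position i * (card (\<nu> i) - 1) + position i"
    using fin(2)[OF iv(2)] by (cases "card (\<nu> i)") auto
  ultimately have 2: "(\<Sum>j\<in>I. position j * card (\<nu> j)) =
    (\<Sum>j\<in>I. position j * card (facet \<nu> a j)) + position i"
    using finite_I iv(2) by (simp add: sum.remove[of I i])
  show ?thesis
    unfolding incidence_def \<chi>_def S.sign_def 1 2 by (simp add: power_add)
qed

text \<open>The summands match because deleting a pair from a graph leaves a cell exactly when its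
  index keeps another value; the signs match through \<open>\<chi>\<close>.\<close>

lemma set_coboundary_facets:
  assumes \<nu>: "\<nu> \<in> X"
  shows "(\<Sum>a\<in>facet_indices I \<nu>. incidence I \<nu> a * (\<chi> (facet \<nu> a) * f (graph (facet \<nu>
    a)))) =
     \<chi> \<nu> * S.set_coboundary f (graph \<nu>)"
proof -
  have iff: "a \<in> graph \<nu> \<and>
    graph \<nu> - {a} \<in> faces \<longleftrightarrow> a \<in> facet_indices I \<nu>" for a
  proof
    assume a: "a \<in> facet_indices I \<nu>"
    then obtain i v where iv: "a = (i, v)" "i \<in> I" "v \<in> \<nu> i" by (auto simp: facet_indices_def)
    have "graph \<nu> - {a} = graph (facet \<nu> a)" unfolding iv(1) by (rule graph_facet[OF iv(2), symmetric])
    then have "graph \<nu> - {a} \<in> faces" using imageI[OF facet_cell[OF \<nu> a], of graph] by (simp only:)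
    then show "a \<in> graph \<nu> \<and> graph \<nu> - {a} \<in> faces" using iv by blast
  next
    assume a: "a \<in> graph \<nu> \<and> graph \<nu> - {a} \<in> faces"
    then obtain i v where iv: "a = (i, v)" "i \<in> I" "v \<in> \<nu> i" by (elim conjE SigmaE)
    have "i \<in> fst ` (graph \<nu> - {a})" by (rule subsetD[OF faces_hit[OF conjunct2[OF a]] iv(2)])
    then obtain w where "(i, w) \<in> graph \<nu> - {a}" by (elim imageE) (metis prod.collapse)
    then have "w \<in> \<nu> i" "w \<noteq> v" using iv(1) by simp_all
    then have "\<nu> i \<noteq> {v}" by blast
    then show "a \<in> facet_indices I \<nu>" using iv by (simp add: facet_indices_def)
  qed
  have "S.set_coboundary f (graph \<nu>) =
      (\<Sum>a\<in>I \<times> V.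
        if a \<in> facet_indices I \<nu> then S.sign a (graph \<nu> - {a}) * f (graph \<nu> - {a}) else 0)"
    unfolding S.set_coboundary_def iff ..
  also have "\<dots> = (\<Sum>a\<in>{a \<in> I \<times> V. a \<in> facet_indices I \<nu>}. S.sign a (graph \<nu> -
    {a}) * f (graph \<nu> - {a}))"
    by (rule sum.inter_filter[symmetric]) (use finite_I finite_V in simp)
  also have "{a \<in> I \<times> V. a \<in> facet_indices I \<nu>} = facet_indices I \<nu>"
    using cellD(1)[OF \<nu>] by (auto simp: facet_indices_def)
  finally have "\<chi> \<nu> * S.set_coboundary f (graph \<nu>) =
      (\<Sum>a\<in>facet_indices I \<nu>. \<chi> \<nu> * S.sign a (graph \<nu> - {a}) * f (graph \<nu> - {a}))"
    by (simp add: sum_distrib_left mult.assoc)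
  also have "\<dots> = (\<Sum>a\<in>facet_indices I \<nu>. incidence I \<nu> a * (\<chi> (facet \<nu> a) * f (graph
    (facet \<nu> a))))"
  proof (rule sum.cong[OF refl])
    fix a assume a: "a \<in> facet_indices I \<nu>"
    then obtain i v where iv: "a = (i, v)" "i \<in> I" by (auto simp: facet_indices_def)
    have g: "graph (facet \<nu> a) = graph \<nu> - {a}" unfolding iv(1) by (rule graph_facet[OF iv(2)])
    show "\<chi> \<nu> * S.sign a (graph \<nu> - {a}) * f (graph \<nu> - {a}) =
        incidence I \<nu> a * (\<chi> (facet \<nu> a) * f (graph (facet \<nu> a)))"
      unfolding g mult.assoc[symmetric] incidence_sign[OF \<nu> a] ..
  qed
  finally show ?thesis ..
qed

lemma coboundary_value:
  assumes c: "c \<in> carrier (C n)" and \<nu>: "Some \<nu> \<in> augmented_cells I X (n + 1)" and n: "n \<noteq> - 1"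
  shows "[d n c (Some \<nu>) =
    (\<Sum>a\<in>facet_indices I \<nu>. incidence I \<nu> a * c (Some (facet \<nu> a)))] (mod int p)"
proof -
  have X: "\<nu> \<in> X" using Some_augmented[OF \<nu>] by blast
  have "d n c (Some \<nu>) =
      finprod Zp (\<lambda>a. c (Some (facet \<nu> a)) [^]\<^bsub>Zp\<^esub> incidence I \<nu> a) (facet_indices I
        \<nu>)"
    using \<nu> n by (simp add: coboundary_def)
  also have "\<dots> = (\<Sum>a\<in>facet_indices I \<nu>. c (Some (facet \<nu> a)) [^]\<^bsub>Zp\<^esub> incidence I
    \<nu> a) mod int p"
    by (rule finprod_integer_mod_group[OF p_pos finite_facet_indices[OF X]])
      (use coboundary_term_closed[OF c \<nu> n] in auto)
  also have "[\<dots> = (\<Sum>a\<in>facet_indices I \<nu>. c (Some (facet \<nu> a)) [^]\<^bsub>Zp\<^esub> incidence I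
    \<nu> a)] (mod int p)"
    by simp
  also have "[(\<Sum>a\<in>facet_indices I \<nu>. c (Some (facet \<nu> a)) [^]\<^bsub>Zp\<^esub> incidence I \<nu> a)
    =
     (\<Sum>a\<in>facet_indices I \<nu>. incidence I \<nu> a * c (Some (facet \<nu> a)))] (mod int p)"
    by (rule cong_sum) (simp add: int_pow_integer_mod_group)
  finally show ?thesis .
qed

lemma cocycle_imp_coboundary:
  assumes triv: "trivial_group (reduced_cohomology_group I X Zp n)"
    and c: "c \<in> carrier (C n)" "d n c = \<one>\<^bsub>C (n + 1)\<^esub>"
  shows "\<exists>e\<in>carrier (C (n - 1)). d (n - 1) e = c"
proof -
  have "c \<in> carrier (cocycle_group I X Zp n)" using c by (simp add: carrier_cocycle_group)
  from trivial_quotient_imp_subset[OF comm_group.axioms(2)[OF comm_group_cocycle_group]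
      subgroup_coboundary_set triv[unfolded reduced_cohomology_group_def] this]
  have "c \<in> coboundary_set I X Zp n" .
  then show ?thesis by (auto simp: coboundary_set_def)
qed

definition cochain_of :: "int \<Rightarrow> (('i \<times> 'v) set \<Rightarrow> int) \<Rightarrow> ('i \<Rightarrow>
  'v set) option \<Rightarrow> int" where
  "cochain_of n f = (\<lambda>x\<in>augmented_cells I X n. case x of None \<Rightarrow> 0 | Some \<nu> \<Rightarrow>
    (\<chi> \<nu> * f (graph \<nu>)) mod int p)"

lemma cochain_of_closed: "cochain_of n f \<in> carrier (C n)"
  using p_pos by (auto simp: cochain_group_def cochain_of_def carrier_integer_mod_group split: option.splits)

lemma set_cocycle:
  assumes triv: "trivial_group (reduced_cohomology_group I X Zp (int i))"
    and f: "\<And>S. S \<in> S.cells (Suc (card I + i)) \<Longrightarrow> [S.set_coboundary f S = 0] (mod int p)"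
  shows "\<exists>e\<in>carrier (C (int i - 1)). \<forall>\<nu>. Some \<nu> \<in> augmented_cells I X (int i)
    \<longrightarrow>
    [d (int i - 1) e (Some \<nu>) = \<chi> \<nu> * f (graph \<nu>)] (mod int p)"
proof -
  let ?c = "cochain_of (int i) f"
  have "d (int i) ?c = \<one>\<^bsub>C (int i + 1)\<^esub>"
  proof (rule ext)
    fix x
    show "d (int i) ?c x = \<one>\<^bsub>C (int i + 1)\<^esub> x"
    proof (cases "x \<in> augmented_cells I X (int i + 1)")
      case x: True
      then obtain \<nu> where \<nu>: "x = Some \<nu>" by (auto simp: augmented_cells_def split: if_splits)
      have X: "\<nu> \<in> X" using x \<nu> Some_augmented by blast
      have fa: "Some (facet \<nu> a) \<in> augmented_cells I X (int i)" if "a \<in> facet_indices I \<nu>" for a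
        by (rule facet_augmented[OF _ _ that]) (use x \<nu> in auto)
      have "[d (int i) ?c x =
        (\<Sum>a\<in>facet_indices I \<nu>. incidence I \<nu> a * ?c (Some (facet \<nu> a)))] (mod int p)"
        unfolding \<nu> by (rule coboundary_value[OF cochain_of_closed]) (use x \<nu> in auto)
      also have "[(\<Sum>a\<in>facet_indices I \<nu>. incidence I \<nu> a * ?c (Some (facet \<nu> a))) =
          (\<Sum>a\<in>facet_indices I \<nu>. incidence I \<nu> a * (\<chi> (facet \<nu> a) * f (graph (facet \<nu>
            a))))] (mod int p)"
        by (intro cong_sum cong_mult cong_refl) (use fa in \<open>simp add: cochain_of_def\<close>)
      also have "(\<Sum>a\<in>facet_indices I \<nu>. incidence I \<nu> a * (\<chi> (facet \<nu> a) * f (graph (facet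
        \<nu> a)))) =
          \<chi> \<nu> * S.set_coboundary f (graph \<nu>)"
        by (rule set_coboundary_facets[OF X])
      also have "[\<chi> \<nu> * S.set_coboundary f (graph \<nu>) = \<chi> \<nu> * 0] (mod int p)"
      proof (intro cong_mult cong_refl f)
        show "graph \<nu> \<in> S.cells (Suc (card I + i))"
          using faces_cells_iff[OF X, of "Suc i"] x \<nu> by (simp add: add.commute)
      qed
      finally have "[d (int i) ?c x = 0] (mod int p)" by simp
      moreover have "d (int i) ?c x \<in> carrier Zp"
        using cochain_closed[OF coboundary_closed[OF cochain_of_closed] x] .
      ultimately have "d (int i) ?c x = 0"
        using p_pos by (simp add: carrier_integer_mod_group cong_def)
      then show ?thesis using x by (simp add: cochain_group_def)
    qed (simp add: coboundary_def cochain_group_def)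
  qed
  from cocycle_imp_coboundary[OF triv cochain_of_closed this]
  obtain e where e: "e \<in> carrier (C (int i - 1))" "d (int i - 1) e = ?c" by blast
  moreover have "[?c (Some \<nu>) = \<chi> \<nu> * f (graph \<nu>)] (mod int p)"
    if "Some \<nu> \<in> augmented_cells I X (int i)" for \<nu>
    using that by (simp add: cochain_of_def)
  ultimately show ?thesis by (intro bexI[of _ e]) simp_all
qed

lemma \<chi>_cancel: "[\<chi> \<nu> * x = \<chi> \<nu> * y] (mod int p) \<Longrightarrow> [x = y] (mod int p)"
  using cong_mult[OF cong_refl[of "\<chi> \<nu>"]] \<chi>_square[of \<nu>] by (metis mult.assoc mult_1)

lemma set_cocycle_imp_coboundary:
  assumes triv: "trivial_group (reduced_cohomology_group I X Zp (int (Suc i)))"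
    and f: "\<And>S. S \<in> S.cells (Suc (Suc (card I + i))) \<Longrightarrow>
      [S.set_coboundary f S = 0] (mod int p)"
  shows "\<exists>g. \<forall>S\<in>S.cells (Suc (card I + i)). [f S = S.set_coboundary g S] (mod int p)"
proof -
  obtain e where e: "e \<in> carrier (C (int (Suc i) - 1))"
    "\<And>\<nu>. Some \<nu> \<in> augmented_cells I X (int (Suc i)) \<Longrightarrow>
       [d (int (Suc i) - 1) e (Some \<nu>) = \<chi> \<nu> * f (graph \<nu>)] (mod int p)"
    using set_cocycle[OF triv] f by force
  have i: "int (Suc i) - 1 = int i" by simp
  define g where "g S = (let \<nu> = inv_into X graph S in \<chi> \<nu> * e (Some \<nu>))" for S
  have "[f S = S.set_coboundary g S] (mod int p)" if S: "S \<in> S.cells (Suc (card I + i))" for S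
  proof -
    obtain \<nu> where \<nu>: "\<nu> \<in> X" "S = graph \<nu>" using S by (auto simp: S.cells_def)
    have aug: "Some \<nu> \<in> augmented_cells I X (int (Suc i))"
      using faces_cells_iff[OF \<nu>(1), of "Suc i"] S \<nu>(2) by simp
    have "[\<chi> \<nu> * f (graph \<nu>) = d (int i) e (Some \<nu>)] (mod int p)"
      using e(2)[OF aug] unfolding i by (rule cong_sym)
    also have "[d (int i) e (Some \<nu>) =
        (\<Sum>a\<in>facet_indices I \<nu>. incidence I \<nu> a * e (Some (facet \<nu> a)))] (mod int p)"
      by (rule coboundary_value) (use e(1) aug in \<open>simp_all add: i add.commute\<close>)
    also have "(\<Sum>a\<in>facet_indices I \<nu>. incidence I \<nu> a * e (Some (facet \<nu> a))) =
        (\<Sum>a\<in>facet_indices I \<nu>. incidence I \<nu> a * (\<chi> (facet \<nu> a) * g (graph (facet \<nu>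
          a))))"
    proof (rule sum.cong[OF refl])
      fix a assume "a \<in> facet_indices I \<nu>"
      then have "inv_into X graph (graph (facet \<nu> a)) = facet \<nu> a"
        by (intro inv_into_f_f[OF inj_graph] facet_cell[OF \<nu>(1)])
      then have "\<chi> (facet \<nu> a) * g (graph (facet \<nu> a)) =
        (\<chi> (facet \<nu> a) * \<chi> (facet \<nu> a)) * e (Some (facet \<nu> a))"
        by (simp add: g_def Let_def mult.assoc)
      then show "incidence I \<nu> a * e (Some (facet \<nu> a)) =
          incidence I \<nu> a * (\<chi> (facet \<nu> a) * g (graph (facet \<nu> a)))"
        by (simp only: \<chi>_square mult_1)
    qed
    also have "\<dots> = \<chi> \<nu> * S.set_coboundary g (graph \<nu>)" by (rule set_coboundary_facets[OF \<nu>(1)])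
    finally show ?thesis unfolding \<nu>(2) by (rule \<chi>_cancel)
  qed
  then show ?thesis by blast
qed

text \<open>A coboundary in degree 0 comes from a single value on the empty face. The twist does not
  spoil constancy: on vertices all \<open>card (\<nu> i)\<close> are 1, so \<open>\<chi>\<close> has
  the common value \<open>\<chi>0\<close>.\<close>

lemma set_cocycle_imp_constant:
  assumes triv: "trivial_group (reduced_cohomology_group I X Zp 0)"
    and f: "\<And>S. S \<in> S.cells (Suc (card I)) \<Longrightarrow> [S.set_coboundary f S = 0] (mod int p)"
  shows "\<exists>r. \<forall>S\<in>S.cells (card I). [f S = r] (mod int p)"
proof -
  obtain e where e: "e \<in> carrier (C (int 0 - 1))"
    "\<And>\<nu>. Some \<nu> \<in> augmented_cells I X (int 0) \<Longrightarrow>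
       [d (int 0 - 1) e (Some \<nu>) = \<chi> \<nu> * f (graph \<nu>)] (mod int p)"
    using set_cocycle[of 0 f] triv f by force
  define \<chi>0 where "\<chi>0 = ((- 1) ^ (\<Sum>i\<in>I. position i) :: int)"
  have "[f S = \<chi>0 * e None] (mod int p)" if S: "S \<in> S.cells (card I)" for S
  proof -
    obtain \<nu> where \<nu>: "\<nu> \<in> X" "S = graph \<nu>" using S by (auto simp: S.cells_def)
    have aug: "Some \<nu> \<in> augmented_cells I X (int 0)"
      using faces_cells_iff[OF \<nu>(1), of 0] S \<nu>(2) by simp
    have "cell_dim I \<nu> = 0" using Some_augmented[OF aug] by simp
    moreover have "0 \<le> int (card (\<nu> i)) - 1" if "i \<in> I" for i
      using cellD(4)[OF \<nu>(1) that] by simp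
    ultimately have "\<forall>i\<in>I. int (card (\<nu> i)) - 1 = 0"
      unfolding cell_dim_def by (simp only: sum_nonneg_eq_0_iff[OF finite_I])
    then have "(\<Sum>i\<in>I. position i * card (\<nu> i)) = (\<Sum>i\<in>I. position i)"
      by (intro sum.cong) auto
    then have \<chi>: "\<chi> \<nu> = \<chi>0" by (simp add: \<chi>_def \<chi>0_def)
    have "d (int 0 - 1) e (Some \<nu>) = e None"
      using aug by (simp add: coboundary_def)
    then have "[\<chi> \<nu> * f (graph \<nu>) = (\<chi> \<nu> * \<chi> \<nu>) * e None] (mod int p)"
      using e(2)[OF aug] \<chi>_square[of \<nu>] by (simp add: cong_sym)
    then have "[\<chi> \<nu> * f (graph \<nu>) = \<chi> \<nu> * (\<chi>0 * e None)] (mod int p)"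
      using \<chi> by (simp add: mult.assoc)
    then show ?thesis unfolding \<nu>(2) by (rule \<chi>_cancel)
  qed
  then show ?thesis by blast
qed

text \<open>Without cells the value 1 on the empty face would be a cocycle, and coboundaries in
  degree -1 are 0.\<close>

lemma nonempty:
  assumes triv: "trivial_group (reduced_cohomology_group I X Zp (- 1))"
  shows "X \<noteq> {}"
proof
  assume X: "X = {}"
  define c where "c = (\<lambda>x\<in>augmented_cells I X (- 1). (1 :: int))"
  have p1: "1 < int p" using prime_gt_1_nat[OF prime] by simp
  have c: "c \<in> carrier (C (- 1))"
    using p1 by (auto simp: cochain_group_def c_def carrier_integer_mod_group)
  have "d (- 1) c = \<one>\<^bsub>C (- 1 + 1)\<^esub>"
    by (rule ext) (simp add: coboundary_def cochain_group_def augmented_cells_def X)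
  from cocycle_imp_coboundary[OF triv c this] obtain e where "d (- 1 - 1) e = c" by blast
  then have "d (- 1 - 1) e None = c None" by simp
  then show False by (simp add: coboundary_def augmented_cells_def c_def)
qed

end

section \<open>The augmentation in terms of oriented cells\<close>

locale ordered_grid = grid I W P \<gamma> p k + ordered_complex "I \<times> W" P lt
  for I :: "'i::linorder set" and W :: "'v set" and P \<gamma> p k and lt +
  fixes lt0 :: "'i \<Rightarrow> 'i \<Rightarrow> bool"
  assumes lt0: "\<And>i j v w. i \<noteq> j \<Longrightarrow> lt (i, v) (j, w) \<longleftrightarrow> lt0 i j"
begin

lemma list_sign_fst: "distinct (map fst l) \<Longrightarrow> list_sign lt l = list_sign lt0 (map fst l)"
proof (induction l)
  case (Cons a l)
  have "{i \<in> set (map fst l). lt0 i (fst a)} = fst ` {x \<in> set l. lt x a}"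
  proof -
    have "lt x a \<longleftrightarrow> lt0 (fst x) (fst a)" if "x \<in> set l" for x
    proof -
      have "fst x \<in> fst ` set l" using that by (rule imageI)
      moreover have "fst a \<notin> fst ` set l" using Cons.prems by simp
      ultimately have "fst x \<noteq> fst a" by metis
      then show ?thesis using lt0[of "fst x" "fst a" "snd x" "snd a"] by simp
    qed
    then show ?thesis by auto
  qed
  moreover have "inj_on fst {x \<in> set l. lt x a}"
    using Cons.prems by (auto simp: distinct_map intro: inj_on_subset)
  ultimately have "card {i \<in> set (map fst l). lt0 i (fst a)} = card {x \<in> set l. lt x a}"
    by (simp add: card_image)
  moreover have "distinct (a # l)" using Cons.prems by (simp only: distinct_map)
  moreover from this have "distinct l" by simp
  ultimately show ?case using Cons by (simp add: list_sign_def)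
qed (simp add: list_sign_def)

text \<open>The augmentation lists indices by the order of their type, the orientation of cells by
  \<open>lt0\<close>. The two need not agree, and this sign compares them.\<close>

definition order_sign :: int where
  "order_sign = list_sign lt0 (sorted_list_of_set I)"

lemma order_sign_square: "order_sign * order_sign = 1"
  unfolding order_sign_def by (rule list_sign_square) simp

lemma aug_set_chain:
  assumes c: "chain L c"
  shows "aug c = of_int order_sign * (\<Sum>S\<in>cells (card I). set_chain c S)"
proof -
  define u where "u = sorted_list_of_set I"
  have u: "distinct u" "set u = I" using finite_I by (auto simp: u_def)
  let ?V = "{l \<in> vertex_lists u. set l \<in> P}"
  have fin: "finite (vertex_lists u)"
  proof (rule finite_subset)
    show "vertex_lists u \<subseteq> {l. set l \<subseteq> I \<times> W \<and> length l = length u}"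
      by (auto simp: vertex_lists_def)
    show "finite {l. set l \<subseteq> I \<times> W \<and> length l = length u}"
      by (rule finite_lists_length_eq[OF finite_A])
  qed
  have d: "distinct (map fst l)" "distinct l" if "l \<in> vertex_lists u" for l
  proof -
    show "distinct (map fst l)" using that u(1) by (simp add: vertex_lists_def)
    then show "distinct l" by (simp only: distinct_map)
  qed
  have "aug c = (\<Sum>l\<in>?V. c l)"
    unfolding aug_def u_def[symmetric]
  proof (rule sum.mono_neutral_right[OF fin])
    show "\<forall>l\<in>vertex_lists u - ?V. c l = 0"
    proof
      fix l assume l: "l \<in> vertex_lists u - ?V"
      show "c l = 0"
      proof (rule ccontr)
        assume "c l \<noteq> 0"
        from chain_support[OF c this] show False using l by simp
      qed
    qed
  qed simp
  also have "\<dots> = (\<Sum>l\<in>?V. of_int order_sign * set_chain c (set l))"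
  proof (rule sum.cong[OF refl])
    fix l assume "l \<in> ?V"
    then have l: "l \<in> vertex_lists u" by simp
    have "map fst l = u" using l by (simp add: vertex_lists_def)
    then have "list_sign lt l = order_sign"
      using list_sign_fst[OF d(1)[OF l]] by (simp add: order_sign_def u_def)
    then show "c l = of_int order_sign * set_chain c (set l)"
      using chain_set_chain[OF c d(2)[OF l]] by simp
  qed
  also have "\<dots> = (\<Sum>S\<in>cells (card I). of_int order_sign * set_chain c S)"
  proof (rule sum.reindex_bij_betw)
    show "bij_betw set ?V (cells (card I))"
      unfolding bij_betw_def
    proof
      show "inj_on set ?V"
      proof (rule inj_onI)
        fix l l' assume V: "l \<in> ?V" "l' \<in> ?V" and eq: "set l = set l'"
        then have l: "l \<in> vertex_lists u" "l' \<in> vertex_lists u" by auto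
        have "map_of l = map_of l'" using map_of_inject_set[OF d(1)[OF l(1)] d(1)[OF l(2)]] eq by simp
        then have "map (\<lambda>i. (i, the (map_of l i))) u = map (\<lambda>i. (i, the (map_of l' i))) u"
          by (simp only:)
        then show "l = l'" unfolding vertex_list_eq[OF l(1) u(1)] vertex_list_eq[OF l(2) u(1)] .
      qed
      show "set ` ?V = cells (card I)"
      proof (intro equalityI subsetI)
        fix S assume "S \<in> set ` ?V"
        then obtain l where l: "S = set l" "l \<in> vertex_lists u" "S \<in> P" by blast
        have "map fst l = u" using l(2) by (simp add: vertex_lists_def)
        then have "length l = length u" by (metis length_map)
        also have "\<dots> = card I" using u distinct_card by metis
        finally show "S \<in> cells (card I)" using l d(2)[OF l(2)] by (simp add: cells_def distinct_card)
      next
        fix S assume "S \<in> cells (card I)"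
        then have S: "S \<in> P" "card S = card I" by (auto simp: cells_def)
        have f: "fst ` S = I"
        proof (rule equalityI[OF _ hits[OF S(1)]])
          show "fst ` S \<subseteq> I" by (rule order_trans[OF image_mono[OF P_grid[OF S(1)]]]) auto
        qed
        \<comment> \<open>A cell with as many elements as \<open>I\<close> that meets every index
          has exactly one element over each.\<close>
        have inj: "inj_on fst S" using eq_card_imp_inj_on[OF finite_cell[OF S(1)], of fst] f S(2) by simp
        define l where "l = map (inv_into S fst) u"
        have "set l = inv_into S fst ` fst ` S" by (simp add: l_def u(2) f)
        also have "\<dots> = S" by (rule inv_into_image_cancel[OF inj subset_refl])
        finally have sl: "set l = S" .
        have "map fst l = u" unfolding l_def map_map
          by (rule map_idI) (use f u(2) in \<open>simp add: f_inv_into_f\<close>)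
        then have "l \<in> ?V" using sl S(1) P_grid[OF S(1)] by (simp add: vertex_lists_def)
        then show "S \<in> set ` ?V" using sl by (intro image_eqI[of _ _ l]) simp_all
      qed
    qed
  qed
  finally show ?thesis by (simp add: sum_distrib_left)
qed

lemma vertex_chain:
  assumes "S0 \<in> cells (card I)"
  shows "\<exists>c. chain (card I) c \<and> aug c = 1"
proof (intro exI conjI)
  let ?e = "\<lambda>S. if S = S0 then of_int order_sign else 0"
  show ch: "chain (card I) (list_chain (card I) ?e)" by (rule chain_list_chain)
  have "aug (list_chain (card I) ?e) = of_int order_sign * (\<Sum>S\<in>cells (card I). ?e S)"
    unfolding aug_set_chain[OF ch] by (simp add: set_chain_list_chain cong: sum.cong)
  also have "(\<Sum>S\<in>cells (card I). ?e S) = of_int order_sign"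
    using assms finite_cells by simp
  finally show "aug (list_chain (card I) ?e) = 1"
    by (simp add: order_sign_square flip: of_int_mult)
qed

end

section \<open>The transitive action\<close>

text \<open>The coordinate translations of \<open>(\<int>/p)\<^sup>k\<close>, transported along a
  bijection. Transitivity is stated through invariant subsets, as it is applied to a slice of a
  fixed cell; being the identity off \<open>I\<close> makes the group laws hold everywhere.\<close>

lemma exists_transitive_action:
  fixes I :: "'i set"
  assumes "finite I" "card I = p ^ k" "p > 0"
  shows "\<exists>\<gamma>. (\<forall>j<k. bij_betw (\<gamma> j) I I) \<and>
    (\<forall>j<k. \<forall>x. x \<notin> I \<longrightarrow> \<gamma> j x = x) \<and>
    (\<forall>i<k. \<forall>j<k. \<forall>x. \<gamma> i (\<gamma> j x) = \<gamma> j (\<gamma> i x)) \<and>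
      (\<forall>j<k. \<forall>x. (\<gamma> j ^^ p) x = x) \<and>
    (\<forall>B. B \<subseteq> I \<longrightarrow> B \<noteq> {} \<longrightarrow>
      (\<forall>j<k. \<gamma> j ` B \<subseteq> B) \<longrightarrow> B = I)"
proof -
  define Q where "Q = ({..<k} \<rightarrow>\<^sub>E {..<p})"
  have "card Q = p ^ k" "finite Q" by (auto simp: Q_def card_PiE intro!: finite_PiE)
  then obtain b where b: "bij_betw b I Q"
    using assms(1,2) finite_same_card_bij by metis
  define b' where "b' = inv_into I b"
  have b': "b' f \<in> I" "b (b' f) = f" if "f \<in> Q" for f
    using that b unfolding b'_def bij_betw_def by (metis inv_into_into, metis f_inv_into_f)
  have bQ: "b x \<in> Q" "b' (b x) = x" if "x \<in> I" for x
    using that b unfolding b'_def bij_betw_def by (blast, metis inv_into_f_f)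
  define s where "s j n f = f(j := (f j + n) mod p)" for j n :: nat and f :: "nat \<Rightarrow> nat"
  have sQ: "s j n f \<in> Q" if "j < k" "f \<in> Q" for j n f
    using that assms(3) unfolding s_def Q_def by (intro PiE_I) (auto simp: PiE_iff extensional_def)
  define \<gamma> where "\<gamma> j x = (if x \<in> I then b' (s j 1 (b x)) else x)" for j x
  have pow: "(\<gamma> j ^^ n) (b' f) = b' (s j n f)" if "j < k" "f \<in> Q" for j n f
  proof (induction n)
    case 0
    have "f j < p" using that by (auto simp: Q_def)
    then show ?case by (simp add: s_def)
  next
    case (Suc n)
    have "(\<gamma> j ^^ Suc n) (b' f) = \<gamma> j (b' (s j n f))" by (simp add: Suc)
    also have "\<dots> = b' (s j 1 (s j n f))"
      using b'[OF sQ[OF that]] by (simp add: \<gamma>_def)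
    also have "s j 1 (s j n f) = s j (Suc n) f" by (simp add: s_def mod_Suc_eq)
    finally show ?case .
  qed
  have order: "(\<gamma> j ^^ p) x = x" if "j < k" for j x
  proof (cases "x \<in> I")
    case True
    have "b x j < p" using bQ(1)[OF True] that by (auto simp: Q_def)
    then have "s j p (b x) = b x" by (simp add: s_def)
    then show ?thesis using pow[OF that bQ(1)[OF True], of p] bQ(2)[OF True] by simp
  next
    case False
    have "(\<gamma> j ^^ n) x = x" for n by (induction n) (auto simp: \<gamma>_def False)
    then show ?thesis .
  qed
  have I: "\<gamma> j x \<in> I" if "j < k" "x \<in> I" for j x
    using that b'(1)[OF sQ[OF that(1) bQ(1)[OF that(2)]]] by (simp add: \<gamma>_def)
  have comm: "\<gamma> i (\<gamma> j x) = \<gamma> j (\<gamma> i x)" if "i < k" "j < k" for i j x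
  proof (cases "x \<in> I")
    case True
    have "\<gamma> i (\<gamma> j x) = b' (s i 1 (s j 1 (b x)))" if "i < k" "j < k" for i j
      using b'[OF sQ[OF that(2) bQ(1)[OF True]]] True by (simp add: \<gamma>_def)
    moreover have "s i 1 (s j 1 (b x)) = s j 1 (s i 1 (b x))"
      by (cases "i = j") (auto simp: s_def fun_upd_twist)
    ultimately show ?thesis using that by simp
  qed (simp add: \<gamma>_def)
  have bij: "bij_betw (\<gamma> j) I I" if j: "j < k" for j
  proof (rule bij_betw_byWitness[of _ "\<gamma> j ^^ (p - 1)"])
    have pn: "(\<gamma> j ^^ n) x \<in> I" if "x \<in> I" for n x
      by (induction n) (use that I[OF j] in auto)
    have Suc: "Suc (p - 1) = p" using assms(3) by simp
    have "(\<gamma> j ^^ Suc (p - 1)) x = x" for x unfolding Suc by (rule order[OF j])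
    then have "(\<gamma> j ^^ (p - 1)) (\<gamma> j x) = x" "\<gamma> j ((\<gamma> j ^^ (p - 1)) x) = x" for x
      by (simp_all only: funpow.simps comp_apply funpow_swap1)
    then show "\<forall>x\<in>I. (\<gamma> j ^^ (p - 1)) (\<gamma> j x) =
      x" "\<forall>x\<in>I. \<gamma> j ((\<gamma> j ^^ (p - 1)) x) = x" by blast+
    show "\<gamma> j ` I \<subseteq> I" "(\<gamma> j ^^ (p - 1)) ` I \<subseteq> I" using I[OF j] pn by blast+
  qed
  have trans: "B = I" if B: "B \<subseteq> I" "B \<noteq> {}" "\<forall>j<k. \<gamma> j ` B \<subseteq> B" for B
  proof
    show "I \<subseteq> B"
    proof
      fix y assume y: "y \<in> I"
      obtain x where x: "x \<in> B" using B(2) by blast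
      \<comment> \<open>A path from \<open>x\<close> to \<open>y\<close> that corrects one
        coordinate at a time.\<close>
      define h where "h n = (\<lambda>i\<in>{..<k}. if i < n then b y i else b x i)" for n
      have bx: "b x \<in> Q" "b y \<in> Q" using x B(1) y bQ(1) by blast+
      have hQ: "h n \<in> Q" for n using bx by (auto simp: h_def Q_def PiE_iff)
      have "n \<le> k \<Longrightarrow> b' (h n) \<in> B" for n
      proof (induction n)
        case 0
        have "h 0 = b x" using bx(1) by (auto simp: h_def Q_def fun_eq_iff PiE_iff extensional_def)
        then show ?case using x B(1) bQ(2)[of x] by (simp add: subset_iff)
      next
        case (Suc n)
        then have n: "n < k" "b' (h n) \<in> B" by auto
        have "b y n < p" "b x n < p" using bx n(1) by (auto simp: Q_def)
        \<comment> \<open>The exponent carries coordinate \<open>n\<close> from \<open>b x n\<close>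
          to \<open>b y n\<close>; adding \<open>p\<close> keeps the subtraction of natural numbers
          exact.\<close>
        then have "(b x n + (b y n + p - b x n)) mod p = b y n" by simp
        then have "s n (b y n + p - b x n) (h n) = h (Suc n)"
          using n(1) by (auto simp: s_def h_def fun_eq_iff less_Suc_eq)
        moreover have "(\<gamma> n ^^ r) (b' (h n)) \<in> B" for r
          by (induction r) (use n B(3) in auto)
        ultimately show ?case using pow[OF n(1) hQ] by metis
      qed
      moreover have "h k = b y" using bx(2) by (auto simp: h_def Q_def fun_eq_iff PiE_iff extensional_def)
      ultimately show "y \<in> B" using bQ(2)[OF y] by (metis order_refl)
    qed
  qed (rule B(1))
  show ?thesis
    by (intro exI[of _ \<gamma>] conjI allI impI bij comm order trans) (auto simp: \<gamma>_def)
qed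

section \<open>The Ramsey complex\<close>

text \<open>\<open>S\<close> contains a vertex with all values in \<open>\<sigma>\<close> exactly
  when its part over \<open>\<sigma>\<close> meets every index. With the singletons of colours as
  \<open>K\<close> this is the target complex, whose cells contain no constant colouring.\<close>

definition ramsey_cells :: "'i set \<Rightarrow> 'v set \<Rightarrow> 'v set set \<Rightarrow> ('i \<times> 'v) set
  set" where
  "ramsey_cells I W K =
     {S. S \<subseteq> I \<times> W \<and> I \<subseteq> fst ` S \<and>
       (\<forall>\<sigma>\<in>K. \<not> I \<subseteq> fst ` (S \<inter> UNIV \<times> \<sigma>))}"

lemma grid_ramsey_cells:
  fixes I :: "'i::linorder set" and W :: "'v set"
  assumes "finite I" "finite W" "prime p"
    and bij: "\<And>j. j < k \<Longrightarrow> bij_betw (\<gamma> j) I I"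
    and outside: "\<And>j x. j < k \<Longrightarrow> x \<notin> I \<Longrightarrow> \<gamma> j x = x"
    and comm: "\<And>i j x. i < k \<Longrightarrow> j < k \<Longrightarrow>
      \<gamma> i (\<gamma> j x) = \<gamma> j (\<gamma> i x)"
    and order: "\<And>j x. j < k \<Longrightarrow> (\<gamma> j ^^ p) x = x"
  shows "grid I W (ramsey_cells I W K) \<gamma> p k"
proof
  show "S \<subseteq> I \<times> W" "I \<subseteq> fst ` S" if "S \<in> ramsey_cells I W K" for S
    using that by (simp_all add: ramsey_cells_def)
  show "T \<in> ramsey_cells I W K" if "S \<in> ramsey_cells I W K" "T \<subseteq> S" "I \<subseteq> fst ` T" for S T
  proof -
    have "fst ` (T \<inter> UNIV \<times> \<sigma>) \<subseteq> fst ` (S \<inter> UNIV \<times> \<sigma>)" for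
      \<sigma>
      by (rule image_mono) (use that(2) in blast)
    then show ?thesis using that unfolding ramsey_cells_def by blast
  qed
  show "map_prod (\<gamma> j) id ` S \<in> ramsey_cells I W K \<longleftrightarrow> S \<in> ramsey_cells I W K"
    if j: "j < k" for j S
  proof -
    have img: "\<gamma> j ` I = I" and inj: "inj_on (\<gamma> j) I" using bij[OF j] by (auto simp: bij_betw_def)
    have mem: "\<gamma> j x \<in> I \<longleftrightarrow> x \<in> I" for x
      using imageI[of x I "\<gamma> j"] outside[OF j, of x] unfolding img by (cases "x \<in> I") simp_all
    have inv: "x = y" if "\<gamma> j x = \<gamma> j y" "x \<in> I" for x y
    proof -
      have "\<gamma> j x \<in> I" using that(2) by (simp only: mem)
      then have "y \<in> I" unfolding that(1) by (simp only: mem)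
      then show ?thesis using inj that by (simp add: inj_on_def)
    qed
    have fst: "fst ` map_prod (\<gamma> j) id ` T = \<gamma> j ` fst ` T" for T :: "('i \<times> 'v) set"
      by (simp only: image_image fst_map_prod)
    have hit: "I \<subseteq> \<gamma> j ` B \<longleftrightarrow> I \<subseteq> B" for B
    proof
      assume "I \<subseteq> B"
      then have "\<gamma> j ` I \<subseteq> \<gamma> j ` B" by (rule image_mono)
      then show "I \<subseteq> \<gamma> j ` B" by (simp only: img)
    next
      assume *: "I \<subseteq> \<gamma> j ` B"
      show "I \<subseteq> B"
      proof
        fix x assume x: "x \<in> I"
        then have "\<gamma> j x \<in> \<gamma> j ` B" using * by (simp add: mem subset_iff)
        then obtain y where "y \<in> B" "\<gamma> j x = \<gamma> j y" by blast
        then show "x \<in> B" using inv[of x y] x by simp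
      qed
    qed
    have int: "map_prod (\<gamma> j) id ` S \<inter> UNIV \<times> \<sigma> =
      map_prod (\<gamma> j) id ` (S \<inter> UNIV \<times> \<sigma>)" for \<sigma>
      by auto
    have el: "map_prod (\<gamma> j) id x \<in> I \<times> W \<longleftrightarrow> x \<in> I \<times> W" for x :: "'i
      \<times> 'v"
      by (cases x) (simp add: mem)
    have "map_prod (\<gamma> j) id ` S \<subseteq> I \<times> W \<longleftrightarrow> S \<subseteq> I \<times> W"
      unfolding image_subset_iff el by blast
    then show ?thesis unfolding ramsey_cells_def mem_Collect_eq int fst hit by (simp only:)
  qed
qed (fact assms(1) assms(2) assms(3) bij comm order)+

text \<open>A vertex violates the Ramsey condition exactly when it maps all indices into one face
  \<open>\<sigma>\<close>; such a vertex can be chosen in the cell \<open>\<nu>\<close> exactly when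
  every \<open>\<nu> i\<close> meets \<open>\<sigma>\<close>.\<close>

lemma Ram_graphs:
  assumes m: "m \<ge> 2" and \<Sigma>: "finite_simplicial_complex \<Sigma>"
  shows "Sigma {1..m} ` Ram (boundary_simplex m) \<Sigma> = ramsey_cells {1..m} (vertices \<Sigma>) \<Sigma>"
proof (intro equalityI subsetI)
  let ?I = "{1..m}"
  note I = vertices_boundary_simplex[OF m]
  fix S assume "S \<in> Sigma ?I ` Ram (boundary_simplex m) \<Sigma>"
  then obtain \<nu> where \<nu>: "\<nu> \<in> ?I \<rightarrow>\<^sub>E (Pow (vertices \<Sigma>) - {{}})"
    "Pi\<^sub>E ?I \<nu> \<subseteq> ramsey_vertices (boundary_simplex m) \<Sigma>" and S: "S = Sigma ?I \<nu>"
    by (auto simp: Ram_def induced_subcomplex_def product_cells_def I)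
  have \<nu>i: "\<nu> i \<subseteq> vertices \<Sigma>" "\<nu> i \<noteq> {}" if "i \<in> ?I" for i
    using PiE_mem[OF \<nu>(1) that] by auto
  have "S \<subseteq> ?I \<times> vertices \<Sigma>" unfolding S by (rule Sigma_mono[OF subset_refl \<nu>i(1)])
  moreover have "?I \<subseteq> fst ` S"
  proof
    fix i assume i: "i \<in> ?I"
    then obtain v where "v \<in> \<nu> i" using \<nu>i(2) by blast
    then have "(i, v) \<in> S" using i unfolding S by blast
    then show "i \<in> fst ` S" by (rule rev_image_eqI) simp
  qed
  moreover have "\<not> ?I \<subseteq> fst ` (S \<inter> UNIV \<times> \<sigma>)"
    if \<sigma>: "\<sigma> \<in> \<Sigma>" for \<sigma>
  proof
    assume *: "?I \<subseteq> fst ` (S \<inter> UNIV \<times> \<sigma>)"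
    have "\<exists>v. v \<in> \<nu> i \<and> v \<in> \<sigma>" if i: "i \<in> ?I" for i
    proof -
      obtain x where "x \<in> S \<inter> UNIV \<times> \<sigma>" "i = fst x" using subsetD[OF * i] by (elim imageE)
      then show ?thesis unfolding S by (intro exI[of _ "snd x"]) auto
    qed
    then obtain \<eta> where \<eta>: "\<And>i. i \<in> ?I \<Longrightarrow> \<eta> i \<in> \<nu> i \<and>
      \<eta> i \<in> \<sigma>" by metis
    have "restrict \<eta> ?I \<in> Pi\<^sub>E ?I \<nu>" using \<eta> by (intro restrict_PiE_iff[THEN iffD2]) blast
    then have "restrict \<eta> ?I \<in> ramsey_vertices (boundary_simplex m) \<Sigma>" using \<nu>(2) by blast
    then have "{i \<in> ?I. restrict \<eta> ?I i \<in> \<sigma>} \<in> boundary_simplex m"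
      using \<sigma> unfolding ramsey_vertices_def I by blast
    moreover have "{i \<in> ?I. restrict \<eta> ?I i \<in> \<sigma>} = ?I" using \<eta> by auto
    ultimately show False by (simp add: boundary_simplex_def)
  qed
  ultimately show "S \<in> ramsey_cells ?I (vertices \<Sigma>) \<Sigma>" by (simp add: ramsey_cells_def)
next
  let ?I = "{1..m}"
  note I = vertices_boundary_simplex[OF m]
  fix S assume "S \<in> ramsey_cells ?I (vertices \<Sigma>) \<Sigma>"
  then have S: "S \<subseteq> ?I \<times> vertices \<Sigma>" "?I \<subseteq> fst ` S"
    "\<And>\<sigma>. \<sigma> \<in> \<Sigma> \<Longrightarrow>
      \<not> ?I \<subseteq> fst ` (S \<inter> UNIV \<times> \<sigma>)" unfolding ramsey_cells_def by blast+
  define \<nu> where "\<nu> = (\<lambda>i\<in>?I. S `` {i})"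
  have SS: "S = Sigma ?I \<nu>" using S(1) unfolding \<nu>_def by (auto simp: Sigma_def)
  have "\<nu> i \<in> Pow (vertices \<Sigma>) - {{}}" if i: "i \<in> ?I" for i
  proof -
    obtain x where "x \<in> S" "i = fst x" using subsetD[OF S(2) i] by (elim imageE)
    then have "snd x \<in> \<nu> i" using i by (simp add: \<nu>_def)
    moreover have "\<nu> i \<subseteq> vertices \<Sigma>" using i S(1) by (auto simp: \<nu>_def)
    ultimately show ?thesis by blast
  qed
  then have "\<nu> \<in> product_cells ?I (vertices \<Sigma>)"
    unfolding product_cells_def by (intro PiE_I) (auto simp: \<nu>_def)
  moreover have "Pi\<^sub>E ?I \<nu> \<subseteq> ramsey_vertices (boundary_simplex m) \<Sigma>"
  proof
    fix \<eta> assume \<eta>: "\<eta> \<in> Pi\<^sub>E ?I \<nu>"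
    have mem: "(i, \<eta> i) \<in> S" if "i \<in> ?I" for i
    proof -
      have "\<eta> i \<in> \<nu> i" using PiE_mem[OF \<eta> that] .
      then show ?thesis using that unfolding SS by blast
    qed
    have "\<eta> \<in> ?I \<rightarrow>\<^sub>E vertices \<Sigma>"
    proof (rule PiE_I)
      show "\<eta> i \<in> vertices \<Sigma>" if "i \<in> ?I" for i using mem[OF that] S(1) by blast
      show "\<eta> i = undefined" if "i \<notin> ?I" for i using \<eta> that by (rule PiE_arb)
    qed
    moreover have "{i \<in> ?I. \<eta> i \<in> \<sigma>} \<in> boundary_simplex m"
      if \<sigma>: "\<sigma> \<in> \<Sigma>" for \<sigma>
    proof -
      have "{i \<in> ?I. \<eta> i \<in> \<sigma>} \<noteq> ?I"
      proof
        assume eq: "{i \<in> ?I. \<eta> i \<in> \<sigma>} = ?I"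
        have "?I \<subseteq> fst ` (S \<inter> UNIV \<times> \<sigma>)"
        proof
          fix i assume i: "i \<in> ?I"
          then have "\<eta> i \<in> \<sigma>" using eq by blast
          then have "(i, \<eta> i) \<in> S \<inter> UNIV \<times> \<sigma>" using mem[OF i] by blast
          then show "i \<in> fst ` (S \<inter> UNIV \<times> \<sigma>)" by (rule rev_image_eqI) simp
        qed
        then show False using S(3)[OF \<sigma>] by blast
      qed
      then show ?thesis unfolding boundary_simplex_def by blast
    qed
    ultimately show "\<eta> \<in> ramsey_vertices (boundary_simplex m) \<Sigma>"
      unfolding ramsey_vertices_def I by blast
  qed
  ultimately have "\<nu> \<in> Ram (boundary_simplex m) \<Sigma>"
    by (simp add: Ram_def induced_subcomplex_def I)
  then show "S \<in> Sigma ?I ` Ram (boundary_simplex m) \<Sigma>" unfolding SS by (rule imageI)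
qed

lemma colour_cellD:
  assumes "S \<in> ramsey_cells I {1..n} ((\<lambda>c. {c}) ` {1..n})"
  shows "S \<subseteq> I \<times> {1..n}" "I \<subseteq> fst ` S" "c \<in> {1..n} \<Longrightarrow>
    \<not> I \<subseteq> fst ` (S \<inter> UNIV \<times> {c})"
proof -
  have S: "S \<subseteq> I \<times> {1..n} \<and> I \<subseteq> fst ` S \<and>
    (\<forall>\<sigma>\<in>(\<lambda>c. {c}) ` {1..n}. \<not> I \<subseteq> fst ` (S \<inter> UNIV \<times>
      \<sigma>))"
    using assms unfolding ramsey_cells_def by (rule CollectD)
  then show "S \<subseteq> I \<times> {1..n}" "I \<subseteq> fst ` S"
    by (rule conjunct1, rule conjunct2[THEN conjunct1])
  show "\<not> I \<subseteq> fst ` (S \<inter> UNIV \<times> {c})" if "c \<in> {1..n}"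
    by (rule bspec[OF S[THEN conjunct2, THEN conjunct2] imageI[OF that]])
qed

text \<open>Each colour misses some index. Since counting elements shifts the dimension by
  \<open>card I\<close>, this bounds the dimension by
  \<open>(n - 1) * (card I - 1) - 1\<close>.\<close>

lemma card_ramsey_cell_colours:
  assumes I: "finite I" "I \<noteq> {}" and S: "S \<in> ramsey_cells I {1..n} ((\<lambda>c. {c}) ` {1..n})"
  shows "card S \<le> n * (card I - 1)"
proof -
  note SS = S[THEN colour_cellD(1)] S[THEN colour_cellD(3)]
  have "card (S \<inter> UNIV \<times> {c}) \<le> card I - 1" if c: "c \<in> {1..n}" for c
  proof -
    have "inj_on fst (S \<inter> UNIV \<times> {c})" by (auto simp: inj_on_def)
    then have "card (S \<inter> UNIV \<times> {c}) = card (fst ` (S \<inter> UNIV \<times> {c}))"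
      by (rule card_image[symmetric])
    also have "\<dots> < card I"
    proof (rule psubset_card_mono[OF I(1)])
      have "fst ` (S \<inter> UNIV \<times> {c}) \<subseteq> I"
        by (rule image_subsetI) (use SS(1) in force)
      then show "fst ` (S \<inter> UNIV \<times> {c}) \<subset> I" using SS(2)[OF c] by blast
    qed
    finally show ?thesis by simp
  qed
  note bound = this
  have "S = (\<Union>c\<in>{1..n}. S \<inter> UNIV \<times> {c})" using SS(1) by auto
  then have "card S = card (\<Union>c\<in>{1..n}. S \<inter> UNIV \<times> {c})" by (rule arg_cong)
  also have "\<dots> \<le> (\<Sum>c\<in>{1..n}. card (S \<inter> UNIV \<times> {c}))" by (rule card_UN_le) simp
  also have "\<dots> \<le> (\<Sum>c\<in>{1..n}. card I - 1)" by (rule sum_mono) (rule bound)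
  finally show ?thesis by simp
qed

theorem theorem1:
  fixes \<Sigma> :: "'a set set" and n p k :: nat
  assumes "finite_simplicial_complex \<Sigma>"
    and "n \<ge> 1"
    and "prime p" and "k \<ge> 1"
    and "\<And>i :: int. i \<le> (int n - 1) * (int (p ^ k) - 1) - 1 \<Longrightarrow>
           trivial_group (reduced_cohomology_group (vertices (boundary_simplex (p ^ k)))
             (Ram (boundary_simplex (p ^ k)) \<Sigma>) (integer_mod_group p) i)"
  shows "\<not> (\<exists>col. col \<in> vertices \<Sigma> \<rightarrow> {1..n} \<and>
               (\<forall>j\<in>{1..n}. {v \<in> vertices \<Sigma>. col v = j} \<in> \<Sigma>))"
proof
  assume "\<exists>col. col \<in> vertices \<Sigma> \<rightarrow> {1..n} \<and>
    (\<forall>j\<in>{1..n}. {v \<in> vertices \<Sigma>. col v = j} \<in> \<Sigma>)"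
  then obtain col where col: "\<And>v. v \<in> vertices \<Sigma> \<Longrightarrow> col v \<in> {1..n}"
    "\<And>j. j \<in> {1..n} \<Longrightarrow> {v \<in> vertices \<Sigma>. col v = j} \<in> \<Sigma>" by blast
  define m where "m = p ^ k"
  define I where "I = {1..m}"
  define V where "V = vertices \<Sigma>"
  define X where "X = Ram (boundary_simplex m) \<Sigma>"
  define q where "q = (n - 1) * (m - 1)"
  define P where "P = ramsey_cells I V \<Sigma>"
  define P' where "P' = ramsey_cells I {1..n} ((\<lambda>c. {c}) ` {1..n})"
  have "p ^ 1 \<le> p ^ k" using assms(4) prime_gt_0_nat[OF assms(3)] by (intro power_increasing) auto
  then have m: "m \<ge> 2" using prime_ge_2_nat[OF assms(3)] by (simp add: m_def)
  have I_vert: "vertices (boundary_simplex m) = I" unfolding I_def by (rule vertices_boundary_simplex[OF m])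
  have I: "finite I" "I \<noteq> {}" "card I = m" using m by (auto simp: I_def)
  have triv: "trivial_group (reduced_cohomology_group I X (integer_mod_group p) i)" if "i < int q" for i
  proof -
    have "int q = (int n - 1) * (int (p ^ k) - 1)" using assms(2) m by (simp add: q_def m_def of_nat_diff)
    then show ?thesis using assms(5)[of i] that by (simp add: I_vert[symmetric] X_def m_def)
  qed
  \<comment> \<open>This degree is covered even for \<open>n = 1\<close>, where \<open>q = 0\<close>
    and only a vertex of \<open>X\<close> is needed.\<close>
  have triv': "trivial_group (reduced_cohomology_group I X (integer_mod_group p) (- 1))"
    by (rule triv) simp
  have fc: "finite_simplicial_complex (boundary_simplex m)"
    by (rule finite_simplicial_complex_boundary_simplex) (use m in simp)
  interpret S: simplex_product_mod I V X p
    using simplex_product_subcomplex_Ram[OF fc assms(1)] assms(3)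
    by (simp add: simplex_product_mod_def simplex_product_mod_axioms_def X_def V_def I_vert)
  have graphs: "Sigma I ` X = P" unfolding I_def X_def P_def V_def by (rule Ram_graphs[OF m assms(1)])
  have cardI: "card I = p ^ k" unfolding I(3) by (rule m_def)
  from exists_transitive_action[OF I(1) cardI prime_gt_0_nat[OF assms(3)]]
  obtain \<gamma> where act: "\<forall>j<k. bij_betw (\<gamma> j) I I" "\<forall>j<k. \<forall>x. x \<notin> I
    \<longrightarrow> \<gamma> j x = x"
    "\<forall>i<k. \<forall>j<k. \<forall>x. \<gamma> i (\<gamma> j x) =
      \<gamma> j (\<gamma> i x)" "\<forall>j<k. \<forall>x. (\<gamma> j ^^ p) x = x"
    and trans: "\<forall>B. B \<subseteq> I \<longrightarrow> B \<noteq> {} \<longrightarrow>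
      (\<forall>j<k. \<gamma> j ` B \<subseteq> B) \<longrightarrow> B = I"
    by (elim exE conjE)
  note \<gamma> = act[rule_format]
  have gridX: "grid I V P \<gamma> p k" unfolding P_def
    by (rule grid_ramsey_cells[OF I(1) S.finite_V assms(3) \<gamma>])
  have gridY: "grid I {1..n} P' \<gamma> p k" unfolding P'_def
    by (rule grid_ramsey_cells[OF I(1) finite_atLeastAtMost assms(3) \<gamma>])
  interpret F: grid_map I V P "{1..n}" P' \<gamma> p k col
  proof (intro grid_map.intro gridX gridY grid_map_axioms.intro)
    show "col v \<in> {1..n}" if "v \<in> V" for v using col(1) that unfolding V_def .
    fix S assume "S \<in> P"
    then have S: "S \<subseteq> I \<times> V" "I \<subseteq> fst ` S" "\<And>\<sigma>. \<sigma> \<in> \<Sigma>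
      \<Longrightarrow> \<not> I \<subseteq> fst ` (S \<inter> UNIV \<times> \<sigma>)"
      unfolding P_def ramsey_cells_def by blast+
    have fst: "fst ` map_prod id col ` T = fst ` T" for T :: "(nat \<times> 'a) set"
      by (simp only: image_image fst_map_prod id_apply)
    \<comment> \<open>A constant colouring \<open>c\<close> in the image of \<open>S\<close> would
      mean that \<open>S\<close> meets every index over the colour class of \<open>c\<close>, which
      is a face.\<close>
    have int: "map_prod id col ` S \<inter> UNIV \<times> {c} =
      map_prod id col ` (S \<inter> UNIV \<times> {v \<in> V. col v = c})" for c
      using S(1) by auto
    show "map_prod id col ` S \<in> P'"
      unfolding P'_def ramsey_cells_def
    proof (intro CollectI conjI ballI)
      show "map_prod id col ` S \<subseteq> I \<times> {1..n}"
      proof (rule image_subsetI)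
        fix x assume "x \<in> S"
        then obtain i v where "x = (i, v)" "i \<in> I" "v \<in> V" using S(1) by blast
        then show "map_prod id col x \<in> I \<times> {1..n}" using col(1)[of v] by (simp add: V_def)
      qed
      show "I \<subseteq> fst ` map_prod id col ` S" unfolding fst by (rule S(2))
      fix \<sigma> assume "\<sigma> \<in> (\<lambda>c. {c}) ` {1..n}"
      then obtain c where c: "\<sigma> = {c}" "c \<in> {1..n}" by (elim imageE)
      show "\<not> I \<subseteq> fst ` (map_prod id col ` S \<inter> UNIV \<times> \<sigma>)"
        unfolding c(1) int fst V_def by (rule S(3)[OF col(2)[OF c(2)]])
    qed
  qed
  interpret OG: ordered_grid I V P \<gamma> p k S.lex fixed_less
  proof (intro ordered_grid.intro gridX ordered_grid_axioms.intro)
    show "ordered_complex (I \<times> V) P S.lex" using S.S.ordered_complex_axioms unfolding graphs .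
    show "S.lex (i, v) (j, w) \<longleftrightarrow> fixed_less i j" if "i \<noteq> j" for i j v w using that
      by (simp add: S.lex_def)
  qed
  have "X \<noteq> {}" by (rule S.nonempty[OF triv'])
  have start: "\<exists>c. F.X.chain (card I) c \<and> F.X.aug c = 1"
  proof -
    obtain \<nu> where \<nu>: "\<nu> \<in> X" using \<open>X \<noteq> {}\<close> by blast
    have "\<exists>v. v \<in> \<nu> i" if "i \<in> I" for i using S.cellD(2)[OF \<nu> that] by blast
    then obtain \<eta> where \<eta>: "\<And>i. i \<in> I \<Longrightarrow> \<eta> i \<in> \<nu> i" by metis
    have "(\<lambda>i. (i, \<eta> i)) ` I \<in> P"
    proof (rule F.X.faces)
      show "Sigma I \<nu> \<in> P" using imageI[OF \<nu>, of "Sigma I"] unfolding graphs .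
      show "(\<lambda>i. (i, \<eta> i)) ` I \<subseteq> Sigma I \<nu>" using \<eta> by blast
      show "I \<subseteq> fst ` (\<lambda>i. (i, \<eta> i)) ` I" by (simp add: image_image)
    qed
    moreover have "card ((\<lambda>i. (i, \<eta> i)) ` I) = card I" by (rule card_image) (simp add: inj_on_def)
    ultimately show ?thesis by (intro OG.vertex_chain) (simp add: OG.cells_def)
  qed
  have fill0: "\<exists>e. F.X.chain (Suc (card I)) e \<and> congruent_mod p (app F.X.boundary e) c"
    if q: "0 < q" and c: "F.X.chain (card I) c" "congruent_mod p (F.X.aug c) 0" for c
  proof (rule OG.fill_chain[OF assms(3) c(1)])
    fix f r assume f: "\<And>S. S \<in> OG.cells (Suc (card I)) \<Longrightarrow>
      [OG.set_coboundary f S = 0] (mod int p)"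
    have "trivial_group (reduced_cohomology_group I X (integer_mod_group p) 0)" by (rule triv) (use q in simp)
    from S.set_cocycle_imp_constant[OF this, unfolded graphs, OF f]
    obtain s where s: "\<And>S. S \<in> OG.cells (card I) \<Longrightarrow> [f S = s] (mod int p)" by blast
    \<comment> \<open>A constant cocycle pairs with \<open>c\<close> to a multiple of the
      augmentation of \<open>c\<close>, up to a sign.\<close>
    have "congruent_mod p (of_int OG.order_sign * F.X.aug c) 0" by (rule congruent_mod_0_mult[OF c(2)])
    then have "congruent_mod p (\<Sum>S\<in>OG.cells (card I). OG.set_chain c S) 0"
      unfolding OG.aug_set_chain[OF c(1)] mult.assoc[symmetric] of_int_mult[symmetric] OG.order_sign_square by simp
    then have z: "[(\<Sum>S\<in>OG.cells (card I). coeff (OG.set_chain c S) r) = 0] (mod int p)"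
      by (simp add: OG.congruent_mod_poly_iff coeff_sum)
    have "[(\<Sum>S\<in>OG.cells (card I). coeff (OG.set_chain c S) r * f S) =
        (\<Sum>S\<in>OG.cells (card I). coeff (OG.set_chain c S) r * s)] (mod int p)"
      by (intro cong_sum cong_mult cong_refl s)
    also have "(\<Sum>S\<in>OG.cells (card I). coeff (OG.set_chain c S) r * s) =
        (\<Sum>S\<in>OG.cells (card I). coeff (OG.set_chain c S) r) * s" by (rule sum_distrib_right[symmetric])
    also have "[\<dots> = 0 * s] (mod int p)" by (rule cong_mult[OF z cong_refl])
    finally show "[(\<Sum>S\<in>OG.cells (card I). coeff (OG.set_chain c S) r * f S) = 0] (mod int p)" by simp
  qed
  have fill: "\<exists>e. F.X.chain (Suc (card I + i)) e \<and> congruent_mod p (app F.X.boundary e) c"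
    if i: "0 < i" "i < q" and c: "F.X.chain (card I + i) c" "congruent_mod p (app F.X.boundary c) 0" for i c
  proof (rule OG.fill_chain[OF assms(3) c(1)])
    fix f r assume f: "\<And>S. S \<in> OG.cells (Suc (card I + i)) \<Longrightarrow>
      [OG.set_coboundary f S = 0] (mod int p)"
    obtain i' where i': "i = Suc i'" using i(1) by (cases i) auto
    have "trivial_group (reduced_cohomology_group I X (integer_mod_group p) (int (Suc i')))"
      by (rule triv) (use i i' in simp)
    from S.set_cocycle_imp_coboundary[OF this, unfolded graphs, OF f[unfolded i' add_Suc_right]]
    obtain h where h: "\<And>S. S \<in> OG.cells (Suc (card I + i')) \<Longrightarrow>
      [f S = OG.set_coboundary h S] (mod int p)"
      by blast
    have c': "F.X.chain (Suc (card I + i')) c" using c(1) unfolding i' by simp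
    let ?z = "\<lambda>S. coeff (OG.set_chain c S) r"
    have "[(\<Sum>S\<in>OG.cells (Suc (card I + i')). ?z S * f S) =
        (\<Sum>S\<in>OG.cells (Suc (card I + i')). ?z S * OG.set_coboundary h S)] (mod int p)"
      by (intro cong_sum cong_mult cong_refl h)
    \<comment> \<open>The cocycle is a coboundary, and by adjunction its pairing with a cycle
      vanishes.\<close>
    also have "(\<Sum>S\<in>OG.cells (Suc (card I + i')). ?z S * OG.set_coboundary h S) =
        (\<Sum>R\<in>OG.cells (card I + i'). OG.set_boundary ?z R * h R)"
      by (rule OG.boundary_coboundary_adjoint)
    also have "[\<dots> = (\<Sum>R\<in>OG.cells (card I + i'). 0 * h R)] (mod int p)"
      by (intro cong_sum cong_mult cong_refl OG.coeff_set_boundary_set_chain[OF c' c(2)])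
    finally show "[(\<Sum>S\<in>OG.cells (card I + i). ?z S * f S) = 0] (mod int p)" unfolding i' by simp
  qed
  from start obtain c0 where c0: "F.X.chain (card I) c0" "F.X.aug c0 = 1" by blast
  have "\<exists>\<phi>. F.X.resolution q \<phi>"
    by (rule F.X.resolution_exists[OF c0(1) _ fill0 fill]) (simp add: c0(2))
  then obtain \<phi> where \<phi>: "F.X.resolution q \<phi>" by blast
  have res: "F.Y.resolution q (\<lambda>i. F.push (\<phi> i))" by (rule F.resolution_push[OF \<phi>])
  have top: "F.push (\<phi> q) = 0"
  proof (rule ext, rule ccontr)
    fix l assume "F.push (\<phi> q) l \<noteq> 0 l"
    then have nz: "F.push (\<phi> q) l \<noteq> 0" by simp
    have ch: "F.Y.chain (card I + q) (F.push (\<phi> q))" using res unfolding F.Y.resolution_def by blast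
    have "set l \<in> P'" "length l = card I + q" "distinct l"
      using F.Y.chain_support[OF ch nz] F.Y.chain_distinct[OF ch nz] by auto
    \<comment> \<open>The two sides miss each other by exactly one: \<open>n * (m - 1)\<close> is
      \<open>m + q - 1\<close>.\<close>
    then have "m + q \<le> n * (m - 1)"
      using card_ramsey_cell_colours[OF I(1,2), of "set l" n] I(3) unfolding P'_def by (simp add: distinct_card)
    moreover have "n * (m - 1) = q + (m - 1)" using assms(2) unfolding q_def by (cases n) auto
    ultimately show False using m by simp
  qed
  show False
  proof (rule F.Y.no_resolution[OF _ res top])
    fix S assume S: "S \<in> P'"
    show "\<exists>j<k. map_prod (\<gamma> j) id ` S \<noteq> S"
    proof (rule ccontr)
      assume "\<not> ?thesis"
      then have fixed: "map_prod (\<gamma> j) id ` S = S" if "j < k" for j using that by blast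
      note SS = S[unfolded P'_def, THEN colour_cellD(1)] S[unfolded P'_def, THEN colour_cellD(2)]
        S[unfolded P'_def, THEN colour_cellD(3)]
      obtain i c where ic: "(i, c) \<in> S" using SS(2) I(2) by fastforce
      have c: "c \<in> {1..n}" using ic SS(1) by blast
      \<comment> \<open>In a fixed cell the indices that carry the colour \<open>c\<close> form an
        invariant set; transitivity makes it all of \<open>I\<close>, and the constant colouring
        \<open>c\<close> lies in the cell.\<close>
      have "{i. (i, c) \<in> S} = I"
      proof (rule trans[rule_format])
        show "{i. (i, c) \<in> S} \<subseteq> I" using SS(1) by blast
        show "{i. (i, c) \<in> S} \<noteq> {}" using ic by blast
        show "\<gamma> j ` {i. (i, c) \<in> S} \<subseteq> {i. (i, c) \<in> S}" if "j < k" for j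
        proof (rule image_subsetI)
          fix x assume "x \<in> {i. (i, c) \<in> S}"
          then have "map_prod (\<gamma> j) id (x, c) \<in> map_prod (\<gamma> j) id ` S" by (intro imageI) simp
          then show "\<gamma> j x \<in> {i. (i, c) \<in> S}" unfolding fixed[OF that] by simp
        qed
      qed
      then have "I \<subseteq> fst ` (S \<inter> UNIV \<times> {c})" by force
      then show False using SS(3)[OF c] by blast
    qed
  qed
qed

end
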